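(* Let $n\ge 1$ and let $S(t)$, $t\in I$ ($I\subset\mathbb{R}$ an open interval), be a smooth evolution of a smooth closed hypersurface embedded in the Euclidean space $\mathbb{R}^{n+1}$. Let $B$ denote the Gauss-Kronecker curvature of $S(t)$ and $dS$ its $n$-dimensional surface area element. Then $$\frac{d}{dt}\int_{S(t)} B\,dS = 0\qquad\text{for all } t\in I .$$ Consequently the integral $\int_S B\,dS$ is independent of shape in the following sense: for any $t_0,t_1\in I$, $\int_{S(t_0)}B\,dS=\int_{S(t_1)}B\,dS$, i.e. the integral takes the same value on any two such hypersurfaces related by a smooth evolution.
   Context: "Closed" means compact and without boundary. A smooth evolution $S(t)$, $t\in I$, means: there is a closed smooth $n$-manifold $M$ and a smooth map $F:M\times I\to\mathbb{R}^{n+1}$ such that for every $t$ the map $F_t=F(\cdot,t)$ is a smooth embedding with image $S(t)$; a unit normal field $\mathbf{N}$ on $S(t)$ is chosen to depend smoothly on the point of $M$ and on $t$. In local coordinates $(u^1,\dots,u^n)$ on $M$, the covariant basis is $\mathbf{S}_\alpha=\partial F_t/\partial u^\alpha$, the metric tensor is $S_{\alpha\beta}=\mathbf{S}_\alpha\cdot\mathbf{S}_\beta$ with inverse $S^{\alpha\beta}$, and the surface element is $dS=\sqrt{\det(S_{\alpha\beta})}\,du^1\cdots du^n$. The curvature tensor (second fundamental form / shape operator) is $B_{\alpha\beta}=\mathbf{N}\cdot\partial^2F_t/\partial u^\alpha\partial u^\beta$ and $B^\alpha_\beta=S^{\alpha\gamma}B_{\gamma\beta}$ (summation over repeated indices).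 The Gauss-Kronecker curvature is $B=\det(B^\alpha_\beta)$, equivalently the product of the $n$ principal curvatures (the eigenvalues of $B^\alpha_\beta$). For $n=1$ it is the signed curvature of the curve. *)

theory Defs
  imports "HOL-Analysis.Analysis"
begin

section \<open>Smooth maps between Euclidean spaces\<close>

text \<open>Only meant for open sets \<open>U\<close>: derivatives are taken with respect to full neighbourhoods.\<close>

primrec Ck_on :: "nat \<Rightarrow> 'a::euclidean_space set \<Rightarrow> ('a \<Rightarrow> 'b::real_normed_vector) \<Rightarrow> bool" where
  "Ck_on 0 U f \<longleftrightarrow> continuous_on U f"
| "Ck_on (Suc k) U f \<longleftrightarrow>
     (\<forall>x\<in>U. f differentiable (at x)) \<and>
     (\<forall>v. Ck_on k U (\<lambda>x. frechet_derivative f (at x) v))"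

definition smooth_on :: "'a::euclidean_space set \<Rightarrow> ('a \<Rightarrow> 'b::real_normed_vector) \<Rightarrow> bool" where
  "smooth_on U f \<longleftrightarrow> (\<forall>k. Ck_on k U f)"

section \<open>Closed smooth manifolds\<close>

text \<open>A chart \<open>(U, \<phi>)\<close> consists of its domain and its coordinate map; values of \<open>\<phi>\<close> outside
  \<open>U\<close> are irrelevant. The dimension of the manifold is \<open>CARD('n)\<close>, which is at least 1.\<close>

type_synonym ('a, 'n) chart = "'a set \<times> ('a \<Rightarrow> real ^ 'n)"

definition is_chart :: "'a topology \<Rightarrow> ('a, 'n::finite) chart \<Rightarrow> bool" where
  "is_chart X = (\<lambda>(U, \<phi>). openin X U \<and> open (\<phi> ` U) \<and>
     homeomorphic_map (subtopology X U) (top_of_set (\<phi> ` U)) \<phi>)"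

definition smooth_atlas :: "'a topology \<Rightarrow> ('a, 'n::finite) chart set \<Rightarrow> bool" where
  "smooth_atlas X \<A> \<longleftrightarrow>
     (\<forall>c\<in>\<A>. is_chart X c) \<and>
     (\<Union>(U, \<phi>)\<in>\<A>. U) = topspace X \<and>
     (\<forall>(U, \<phi>)\<in>\<A>. \<forall>(V, \<psi>)\<in>\<A>. smooth_on (\<phi> ` (U \<inter> V)) (\<psi> \<circ> inv_into U \<phi>))"

definition closed_smooth_manifold :: "'a topology \<Rightarrow> ('a, 'n::finite) chart set \<Rightarrow> bool" where
  "closed_smooth_manifold X \<A> \<longleftrightarrow>
     Hausdorff_space X \<and> second_countable X \<and> compact_space X \<and> smooth_atlas X \<A>"

section \<open>Smooth evolutions of embedded hypersurfaces\<close>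

definition smooth_embedding ::
    "'a topology \<Rightarrow> ('a, 'n::finite) chart set \<Rightarrow> ('a \<Rightarrow> 'b::euclidean_space) \<Rightarrow> bool" where
  "smooth_embedding X \<A> f \<longleftrightarrow>
     embedding_map X euclidean f \<and>
     (\<forall>(U, \<phi>)\<in>\<A>. smooth_on (\<phi> ` U) (f \<circ> inv_into U \<phi>) \<and>
        (\<forall>u\<in>\<phi> ` U. inj (frechet_derivative (f \<circ> inv_into U \<phi>) (at u))))"

text \<open>Smoothness of a map on the product of the manifold with an open interval.\<close>

definition smooth_family ::
    "('a, 'n::finite) chart set \<Rightarrow> real set \<Rightarrow> ('a \<Rightarrow> real \<Rightarrow> 'b::euclidean_space) \<Rightarrow> bool" where
  "smooth_family \<A> I G \<longleftrightarrow>
     (\<forall>(U, \<phi>)\<in>\<A>. smooth_on (\<phi> ` U \<times> I) (\<lambda>(u, t). G (inv_into U \<phi> u) t))"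

definition partial_deriv :: "'n::finite \<Rightarrow> (real ^ 'n \<Rightarrow> 'b::real_normed_vector) \<Rightarrow> real ^ 'n \<Rightarrow> 'b" where
  "partial_deriv \<alpha> f u = frechet_derivative f (at u) (axis \<alpha> 1)"

definition unit_normal_field ::
    "'a topology \<Rightarrow> ('a, 'n::finite) chart set \<Rightarrow> ('a \<Rightarrow> 'b::euclidean_space) \<Rightarrow> ('a \<Rightarrow> 'b) \<Rightarrow> bool" where
  "unit_normal_field X \<A> f \<nu> \<longleftrightarrow>
     (\<forall>p\<in>topspace X. norm (\<nu> p) = 1) \<and>
     (\<forall>(U, \<phi>)\<in>\<A>. \<forall>p\<in>U. \<forall>\<alpha>. \<nu> p \<bullet> partial_deriv \<alpha> (f \<circ> inv_into U \<phi>) (\<phi> p) = 0)"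

definition smooth_evolution ::
    "'a topology \<Rightarrow> ('a, 'n::finite) chart set \<Rightarrow> real set \<Rightarrow>
     ('a \<Rightarrow> real \<Rightarrow> 'b::euclidean_space) \<Rightarrow> ('a \<Rightarrow> real \<Rightarrow> 'b) \<Rightarrow> bool" where
  "smooth_evolution X \<A> I F N \<longleftrightarrow>
     smooth_family \<A> I F \<and> (\<forall>t\<in>I. smooth_embedding X \<A> (\<lambda>p. F p t)) \<and>
     smooth_family \<A> I N \<and> (\<forall>t\<in>I. unit_normal_field X \<A> (\<lambda>p. F p t) (\<lambda>p. N p t))"

section \<open>Metric, curvature and surface element\<close>

text \<open>Here \<open>r\<close> and \<open>\<nu>\<close> are the embedding and the unit normal in local coordinates.\<close>

definition metric_tensor :: "(real ^ 'n::finite \<Rightarrow> 'b::euclidean_space) \<Rightarrow> real ^ 'n \<Rightarrow> real ^ 'n ^ 'n" where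
  "metric_tensor r u = (\<chi> \<alpha> \<beta>. partial_deriv \<alpha> r u \<bullet> partial_deriv \<beta> r u)"

definition curvature_tensor ::
    "(real ^ 'n::finite \<Rightarrow> 'b::euclidean_space) \<Rightarrow> (real ^ 'n \<Rightarrow> 'b) \<Rightarrow> real ^ 'n \<Rightarrow> real ^ 'n ^ 'n" where
  "curvature_tensor r \<nu> u = (\<chi> \<alpha> \<beta>. \<nu> u \<bullet> partial_deriv \<alpha> (partial_deriv \<beta> r) u)"

definition shape_operator ::
    "(real ^ 'n::finite \<Rightarrow> 'b::euclidean_space) \<Rightarrow> (real ^ 'n \<Rightarrow> 'b) \<Rightarrow> real ^ 'n \<Rightarrow> real ^ 'n ^ 'n" where
  "shape_operator r \<nu> u = matrix_inv (metric_tensor r u) ** curvature_tensor r \<nu> u"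

text \<open>The Gauss--Kronecker curvature at a point of the manifold: the common value of the
  determinant of the shape operator in all charts around the point.\<close>

definition gauss_kronecker ::
    "('a, 'n::finite) chart set \<Rightarrow> ('a \<Rightarrow> 'b::euclidean_space) \<Rightarrow> ('a \<Rightarrow> 'b) \<Rightarrow> 'a \<Rightarrow> real" where
  "gauss_kronecker \<A> f \<nu> p =
     (THE k. \<forall>(U, \<phi>)\<in>\<A>. p \<in> U \<longrightarrow>
        k = det (shape_operator (f \<circ> inv_into U \<phi>) (\<nu> \<circ> inv_into U \<phi>) (\<phi> p)))"

text \<open>The surface element of the image of an embedding \<open>f\<close>, transported to the manifold by \<open>f\<close>:
  the unique Borel measure that has density \<open>sqrt (det S)\<close>, for \<open>S\<close> the metric tensor,
  with respect to Lebesgue measure in every chart.\<close>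

definition surface_element ::
    "'a topology \<Rightarrow> ('a, 'n::finite) chart set \<Rightarrow> ('a \<Rightarrow> 'b::euclidean_space) \<Rightarrow> 'a measure" where
  "surface_element X \<A> f =
     (THE \<mu>. sets \<mu> = sets (sigma (topspace X) {U. openin X U}) \<and>
        (\<forall>(U, \<phi>)\<in>\<A>. \<forall>A\<in>sets \<mu>. A \<subseteq> U \<longrightarrow>
           emeasure \<mu> A =
             (\<integral>\<^sup>+u\<in>\<phi> ` A. ennreal (sqrt (det (metric_tensor (f \<circ> inv_into U \<phi>) u))) \<partial>lborel)))"

definition total_curvature ::
    "'a topology \<Rightarrow> ('a, 'n::finite) chart set \<Rightarrow> ('a \<Rightarrow> 'b::euclidean_space) \<Rightarrow> ('a \<Rightarrow> 'b) \<Rightarrow> real" where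
  "total_curvature X \<A> f \<nu> = (\<integral>p. gauss_kronecker \<A> f \<nu> p \<partial>surface_element X \<A> f)"

end

theory Submission
  imports Defs
begin

text \<open>
  The total curvature is, up to sign, the volume that the Gauss map \<open>N\<close> sweeps out on the unit
  sphere. In a chart, the Weingarten equations say that
  \<open>B = (-1)^n det (N, \<partial>\<^sub>1N, ..., \<partial>\<^sub>nN) / det (N, \<partial>\<^sub>1F, ..., \<partial>\<^sub>nF)\<close>, and the denominator is the
  density of the surface element up to sign (\<open>det_shape_operator\<close>, \<open>det_metric_tensor\<close>). Under a
  change of charts both determinants are multiplied by the same Jacobian determinant
  (\<open>jet_det_transition\<close>), so such quotients are functions on the manifold, and no orientation has
  to be chosen. As \<open>det (N, \<partial>\<^sub>1F, ..., \<partial>\<^sub>nF)\<close> never vanishes, its sign is constant in time, and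
  the total curvatures at all times are integrals against the surface element at one fixed time
  \<open>t\<^sub>0\<close> (\<open>total_curvature_relative\<close>).

  The swept volume makes sense for every map \<open>p \<mapsto> N (p, \<tau> p)\<close> with a smooth function \<open>\<tau>\<close> of the
  point in place of a constant time. This freedom replaces partitions of unity and integration by
  parts on the manifold: the time is advanced from \<open>t\<^sub>0\<close> to \<open>t\<^sub>1\<close> in finitely many moves
  \<open>\<tau> \<mapsto> \<tau> + \<eta> (t\<^sub>1 - \<tau>)\<close>, where \<open>\<eta>\<close> is a bump function inside one chart and the regions \<open>\<eta> = 1\<close>
  cover the manifold (\<open>gauss_map_volume_constant\<close>). A single move does not change the volume
  (\<open>gauss_map_volume_local_change\<close>), since it is a homotopy of sphere-valued maps on a box that is
  constant near the boundary. There the claim is the divergence theorem for the determinants formed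
  from \<open>G\<close> and all but one of its partial derivatives in space-time: their divergence is a multiple
  of \<open>det (\<partial>\<^sub>iG)\<^sub>i\<close>, all of whose rows are orthogonal to \<open>G\<close>, plus terms with mixed second
  derivatives that cancel in pairs (\<open>divergence_free\<close>, \<open>frame_integral_homotopy\<close>).

  The surface element is defined by a description, so its existence and uniqueness are part of the
  proof (\<open>has_chart_density_exists\<close>, \<open>has_chart_density_unique\<close>); this is where compactness and the
  change of variables formula for Lebesgue measure enter.
\<close>

section \<open>Calculus of continuously differentiable maps\<close>

lemma has_derivative_cong_open:
  assumes "open U" "x \<in> U" "\<And>y. y \<in> U \<Longrightarrow> f y = g y"
  shows "(f has_derivative D) (at x) \<longleftrightarrow> (g has_derivative D) (at x)"
  using has_derivative_transform_within_open[OF _ assms(1,2)] assms(3) by (metis (full_types))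

lemma frechet_derivative_cong_open:
  assumes "open U" "x \<in> U" "\<And>y. y \<in> U \<Longrightarrow> f y = g y"
  shows "frechet_derivative f (at x) = frechet_derivative g (at x)"
  using has_derivative_cong_open[OF assms] by (simp add: frechet_derivative_def)

lemma Ck_on_cong:
  assumes "open U" "\<And>x. x \<in> U \<Longrightarrow> f x = g x"
  shows "Ck_on k U f \<longleftrightarrow> Ck_on k U g"
  using assms(2)
proof (induction k arbitrary: f g)
  case 0
  then show ?case by (simp cong: continuous_on_cong)
next
  case (Suc k)
  have deriv: "(f has_derivative D) (at x) \<longleftrightarrow> (g has_derivative D) (at x)" if "x \<in> U" for x D
    using has_derivative_cong_open[OF assms(1) that] Suc.prems by blast
  have fd: "frechet_derivative f (at x) = frechet_derivative g (at x)" if "x \<in> U" for x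
    using frechet_derivative_cong_open[OF assms(1) that] Suc.prems by blast
  have "(\<forall>x\<in>U. f differentiable (at x)) \<longleftrightarrow> (\<forall>x\<in>U. g differentiable (at x))"
    unfolding differentiable_def using deriv by blast
  moreover have "Ck_on k U (\<lambda>x. frechet_derivative f (at x) v) \<longleftrightarrow> Ck_on k U (\<lambda>x. frechet_derivative g (at x) v)" for v
    by (rule Suc.IH) (simp add: fd)
  ultimately show ?case by simp
qed

lemma Ck_on_subset: "Ck_on k U f \<Longrightarrow> V \<subseteq> U \<Longrightarrow> Ck_on k V f"
  by (induction k arbitrary: f) (auto intro: continuous_on_subset)

lemma Ck_on_imp_continuous_on: "Ck_on k U f \<Longrightarrow> continuous_on U f"
  by (cases k) (auto intro!: continuous_at_imp_continuous_on differentiable_imp_continuous_within)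

lemma Ck_on_SucD: "Ck_on (Suc k) U f \<Longrightarrow> Ck_on k U f"
proof (induction k arbitrary: f)
  case 0
  from Ck_on_imp_continuous_on[OF this] show ?case by simp
next
  case (Suc k)
  then show ?case by auto
qed

lemma Ck_on_mono: "Ck_on l U f \<Longrightarrow> k \<le> l \<Longrightarrow> Ck_on k U f"
  by (induction l) (auto simp del: Ck_on.simps(2) simp: le_Suc_eq dest: Ck_on_SucD)

lemma Ck_on_Suc_has_derivative:
  "Ck_on (Suc k) U f \<Longrightarrow> x \<in> U \<Longrightarrow> (f has_derivative frechet_derivative f (at x)) (at x)"
  by (simp add: frechet_derivative_works)

lemma Ck_on_Suc_frechet: "Ck_on (Suc k) U f \<Longrightarrow> Ck_on k U (\<lambda>x. frechet_derivative f (at x) v)"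
  by simp

lemma Ck_on_imp_differentiable: "Ck_on k U f \<Longrightarrow> 1 \<le> k \<Longrightarrow> x \<in> U \<Longrightarrow> f differentiable (at x)"
  using Ck_on_mono[of k U f 1] by simp

lemma Ck_on_frechet: "Ck_on k U f \<Longrightarrow> Suc l \<le> k \<Longrightarrow> Ck_on l U (\<lambda>x. frechet_derivative f (at x) v)"
  using Ck_on_mono[of k U f "Suc l"] Ck_on_Suc_frechet by blast

lemma Ck_on_SucI:
  assumes "open U" "\<And>x. x \<in> U \<Longrightarrow> (f has_derivative f' x) (at x)" "\<And>v. Ck_on k U (\<lambda>x. f' x v)"
  shows "Ck_on (Suc k) U f"
proof -
  have "frechet_derivative f (at x) = f' x" if "x \<in> U" for x
    using assms(2)[OF that] frechet_derivative_at by metis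
  then have "Ck_on k U (\<lambda>x. frechet_derivative f (at x) v) \<longleftrightarrow> Ck_on k U (\<lambda>x. f' x v)" for v
    by (intro Ck_on_cong assms(1)) simp
  with assms show ?thesis by (auto simp: differentiable_def)
qed

lemma Ck_on_const: "open U \<Longrightarrow> Ck_on k U (\<lambda>x. c)"
proof (induction k arbitrary: c)
  case (Suc k)
  show ?case by (rule Ck_on_SucI[where f' = "\<lambda>x v. 0"]) (use Suc in auto)
qed simp

lemma Ck_on_bounded_linear: "open U \<Longrightarrow> bounded_linear f \<Longrightarrow> Ck_on k U f"
proof (cases k)
  case 0
  assume "bounded_linear f" with 0 show ?thesis by (simp add: linear_continuous_on)
next
  case (Suc l)
  assume "open U" "bounded_linear f"
  then show ?thesis unfolding Suc
    by (intro Ck_on_SucI[where f' = "\<lambda>x v. f v"])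
      (auto intro: bounded_linear_imp_has_derivative Ck_on_const)
qed

lemma Ck_on_linear_image:
  assumes "open U" "Ck_on k U f" "bounded_linear L"
  shows "Ck_on k U (\<lambda>x. L (f x))"
  using assms(2)
proof (induction k arbitrary: f)
  case 0
  then show ?case using assms(3) by (simp add: bounded_linear.continuous_on)
next
  case (Suc k)
  show ?case
    by (rule Ck_on_SucI[where f' = "\<lambda>x v. L (frechet_derivative f (at x) v)"])
      (use Suc assms in \<open>auto intro: bounded_linear.has_derivative[OF assms(3)] Ck_on_Suc_has_derivative simp del: Ck_on.simps(2) dest: Ck_on_Suc_frechet\<close>)
qed

lemma Ck_on_add:
  assumes "open U" "Ck_on k U f" "Ck_on k U g"
  shows "Ck_on k U (\<lambda>x. f x + g x)"
  using assms(2,3)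
proof (induction k arbitrary: f g)
  case 0
  then show ?case by (simp add: continuous_on_add)
next
  case (Suc k)
  show ?case
    by (rule Ck_on_SucI[where f' = "\<lambda>x v. frechet_derivative f (at x) v + frechet_derivative g (at x) v"])
      (use Suc assms in \<open>auto intro!: has_derivative_add intro: Ck_on_Suc_has_derivative simp del: Ck_on.simps(2) dest: Ck_on_Suc_frechet\<close>)
qed

lemma Ck_on_sum:
  assumes "open U" "\<And>i. i \<in> A \<Longrightarrow> Ck_on k U (f i)"
  shows "Ck_on k U (\<lambda>x. \<Sum>i\<in>A. f i x)"
  using assms(2)
  by (induction A rule: infinite_finite_induct) (auto intro: Ck_on_const Ck_on_add assms(1))

lemma Ck_on_bilinear:
  assumes "open U" "bounded_bilinear B" "Ck_on k U f" "Ck_on k U g"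
  shows "Ck_on k U (\<lambda>x. B (f x) (g x))"
  using assms(3,4)
proof (induction k arbitrary: f g)
  case 0
  then show ?case using assms(2) by (simp add: bounded_bilinear.continuous_on)
next
  case (Suc k)
  show ?case
  proof (rule Ck_on_SucI[where f' = "\<lambda>x v. B (f x) (frechet_derivative g (at x) v) + B (frechet_derivative f (at x) v) (g x)"])
    show "((\<lambda>x. B (f x) (g x)) has_derivative
         (\<lambda>v. B (f x) (frechet_derivative g (at x) v) + B (frechet_derivative f (at x) v) (g x))) (at x)"
      if "x \<in> U" for x
      by (rule bounded_bilinear.FDERIV[OF assms(2)]) (use that Suc.prems in \<open>auto intro: Ck_on_Suc_has_derivative simp del: Ck_on.simps(2)\<close>)
    show "Ck_on k U (\<lambda>x. B (f x) (frechet_derivative g (at x) v) + B (frechet_derivative f (at x) v) (g x))" for v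
      by (intro Ck_on_add assms(1) Suc.IH Ck_on_SucD[OF Suc.prems(1)] Ck_on_SucD[OF Suc.prems(2)]
         Ck_on_Suc_frechet[OF Suc.prems(1)] Ck_on_Suc_frechet[OF Suc.prems(2)])
  qed (use assms in auto)
qed

lemma Ck_on_mult:
  fixes f g :: "'a::euclidean_space \<Rightarrow> real"
  shows "open U \<Longrightarrow> Ck_on k U f \<Longrightarrow> Ck_on k U g \<Longrightarrow> Ck_on k U (\<lambda>x. f x * g x)"
  by (rule Ck_on_bilinear[OF _ bounded_bilinear_mult])

lemma Ck_on_diff:
  "open U \<Longrightarrow> Ck_on k U f \<Longrightarrow> Ck_on k U g \<Longrightarrow> Ck_on k U (\<lambda>x. f x - g x)"
  using Ck_on_add[of U k f "\<lambda>x. - g x"] Ck_on_linear_image[of U k g uminus] bounded_linear_minus[OF bounded_linear_ident]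
  by auto

lemma Ck_on_Pair:
  assumes "open U" "Ck_on k U f" "Ck_on k U g"
  shows "Ck_on k U (\<lambda>x. (f x, g x))"
proof -
  have 1: "bounded_linear (\<lambda>x. (x, 0))" "bounded_linear (\<lambda>y. (0, y))"
    by (auto intro: bounded_linear_Pair bounded_linear_zero bounded_linear_ident)
  have "Ck_on k U (\<lambda>x. (f x, 0) + (0, g x))"
    by (intro Ck_on_add assms(1) Ck_on_linear_image[OF assms(1,2) 1(1)] Ck_on_linear_image[OF assms(1,3) 1(2)])
  then show ?thesis by simp
qed

text \<open>By linearity, the chain rule expresses the directional derivatives of a composition through directional
  derivatives along the basis vectors only, which is what the induction hypothesis speaks of.\<close>

lemma Ck_on_compose:
  fixes f :: "'a::euclidean_space \<Rightarrow> 'b::euclidean_space"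
  assumes "open U" "open V" "f ` U \<subseteq> V" "Ck_on k U f" "Ck_on k V g"
  shows "Ck_on k U (\<lambda>x. g (f x))"
  using assms(4,5)
proof (induction k arbitrary: g)
  case 0
  then show ?case using assms(3) by (auto intro: continuous_on_compose2)
next
  case (Suc k)
  let ?f' = "\<lambda>x. frechet_derivative f (at x)" and ?g' = "\<lambda>y. frechet_derivative g (at y)"
  have fU: "f x \<in> V" if "x \<in> U" for x using assms(3) that by auto
  have df: "(f has_derivative ?f' x) (at x)" if "x \<in> U" for x
    using Ck_on_Suc_has_derivative[OF Suc.prems(1) that] .
  have dg: "(g has_derivative ?g' y) (at y)" if "y \<in> V" for y
    using Ck_on_Suc_has_derivative[OF Suc.prems(2) that] .
  have lin: "?g' (f x) w = (\<Sum>b\<in>Basis. (w \<bullet> b) *\<^sub>R ?g' (f x) b)" if "x \<in> U" for x w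
  proof -
    interpret bounded_linear "?g' (f x)" using dg[OF fU[OF that]] by (rule has_derivative_bounded_linear)
    show ?thesis by (subst euclidean_representation[symmetric, of w]) (simp only: sum scaleR)
  qed
  show ?case
  proof (rule Ck_on_SucI[where f' = "\<lambda>x v. \<Sum>b\<in>Basis. (?f' x v \<bullet> b) *\<^sub>R ?g' (f x) b"])
    show "((\<lambda>x. g (f x)) has_derivative (\<lambda>v. \<Sum>b\<in>Basis. (?f' x v \<bullet> b) *\<^sub>R ?g' (f x) b)) (at x)"
      if "x \<in> U" for x
      using has_derivative_compose[OF df[OF that] dg[OF fU[OF that]]] lin[OF that, symmetric] by simp
    show "Ck_on k U (\<lambda>x. \<Sum>b\<in>Basis. (?f' x v \<bullet> b) *\<^sub>R ?g' (f x) b)" for v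
      by (intro Ck_on_sum assms(1) Ck_on_bilinear[OF assms(1) bounded_bilinear_scaleR]
          Ck_on_linear_image[OF assms(1) _ bounded_linear_inner_left] Ck_on_Suc_frechet[OF Suc.prems(1)]
          Suc.IH Ck_on_SucD[OF Suc.prems(1)] Ck_on_Suc_frechet[OF Suc.prems(2)])
  qed fact
qed

lemma Ck_on_local:
  assumes "\<And>x. x \<in> U \<Longrightarrow> \<exists>V. open V \<and> x \<in> V \<and> Ck_on k V f"
  shows "Ck_on k U f"
  using assms
proof (induction k arbitrary: f)
  case 0
  then show ?case
    by (auto intro!: continuous_at_imp_continuous_on simp: continuous_on_eq_continuous_at) (metis continuous_on_eq_continuous_at)
next
  case (Suc k)
  then show ?case by simp (metis (no_types, lifting))
qed

text \<open>The cube of the positive part is the only ingredient of the bump functions below. It is twice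
  continuously differentiable, which is all the smoothness that the argument uses.\<close>

definition pos_cube :: "real \<Rightarrow> real" where "pos_cube x = (max 0 x) ^ 3"

lemma has_derivative_pos_part_power:
  fixes x :: real
  shows "((\<lambda>y. (max 0 y) ^ (k + 2)) has_derivative (\<lambda>v. v * (of_nat (k + 2) * (max 0 x) ^ (k + 1)))) (at x)"
proof -
  consider "x > 0" | "x < 0" | "x = 0" by linarith
  then show ?thesis
  proof cases
    case 1
    have "((\<lambda>y. y ^ (k + 2)) has_derivative (\<lambda>v. v * (of_nat (k + 2) * (max 0 x) ^ (k + 1)))) (at x)"
      using has_field_derivative_imp_has_derivative[OF DERIV_pow[of "k + 2" x UNIV]] 1
      by (simp add: max_def mult.commute[of _ "(_::real) * _"])
    then show ?thesis
      by (rule has_derivative_transform_within_open[where s = "{0<..}"]) (use 1 in \<open>auto simp: max_def\<close>)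
  next
    case 2
    have "((\<lambda>y. 0) has_derivative (\<lambda>v. v * (of_nat (k + 2) * (max 0 x) ^ (k + 1)))) (at x)"
      using 2 by (auto simp: max_def)
    then show ?thesis
      by (rule has_derivative_transform_within_open[where s = "{..<0}"]) (use 2 in \<open>auto simp: max_def\<close>)
  next
    case 3
    have "((\<lambda>y. (max 0 y) ^ (k + 2)) has_real_derivative 0) (at (0::real))"
      unfolding DERIV_def
    proof (rule Lim_null_comparison[where g = "\<lambda>h. \<bar>h\<bar> ^ (k + 1)"])
      show "\<forall>\<^sub>F h in at 0. norm ((max 0 (0 + h) ^ (k + 2) - max 0 0 ^ (k + 2)) / h) \<le> \<bar>h::real\<bar> ^ (k + 1)"
        by (rule always_eventually) (auto simp: max_def power2_eq_square abs_mult power_abs intro!: mult_nonpos_nonneg)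
      show "((\<lambda>h::real. \<bar>h\<bar> ^ (k + 1)) \<longlongrightarrow> 0) (at 0)"
        by (auto intro!: tendsto_eq_intros)
    qed
    then have "((\<lambda>y. (max 0 y) ^ (k + 2)) has_derivative (\<lambda>v. 0)) (at (0::real))"
      by (simp add: has_field_derivative_def lambda_zero)
    then show ?thesis using 3 by simp
  qed
qed

lemma Ck_on_pos_cube: "Ck_on 2 UNIV pos_cube"
proof -
  have 1: "Ck_on 1 UNIV (\<lambda>x::real. (max 0 x) ^ 2)"
    unfolding One_nat_def
    by (rule Ck_on_SucI[where f' = "\<lambda>x v. v * (of_nat (0 + 2) * (max 0 x) ^ (0 + 1))"])
      (use has_derivative_pos_part_power[of 0] in \<open>auto intro!: continuous_intros simp: numeral_2_eq_2\<close>)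
  show ?thesis unfolding numeral_2_eq_2 pos_cube_def
  proof (rule Ck_on_SucI[where f' = "\<lambda>x v. v * (of_nat (1 + 2) * (max 0 x) ^ (1 + 1))"])
    show "((\<lambda>x. max 0 x ^ 3) has_derivative (\<lambda>v. v * (real (1 + 2) * max 0 x ^ (1 + 1)))) (at x)" for x::real
      using has_derivative_pos_part_power[of 1 x] by (simp add: numeral_3_eq_3)
    show "Ck_on (Suc 0) UNIV (\<lambda>x::real. v * (real (1 + 2) * max 0 x ^ (1 + 1)))" for v
      using Ck_on_mult[OF open_UNIV Ck_on_const[OF open_UNIV, of 1 "v * 3"] 1] by (simp add: mult.assoc numeral_2_eq_2)
  qed simp
qed

text \<open>The integral of \<open>\<partial>\<^sub>b f\<close> over a segment in direction \<open>b\<close> is an increment of \<open>f\<close>.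
  Differentiating this in direction \<open>a\<close> under the integral sign makes an increment of \<open>\<partial>\<^sub>a f\<close>
  the integral of \<open>\<partial>\<^sub>a \<partial>\<^sub>b f\<close>; differentiating again with respect to the length of the segment
  gives the symmetry.\<close>

lemma symmetric_second_derivative_real:
  fixes f :: "'a::euclidean_space \<Rightarrow> real"
  assumes "open U" "Ck_on 2 U f" "x \<in> U"
  shows "frechet_derivative (\<lambda>y. frechet_derivative f (at y) a) (at x) b
       = frechet_derivative (\<lambda>y. frechet_derivative f (at y) b) (at x) a"
proof -
  let ?D = "\<lambda>f y. frechet_derivative f (at y)"
  define fa where "fa = (\<lambda>y. ?D f y a)"
  define fb where "fb = (\<lambda>y. ?D f y b)"
  define fab where "fab = (\<lambda>y. ?D fa y b)"
  define fba where "fba = (\<lambda>y. ?D fb y a)"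
  have C1: "Ck_on 1 U fa" "Ck_on 1 U fb"
    using assms(2) by (auto simp: numeral_2_eq_2 fa_def fb_def)
  have cont: "continuous_on U fb" "continuous_on U fba"
    using Ck_on_imp_continuous_on[OF C1(2)] C1(2) by (auto simp: fba_def)
  have df: "(f has_derivative ?D f y) (at y)" if "y \<in> U" for y
    using assms(2) that by (auto simp: numeral_2_eq_2 frechet_derivative_works)
  have dfa: "(fa has_derivative ?D fa y) (at y)" "(fb has_derivative ?D fb y) (at y)" if "y \<in> U" for y
    using C1 that by (auto simp: frechet_derivative_works)
  have line: "((\<lambda>s. h (y + s *\<^sub>R c)) has_real_derivative ?D h (y + s *\<^sub>R c) c) (at s within S)"
    if "(h has_derivative ?D h (y + s *\<^sub>R c)) (at (y + s *\<^sub>R c))" for h :: "'a \<Rightarrow> real" and y c s S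
  proof -
    interpret bounded_linear "?D h (y + s *\<^sub>R c)" using that by (rule has_derivative_bounded_linear)
    have "((\<lambda>s. h (y + s *\<^sub>R c)) has_derivative (\<lambda>v. ?D h (y + s *\<^sub>R c) (v *\<^sub>R c))) (at s within S)"
      by (rule has_derivative_compose[where f = "\<lambda>s. y + s *\<^sub>R c" and g = h, OF _ that]) (auto intro!: derivative_eq_intros)
    moreover have "(\<lambda>v. ?D h (y + s *\<^sub>R c) (v *\<^sub>R c)) = (*) (?D h (y + s *\<^sub>R c) c)"
      by (rule ext) (simp add: scaleR)
    ultimately show ?thesis by (simp add: has_field_derivative_def)
  qed
  obtain e where e: "e > 0" "ball x e \<subseteq> U" using assms by (auto simp: open_contains_ball)
  define d where "d = e / (2 * (norm a + norm b + 1))"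
  have "d > 0" using e by (auto simp: d_def intro!: divide_pos_pos add_nonneg_pos)
  have inU: "x + s *\<^sub>R a + t *\<^sub>R b \<in> U" if "\<bar>s\<bar> \<le> d" "\<bar>t\<bar> \<le> d" for s t
  proof -
    have "norm (s *\<^sub>R a + t *\<^sub>R b) \<le> \<bar>s\<bar> * norm a + \<bar>t\<bar> * norm b"
      by (rule order_trans[OF norm_triangle_ineq]) simp
    also have "\<dots> \<le> d * norm a + d * norm b"
      using that by (intro add_mono mult_right_mono) auto
    also have "\<dots> < e"
    proof -
      have n: "0 \<le> norm a + norm b" by simp
      then have "2 * norm a + 2 * norm b + 2 \<noteq> 0" by linarith
      then have "e = d * (2 * (norm a + norm b + 1))" by (simp add: d_def)
      moreover have "0 < d * (norm a + norm b + 2)" using n \<open>d > 0\<close> by (intro mult_pos_pos) linarith+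
      ultimately show ?thesis by (simp add: algebra_simps)
    qed
    finally have "dist x (x + s *\<^sub>R a + t *\<^sub>R b) < e"
      by (simp add: dist_norm add.assoc norm_minus_commute add.commute[of "s *\<^sub>R a"])
    then show ?thesis using e by auto
  qed
  have FTC: "integral {0..t} (\<lambda>r. fb (x + s *\<^sub>R a + r *\<^sub>R b)) = f (x + s *\<^sub>R a + t *\<^sub>R b) - f (x + s *\<^sub>R a)"
    if "\<bar>s\<bar> \<le> d" "0 \<le> t" "t \<le> d" for s t
  proof -
    have "((\<lambda>r. fb (x + s *\<^sub>R a + r *\<^sub>R b)) has_integral
        f (x + s *\<^sub>R a + t *\<^sub>R b) - f (x + s *\<^sub>R a + 0 *\<^sub>R b)) {0..t}"
      by (rule fundamental_theorem_of_calculus)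
        (use that in \<open>auto simp: has_real_derivative_iff_has_vector_derivative[symmetric] fb_def intro!: line df inU\<close>)
    then show ?thesis by (simp add: integral_unique)
  qed
  have key: "integral {0..t} (\<lambda>r. fba (x + r *\<^sub>R b)) = fa (x + t *\<^sub>R b) - fa x" if t: "0 \<le> t" "t \<le> d" for t
  proof -
    let ?S = "{-d..d}"
    have "((\<lambda>s. integral (cbox 0 t) (\<lambda>r. fb (x + s *\<^sub>R a + r *\<^sub>R b))) has_real_derivative
        integral (cbox 0 t) (\<lambda>r. fba (x + 0 *\<^sub>R a + r *\<^sub>R b))) (at 0 within ?S)"
    proof (rule leibniz_rule_field_derivative)
      show "((\<lambda>s. fb (x + s *\<^sub>R a + r *\<^sub>R b)) has_real_derivative fba (x + s *\<^sub>R a + r *\<^sub>R b)) (at s within ?S)"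
        if "s \<in> ?S" "r \<in> cbox 0 t" for s r
        using line[of fb "x + r *\<^sub>R b" s a ?S] dfa(2)[OF inU[of s r]] that t
        by (auto simp: fba_def algebra_simps)
      show "(\<lambda>r. fb (x + s *\<^sub>R a + r *\<^sub>R b)) integrable_on cbox 0 t" if "s \<in> ?S" for s
        by (rule integrable_continuous)
          (use that t in \<open>auto intro!: continuous_on_compose2[OF cont(1)] continuous_intros inU\<close>)
      show "continuous_on (?S \<times> cbox 0 t) (\<lambda>(s, r). fba (x + s *\<^sub>R a + r *\<^sub>R b))"
        unfolding case_prod_beta
        by (use t in \<open>auto intro!: continuous_on_compose2[OF cont(2)] continuous_intros inU\<close>)
    qed (use \<open>d > 0\<close> in auto)
    then have "((\<lambda>s. integral {0..t} (\<lambda>r. fb (x + s *\<^sub>R a + r *\<^sub>R b))) has_real_derivative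
        integral {0..t} (\<lambda>r. fba (x + r *\<^sub>R b))) (at 0 within ?S)" by simp
    then have 1: "((\<lambda>s. f (x + s *\<^sub>R a + t *\<^sub>R b) - f (x + s *\<^sub>R a)) has_real_derivative
        integral {0..t} (\<lambda>r. fba (x + r *\<^sub>R b))) (at 0 within ?S)"
      by (rule has_field_derivative_transform_within[where d = 1]) (use FTC t \<open>d > 0\<close> in auto)
    have 2: "((\<lambda>s. f (x + s *\<^sub>R a + t *\<^sub>R b) - f (x + s *\<^sub>R a)) has_real_derivative
        fa (x + t *\<^sub>R b) - fa x) (at 0 within ?S)"
      using DERIV_diff[OF line[of f "x + t *\<^sub>R b" 0 a ?S] line[of f x 0 a ?S]] df[OF inU[of 0 t]] df[OF inU[of 0 0]]
        t \<open>d > 0\<close> by (simp add: fa_def algebra_simps)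
    show ?thesis
      by (rule has_field_derivative_unique[OF 1 2]) (use \<open>d > 0\<close> in \<open>simp add: trivial_limit_within islimpt_Icc\<close>)
  qed
  have "((\<lambda>t. integral {0..t} (\<lambda>r. fba (x + r *\<^sub>R b))) has_real_derivative fba (x + 0 *\<^sub>R b)) (at 0 within {0..d})"
    by (rule integral_has_real_derivative)
      (use \<open>d > 0\<close> inU[of 0] in \<open>auto intro!: continuous_on_compose2[OF cont(2)] continuous_intros\<close>)
  then have "((\<lambda>t. integral {0..t} (\<lambda>r. fba (x + r *\<^sub>R b))) has_real_derivative fba x) (at 0 within {0..d})"
    by simp
  then have 1: "((\<lambda>t. fa (x + t *\<^sub>R b) - fa x) has_real_derivative fba x) (at 0 within {0..d})"
    by (rule has_field_derivative_transform_within[where d = 1]) (use key \<open>d > 0\<close> in auto)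
  have 2: "((\<lambda>t. fa (x + t *\<^sub>R b) - fa x) has_real_derivative fab x) (at 0 within {0..d})"
    using DERIV_diff[OF line[of fa x 0 b "{0..d}"] DERIV_const[of "fa x"]] dfa(1)[OF assms(3)]
    by (simp add: fab_def)
  have "fba x = fab x"
    by (rule has_field_derivative_unique[OF 1 2]) (use \<open>d > 0\<close> in \<open>simp add: trivial_limit_within islimpt_Icc\<close>)
  then show ?thesis by (simp add: fab_def fba_def fa_def fb_def)
qed

corollary symmetric_second_derivative:
  fixes f :: "'a::euclidean_space \<Rightarrow> 'b::euclidean_space"
  assumes "open U" "Ck_on 2 U f" "x \<in> U"
  shows "frechet_derivative (\<lambda>y. frechet_derivative f (at y) a) (at x) b
       = frechet_derivative (\<lambda>y. frechet_derivative f (at y) b) (at x) a"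
proof (rule euclidean_eqI)
  fix c :: 'b assume "c \<in> Basis"
  let ?fc = "\<lambda>y. f y \<bullet> c"
  have C: "Ck_on 2 U ?fc"
    by (rule Ck_on_linear_image[OF assms(1,2) bounded_linear_inner_left])
  have first: "frechet_derivative ?fc (at y) v = frechet_derivative f (at y) v \<bullet> c" if "y \<in> U" for y v
  proof -
    have "(f has_derivative frechet_derivative f (at y)) (at y)"
      using assms(2) that by (auto simp: numeral_2_eq_2 frechet_derivative_works)
    then have "(?fc has_derivative (\<lambda>v. frechet_derivative f (at y) v \<bullet> c)) (at y)"
      by (rule has_derivative_inner_left)
    from frechet_derivative_at[OF this] show ?thesis by metis
  qed
  have second: "frechet_derivative (\<lambda>y. frechet_derivative ?fc (at y) v) (at x) w =
      frechet_derivative (\<lambda>y. frechet_derivative f (at y) v) (at x) w \<bullet> c" for v w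
  proof -
    have "((\<lambda>y. frechet_derivative f (at y) v) has_derivative
        frechet_derivative (\<lambda>y. frechet_derivative f (at y) v) (at x)) (at x)"
      using assms(2,3) by (auto simp: numeral_2_eq_2 frechet_derivative_works[symmetric])
    then have "((\<lambda>y. frechet_derivative f (at y) v \<bullet> c) has_derivative
        (\<lambda>w. frechet_derivative (\<lambda>y. frechet_derivative f (at y) v) (at x) w \<bullet> c)) (at x)"
      by (rule has_derivative_inner_left)
    then have "((\<lambda>y. frechet_derivative ?fc (at y) v) has_derivative
        (\<lambda>w. frechet_derivative (\<lambda>y. frechet_derivative f (at y) v) (at x) w \<bullet> c)) (at x)"
      by (rule has_derivative_transform_within_open[OF _ assms(1,3)]) (simp add: first)
    from frechet_derivative_at[OF this] show ?thesis by metis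
  qed
  show "frechet_derivative (\<lambda>y. frechet_derivative f (at y) a) (at x) b \<bullet> c =
      frechet_derivative (\<lambda>y. frechet_derivative f (at y) b) (at x) a \<bullet> c"
    using symmetric_second_derivative_real[OF assms(1) C assms(3), of a b] second by simp
qed

section \<open>Determinants of frames\<close>

lemma sum_permutations_reindex:
  fixes A :: "'a::comm_ring_1 ^ 'n::finite ^ 'n" and f :: "'k::finite \<Rightarrow> 'n"
  assumes f: "bij_betw f UNIV B"
  shows "(\<Sum>p | p permutes B. of_int (sign p) * (\<Prod>i\<in>B. A $ i $ p i)) = det (\<chi> i j. A $ f i $ f j)"
    (is "sum ?P _ = _")
proof -
  have inj: "inj f" and rf: "range f = B" using f by (auto simp: bij_betw_def)
  have "sum ?P {p. p permutes B} = (\<Sum>p | p permutes UNIV. ?P (map_permutation UNIV f p))"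
  proof (rule sum.reindex_bij_betw[symmetric])
    have "map_permutation UNIV f = (\<lambda>p x. if x \<in> B then f (p (inv_into UNIV f x)) else x)"
      by (intro ext) (simp only: map_permutation_def restrict_id_def rf o_apply)
    with bij_betw_permutations[OF f] show "bij_betw (map_permutation UNIV f) {p. p permutes UNIV} {p. p permutes B}"
      by (simp only:)
  qed
  also have "\<dots> = (\<Sum>p | p permutes UNIV. of_int (sign p) * (\<Prod>i\<in>UNIV. A $ f i $ f (p i)))"
  proof (rule sum.cong[OF refl])
    fix p :: "'k \<Rightarrow> 'k" assume "p \<in> {p. p permutes UNIV}"
    then have p: "p permutes UNIV" by simp
    have "(\<Prod>i\<in>B. A $ i $ map_permutation UNIV f p i) = (\<Prod>i\<in>UNIV. A $ f i $ map_permutation UNIV f p (f i))"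
      by (rule prod.reindex_bij_betw[OF f, symmetric])
    also have "\<dots> = (\<Prod>i\<in>UNIV. A $ f i $ f (p i))"
      by (simp add: map_permutation_apply[OF inj])
    finally show "?P (map_permutation UNIV f p) = of_int (sign p) * (\<Prod>i\<in>UNIV. A $ f i $ f (p i))"
      using sign_map_permutation[OF inj p] by simp
  qed
  finally show ?thesis by (simp add: det_def)
qed

corollary det_reindex:
  fixes A :: "'a::comm_ring_1 ^ 'n::finite ^ 'n" and f :: "'k::finite \<Rightarrow> 'n"
  shows "bij f \<Longrightarrow> det (\<chi> i j. A $ f i $ f j) = det A"
  using sum_permutations_reindex[of f UNIV A] by (simp add: det_def)

text \<open>A frame consists of one normal vector and \<open>n\<close> tangent vectors. To take its determinant, the
  coordinates of the ambient space are matched with the members of the frame by an arbitrary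
  bijection: \<open>None\<close> is the normal, \<open>Some \<alpha>\<close> is the tangent vector with index \<open>\<alpha>\<close>.\<close>

definition slot :: "'m::finite \<Rightarrow> 'n::finite option" where
  "slot = (SOME e. bij e)"

lemma bij_slot:
  assumes "CARD('m::finite) = CARD('n::finite) + 1"
  shows "bij (slot :: 'm \<Rightarrow> 'n option)"
proof -
  have "card (UNIV :: 'm set) = card (UNIV :: 'n option set)"
    using assms by simp
  then obtain h :: "'m \<Rightarrow> 'n option" where "bij h"
    using finite_same_card_bij[of "UNIV :: 'm set" "UNIV :: 'n option set"] by auto
  then show ?thesis unfolding slot_def by (rule someI[of bij])
qed

lemma sum_slot:
  assumes "CARD('m::finite) = CARD('n::finite) + 1"
  shows "(\<Sum>i\<in>(UNIV::'m set). g (slot i :: 'n option)) = g None + (\<Sum>\<alpha>\<in>UNIV. g (Some \<alpha>))"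
proof -
  have "(\<Sum>i\<in>(UNIV::'m set). g (slot i :: 'n option)) = (\<Sum>q\<in>(UNIV :: 'n option set). g q)"
    by (rule sum.reindex_bij_betw) (use bij_slot[OF assms] in simp)
  also have "\<dots> = g None + (\<Sum>\<alpha>\<in>UNIV. g (Some \<alpha>))"
    by (simp add: UNIV_option_conv sum.reindex)
  finally show ?thesis .
qed

definition bordered :: "real ^ 'n::finite ^ 'n \<Rightarrow> real ^ 'm::finite ^ 'm" where
  "bordered A = (\<chi> i j. case slot i of
      None \<Rightarrow> (case slot j :: 'n option of None \<Rightarrow> 1 | Some \<beta> \<Rightarrow> 0)
    | Some \<alpha> \<Rightarrow> (case slot j of None \<Rightarrow> 0 | Some \<beta> \<Rightarrow> A $ \<alpha> $ \<beta>))"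

text \<open>Only permutations that fix the bordering index contribute to the Leibniz formula, and these
  are the permutations of the remaining indices.\<close>

lemma det_bordered:
  assumes "CARD('m::finite) = CARD('n::finite) + 1"
  shows "det (bordered A :: real ^ 'm ^ 'm) = det (A :: real ^ 'n ^ 'n)"
proof -
  let ?s = "slot :: 'm \<Rightarrow> 'n option" and ?B = "bordered A :: real ^ 'm ^ 'm"
  note b = bij_slot[OF assms]
  define i0 where "i0 = inv ?s None"
  define f where "f \<alpha> = inv ?s (Some \<alpha>)" for \<alpha>
  have s_f [simp]: "?s (f \<alpha>) = Some \<alpha>" for \<alpha>
    using b by (simp add: f_def surj_f_inv_f bij_is_surj)
  have s_i0 [simp]: "?s i0 = None" using b by (simp add: i0_def surj_f_inv_f bij_is_surj)
  have f_inj: "inj f" by (rule injI) (metis option.inject s_f)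
  have rf: "range f = UNIV - {i0}"
  proof (intro equalityI subsetI)
    fix i assume i: "i \<in> UNIV - {i0}"
    then have "?s i \<noteq> None" using b s_i0 by (metis DiffE bij_is_inj inj_eq insertI1)
    then obtain \<alpha> where "?s i = Some \<alpha>" by auto
    then have "i = f \<alpha>" using b s_f by (metis bij_is_inj inj_eq)
    then show "i \<in> range f" by simp
  next
    fix i assume "i \<in> range f" then show "i \<in> UNIV - {i0}"
      using s_i0 s_f by (metis DiffI UNIV_I option.distinct(1) rangeE singletonD)
  qed
  have bf: "bij_betw f UNIV (UNIV - {i0})" using f_inj rf by (simp add: bij_betw_def)
  let ?P = "\<lambda>p. of_int (sign p) * (\<Prod>i\<in>UNIV. ?B $ i $ p i)"
  have "det ?B = (\<Sum>p | p permutes UNIV. ?P p)" by (simp add: det_def)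
  also have "\<dots> = (\<Sum>p | p permutes (UNIV - {i0}). ?P p)"
  proof (rule sum.mono_neutral_right)
    show "{p. p permutes UNIV - {i0}} \<subseteq> {p. p permutes UNIV}"
      using permutes_subset by blast
    show "\<forall>p\<in>{p. p permutes UNIV} - {p. p permutes UNIV - {i0}}. ?P p = 0"
    proof
      fix p assume p: "p \<in> {p. p permutes UNIV} - {p. p permutes UNIV - {i0}}"
      have "p i0 \<noteq> i0"
      proof
        assume "p i0 = i0"
        moreover have "p permutes UNIV" using p by simp
        ultimately have "p permutes UNIV - {i0}"
          by (intro permutes_superset[of p UNIV "UNIV - {i0}"]) simp_all
        then show False using p by auto
      qed
      then have "p i0 \<in> range f" using rf by auto
      then obtain \<beta> where "p i0 = f \<beta>" by auto
      then have "?B $ i0 $ p i0 = 0" by (simp add: bordered_def)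
      then have "(\<Prod>i\<in>UNIV. ?B $ i $ p i) = 0" by (intro prod_zero) auto
      then show "?P p = 0" by simp
    qed
  qed simp
  also have "\<dots> = (\<Sum>p | p permutes (UNIV - {i0}). of_int (sign p) * (\<Prod>i\<in>UNIV - {i0}. ?B $ i $ p i))"
  proof (rule sum.cong[OF refl])
    fix p assume "p \<in> {p. p permutes (UNIV - {i0})}"
    then have "p i0 = i0" using permutes_not_in[of p "UNIV - {i0}" i0] by simp
    then have "?B $ i0 $ p i0 = 1" by (simp add: bordered_def)
    then show "?P p = of_int (sign p) * (\<Prod>i\<in>UNIV - {i0}. ?B $ i $ p i)"
      using prod.remove[of UNIV i0 "\<lambda>i. ?B $ i $ p i"] by simp
  qed
  also have "\<dots> = det (\<chi> \<alpha> \<beta>. ?B $ f \<alpha> $ f \<beta>)" by (rule sum_permutations_reindex[OF bf])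
  also have "(\<chi> \<alpha> \<beta>. ?B $ f \<alpha> $ f \<beta>) = A" by (simp add: bordered_def vec_eq_iff)
  finally show ?thesis .
qed

definition frame_rows :: "real ^ 'm::finite \<Rightarrow> ('n::finite \<Rightarrow> real ^ 'm) \<Rightarrow> real ^ 'm ^ 'm" where
  "frame_rows v w = (\<chi> i. case slot i of None \<Rightarrow> v | Some \<alpha> \<Rightarrow> w \<alpha>)"

definition frame_det :: "real ^ 'm::finite \<Rightarrow> ('n::finite \<Rightarrow> real ^ 'm) \<Rightarrow> real" where
  "frame_det v w = det (frame_rows v w)"

text \<open>The product of the two determinants is the determinant of the matrix of all inner products,
  which the hypotheses make block diagonal. The lemma yields both the area density
  (equal frames) and the determinant of the second fundamental form.\<close>

lemma frame_det_product:
  fixes v v' :: "real ^ 'm::finite" and w w' :: "'n::finite \<Rightarrow> real ^ 'm"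
  assumes "CARD('m) = CARD('n) + 1" "v \<bullet> v' = 1" "\<And>\<beta>. v \<bullet> w' \<beta> = 0" "\<And>\<alpha>. w \<alpha> \<bullet> v' = 0"
  shows "frame_det v w * frame_det v' w' = det (\<chi> \<alpha> \<beta>. w \<alpha> \<bullet> w' \<beta>)"
proof -
  have "frame_rows v w ** transpose (frame_rows v' w') = bordered (\<chi> \<alpha> \<beta>. w \<alpha> \<bullet> w' \<beta>)"
    using assms by (auto simp: vec_eq_iff matrix_matrix_mult_def transpose_def frame_rows_def bordered_def
        inner_vec_def split: option.splits)
  then have "det (frame_rows v w) * det (frame_rows v' w') = det (bordered (\<chi> \<alpha> \<beta>. w \<alpha> \<bullet> w' \<beta>) :: real ^ 'm ^ 'm)"
    by (metis det_mul det_transpose)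
  then show ?thesis by (simp add: frame_det_def det_bordered[OF assms(1)])
qed

lemma frame_det_linear_change:
  fixes v :: "real ^ 'm::finite" and w :: "'n::finite \<Rightarrow> real ^ 'm" and J :: "real ^ 'n ^ 'n"
  assumes "CARD('m) = CARD('n) + 1"
  shows "frame_det v (\<lambda>\<alpha>. \<Sum>\<beta>\<in>UNIV. J $ \<alpha> $ \<beta> *\<^sub>R w \<beta>) = det J * frame_det v w"
proof -
  have "frame_rows v (\<lambda>\<alpha>. \<Sum>\<beta>\<in>UNIV. J $ \<alpha> $ \<beta> *\<^sub>R w \<beta>) = bordered J ** frame_rows v w"
  proof (unfold vec_eq_iff, intro allI)
    fix i k :: 'm
    let ?g = "\<lambda>q. (case slot i of
      None \<Rightarrow> (case q of None \<Rightarrow> 1 | Some \<beta> \<Rightarrow> 0)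
    | Some \<alpha> \<Rightarrow> (case q of None \<Rightarrow> 0 | Some \<beta> \<Rightarrow> J $ \<alpha> $ \<beta>)) * (case q of None \<Rightarrow> v $ k | Some \<alpha> \<Rightarrow> w \<alpha> $ k)"
    have "(bordered J ** frame_rows v w) $ i $ k = (\<Sum>j\<in>(UNIV::'m set). ?g (slot j))"
      unfolding matrix_matrix_mult_def bordered_def frame_rows_def vec_lambda_beta
      by (rule sum.cong[OF refl]) (simp split: option.split)
    also have "\<dots> = ?g None + (\<Sum>\<alpha>\<in>UNIV. ?g (Some \<alpha>))" by (rule sum_slot[OF assms])
    also have "\<dots> = frame_rows v (\<lambda>\<alpha>. \<Sum>\<beta>\<in>UNIV. J $ \<alpha> $ \<beta> *\<^sub>R w \<beta>) $ i $ k"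
      by (cases "slot i :: 'n option") (auto simp: frame_rows_def)
    finally show "frame_rows v (\<lambda>\<alpha>. \<Sum>\<beta>\<in>UNIV. J $ \<alpha> $ \<beta> *\<^sub>R w \<beta>) $ i $ k = (bordered J ** frame_rows v w) $ i $ k" ..
  qed
  then show ?thesis by (simp add: frame_det_def det_mul det_bordered[OF assms])
qed

lemma frame_det_nonzero:
  fixes v :: "real ^ 'm::finite" and w :: "'n::finite \<Rightarrow> real ^ 'm"
  assumes "CARD('m) = CARD('n) + 1" "v \<bullet> v = 1" "\<And>\<alpha>. v \<bullet> w \<alpha> = 0"
    and indep: "\<And>c. (\<Sum>\<alpha>\<in>UNIV. c \<alpha> *\<^sub>R w \<alpha>) = 0 \<Longrightarrow> c = (\<lambda>\<alpha>. 0)"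
  shows "frame_det v w \<noteq> 0"
proof
  let ?s = "slot :: 'm \<Rightarrow> 'n option"
  assume "frame_det v w = 0"
  then have "det (transpose (frame_rows v w)) = 0" by (simp add: frame_det_def)
  then have "\<not> inj ((*v) (transpose (frame_rows v w)))"
    using det_nz_iff_inj_gen[of "(*v) (transpose (frame_rows v w))"] by simp
  then obtain x y where xy: "x \<noteq> y" "transpose (frame_rows v w) *v x = transpose (frame_rows v w) *v y"
    by (auto simp: inj_def)
  define c where "c = x - y"
  have c: "c \<noteq> 0" "transpose (frame_rows v w) *v c = 0"
    using xy by (auto simp: c_def matrix_vector_mult_diff_distrib)
  define d where "d q = c $ inv ?s q" for q
  have d: "d (?s i) = c $ i" for i
    using bij_slot[OF assms(1)] by (simp add: d_def bij_is_inj inv_f_f)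
  have "0 = (\<Sum>i\<in>UNIV. c $ i *\<^sub>R (frame_rows v w $ i))"
    using c(2) by (simp add: vec_eq_iff matrix_vector_mult_def transpose_def mult.commute)
  also have "\<dots> = (\<Sum>i\<in>UNIV. d (?s i) *\<^sub>R (case ?s i of None \<Rightarrow> v | Some \<alpha> \<Rightarrow> w \<alpha>))"
    by (simp add: d frame_rows_def)
  also have "\<dots> = d None *\<^sub>R v + (\<Sum>\<alpha>\<in>UNIV. d (Some \<alpha>) *\<^sub>R w \<alpha>)"
    by (subst sum_slot[OF assms(1)]) simp
  finally have eq: "d None *\<^sub>R v + (\<Sum>\<alpha>\<in>UNIV. d (Some \<alpha>) *\<^sub>R w \<alpha>) = 0" ..
  then have "v \<bullet> (d None *\<^sub>R v + (\<Sum>\<alpha>\<in>UNIV. d (Some \<alpha>) *\<^sub>R w \<alpha>)) = 0" by simp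
  then have 0: "d None = 0"
    using assms(2,3) by (simp add: inner_add_right inner_sum_right)
  with eq have "(\<lambda>\<alpha>. d (Some \<alpha>)) = (\<lambda>\<alpha>. 0)" by (intro indep) simp
  with 0 have "d q = 0" for q by (cases q) (auto dest: fun_cong)
  then have "c = 0" using d by (metis vec_eq_iff zero_index)
  with c show False by simp
qed

lemma has_derivative_det_rows:
  fixes r :: "'m::finite \<Rightarrow> 'a::real_normed_vector \<Rightarrow> real ^ 'm"
  assumes "\<And>i. (r i has_derivative r' i) (at x)"
  shows "((\<lambda>y. det (\<chi> i. r i y)) has_derivative (\<lambda>h. \<Sum>k\<in>UNIV. det (\<chi> i. if i = k then r' k h else r i x))) (at x)"
proof -
  have comp: "((\<lambda>y. r i y $ j) has_derivative (\<lambda>h. r' i h $ j)) (at x)" for i j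
    using bounded_linear.has_derivative[OF bounded_linear_vec_nth assms] .
  have "((\<lambda>y. det (\<chi> i. r i y)) has_derivative
      (\<lambda>h. \<Sum>p | p permutes (UNIV::'m set). of_int (sign p) * (\<Sum>k\<in>UNIV. r' k h $ p k * (\<Prod>i\<in>UNIV - {k}. r i x $ p i)))) (at x)"
    unfolding det_def vec_lambda_beta
    by (intro has_derivative_sum has_derivative_mult_right has_derivative_prod comp)
  moreover have "(\<Sum>p | p permutes (UNIV::'m set). of_int (sign p) * (\<Sum>k\<in>UNIV. r' k h $ p k * (\<Prod>i\<in>UNIV - {k}. r i x $ p i)))
     = (\<Sum>k\<in>UNIV. det (\<chi> i. if i = k then r' k h else r i x))" (is "?L = ?R") for h
  proof -
    have "(\<Prod>i\<in>UNIV. (if i = k then r' k h else r i x) $ p i) = r' k h $ p k * (\<Prod>i\<in>UNIV - {k}. r i x $ p i)" for p k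
      by (subst prod.remove[of UNIV k]) (auto intro!: prod.cong)
    then have "?R = (\<Sum>k\<in>UNIV. \<Sum>p | p permutes (UNIV::'m set). of_int (sign p) * (r' k h $ p k * (\<Prod>i\<in>UNIV - {k}. r i x $ p i)))"
      by (simp add: det_def)
    also have "\<dots> = ?L" by (subst sum.swap) (simp add: sum_distrib_left)
    finally show ?thesis ..
  qed
  ultimately show ?thesis by simp
qed

lemma Ck_on_prod:
  fixes f :: "'i \<Rightarrow> 'a::euclidean_space \<Rightarrow> real"
  assumes "open U" "\<And>i. i \<in> A \<Longrightarrow> Ck_on k U (f i)"
  shows "Ck_on k U (\<lambda>x. \<Prod>i\<in>A. f i x)"
  using assms(2)
  by (induction A rule: infinite_finite_induct) (auto intro: Ck_on_const Ck_on_mult assms(1))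

lemma Ck_on_det_rows:
  fixes r :: "'m::finite \<Rightarrow> 'a::euclidean_space \<Rightarrow> real ^ 'm"
  assumes "open U" "\<And>i. Ck_on k U (r i)"
  shows "Ck_on k U (\<lambda>x. det (\<chi> i. r i x))"
  unfolding det_def vec_lambda_beta
  by (intro Ck_on_sum Ck_on_mult Ck_on_const Ck_on_prod Ck_on_linear_image[OF assms(1,2) bounded_linear_vec_nth] assms(1))

lemma det_rows_orthogonal:
  fixes r :: "'m::finite \<Rightarrow> real ^ 'm"
  assumes "g \<noteq> 0" "\<And>i. r i \<bullet> g = 0"
  shows "det (\<chi> i. r i) = 0"
proof (rule ccontr)
  assume "det (\<chi> i. r i) \<noteq> 0"
  then have "inj ((*v) (\<chi> i. r i))" using det_nz_iff_inj_gen[of "(*v) (\<chi> i. r i)"] by simp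
  moreover have "(\<chi> i. r i) *v g = 0"
    using assms(2) by (simp add: vec_eq_iff matrix_vector_mult_def inner_vec_def)
  ultimately show False using assms(1) by (metis injD matrix_vector_mult_0_right)
qed

lemma det_swap_rows:
  fixes A B :: "real ^ 'm::finite ^ 'm"
  assumes "i \<noteq> k" "A $ i = B $ k" "A $ k = B $ i" "\<And>j. j \<noteq> i \<Longrightarrow> j \<noteq> k \<Longrightarrow> A $ j = B $ j"
  shows "det A = - det B"
proof -
  have "A = (\<chi> j. B $ Transposition.transpose i k j)"
    using assms by (auto simp: vec_eq_iff Transposition.transpose_def)
  then have "det A = of_int (sign (Transposition.transpose i k)) * det B"
    using det_permute_rows[OF permutes_swap_id[of i UNIV k], of B] by simp
  then show ?thesis using assms(1) by (simp add: sign_swap_id)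
qed

text \<open>The heart of the homotopy invariance. Differentiating the row \<open>G\<close> of \<open>V i\<close> in direction \<open>b i\<close>
  gives the determinant of all first derivatives; these are orthogonal to \<open>G\<close> because \<open>G\<close> has
  constant length, so it vanishes. Differentiating row \<open>k \<noteq> i\<close> gives a term \<open>T i k\<close> with a mixed
  second derivative, and exchanging \<open>i\<close> with \<open>k\<close> exchanges two rows.\<close>

lemma divergence_free:
  fixes G :: "'c::euclidean_space \<Rightarrow> real ^ 'm::finite" and b :: "'m \<Rightarrow> 'c"
  defines "V \<equiv> \<lambda>i y. det (\<chi> j. if j = i then G y else frechet_derivative G (at y) (b j))"
  assumes "open U" "Ck_on 2 U G" "\<And>y. y \<in> U \<Longrightarrow> G y \<bullet> G y = 1" "x \<in> U"
  shows "(\<Sum>i\<in>UNIV. frechet_derivative (V i) (at x) (b i)) = 0"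
proof -
  let ?D = "\<lambda>y. frechet_derivative G (at y)"
  define H where "H k = frechet_derivative (\<lambda>y. ?D y (b k)) (at x)" for k
  define T where "T i k = (if k = i then 0 else
     det (\<chi> j. if j = k then H k (b i) else if j = i then G x else ?D x (b j)))" for i k
  have dG: "(G has_derivative ?D y) (at y)" if "y \<in> U" for y
    using assms(3) that by (auto simp: numeral_2_eq_2 frechet_derivative_works)
  have dD: "((\<lambda>y. ?D y (b k)) has_derivative H k) (at x)" for k
    using assms(3,5) by (auto simp: numeral_2_eq_2 frechet_derivative_works[symmetric] H_def)
  have H_sym: "H k (b i) = H i (b k)" for i k
    unfolding H_def by (rule symmetric_second_derivative[OF assms(2,3,5)])
  have orth: "?D x h \<bullet> G x = 0" for h
  proof -
    have "((\<lambda>y. G y \<bullet> G y) has_derivative (\<lambda>h. G x \<bullet> ?D x h + ?D x h \<bullet> G x)) (at x)"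
      by (rule has_derivative_inner[OF dG dG]) fact+
    moreover have "((\<lambda>y. G y \<bullet> G y) has_derivative (\<lambda>h. 0)) (at x)"
      by (rule has_derivative_transform_within_open[OF has_derivative_const assms(2,5)]) (use assms(4) in simp)
    ultimately have "(\<lambda>h. G x \<bullet> ?D x h + ?D x h \<bullet> G x) = (\<lambda>h. 0)" by (rule has_derivative_unique)
    from fun_cong[OF this, of h] show ?thesis by (simp add: inner_commute)
  qed
  have "frechet_derivative (V i) (at x) (b i) = (\<Sum>k\<in>UNIV. T i k)" for i
  proof -
    have rows: "((\<lambda>y. if j = i then G y else ?D y (b j)) has_derivative (if j = i then ?D x else H j)) (at x)" for j
      using dG[OF assms(5)] dD by simp
    from has_derivative_det_rows[where r = "\<lambda>j y. if j = i then G y else ?D y (b j)", OF rows]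
    have "frechet_derivative (V i) (at x) = (\<lambda>h. \<Sum>k\<in>UNIV. det (\<chi> j. if j = k then (if k = i then ?D x else H k) h else
        if j = i then G x else ?D x (b j)))"
      unfolding V_def by (rule frechet_derivative_at[symmetric])
    then have "frechet_derivative (V i) (at x) (b i) = (\<Sum>k\<in>UNIV. det (\<chi> j. if j = k then (if k = i then ?D x else H k) (b i) else
        if j = i then G x else ?D x (b j)))" by simp
    also have "\<dots> = (\<Sum>k\<in>UNIV. T i k)"
    proof (rule sum.cong[OF refl])
      fix k
      show "det (\<chi> j. if j = k then (if k = i then ?D x else H k) (b i) else if j = i then G x else ?D x (b j)) = T i k"
      proof (cases "k = i")
        case True
        have "det (\<chi> j. ?D x (b j)) = 0"
          by (rule det_rows_orthogonal[of "G x"]) (use assms(4)[OF assms(5)] orth in auto)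
        moreover have "(\<chi> j. if j = k then (if k = i then ?D x else H k) (b i) else if j = i then G x else ?D x (b j)) = (\<chi> j. ?D x (b j))"
          using True by (auto simp: vec_eq_iff)
        ultimately show ?thesis using True by (simp add: T_def)
      qed (simp add: T_def)
    qed
    finally show ?thesis .
  qed
  then have 1: "(\<Sum>i\<in>UNIV. frechet_derivative (V i) (at x) (b i)) = (\<Sum>i\<in>UNIV. \<Sum>k\<in>UNIV. T i k)" by simp
  have T_anti: "T i k = - T k i" for i k
  proof (cases "i = k")
    case False
    show ?thesis unfolding T_def using False
      by (auto intro!: det_swap_rows[of i k] simp: H_sym)
  qed (simp add: T_def)
  have "(\<Sum>i\<in>UNIV. \<Sum>k\<in>UNIV. T i k) = (\<Sum>i\<in>UNIV. \<Sum>k\<in>UNIV. - T k i)"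
    by (intro sum.cong refl T_anti)
  also have "\<dots> = - (\<Sum>i\<in>UNIV. \<Sum>k\<in>UNIV. T i k)" by (subst sum.swap) (simp add: sum_negf)
  finally show ?thesis using 1 by simp
qed

section \<open>Homotopy invariance in a coordinate box\<close>

lemma integral_eq_integral_UNIV:
  fixes f :: "'a::euclidean_space \<Rightarrow> 'b::banach"
  assumes "\<And>x. x \<notin> S \<Longrightarrow> f x = 0"
  shows "integral S f = integral UNIV f"
proof -
  have "(\<lambda>x. if x \<in> S then f x else 0) = f" using assms by auto
  then show ?thesis using integral_restrict_UNIV[of S f] by simp
qed

text \<open>By translation invariance \<open>\<integral> f (x + h v) dx\<close> does not depend on \<open>h\<close>; the integral in question is
  its derivative at \<open>h = 0\<close>. This avoids iterated integrals.\<close>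

lemma integral_directional_derivative_UNIV:
  fixes f :: "'a::euclidean_space \<Rightarrow> real"
  assumes "Ck_on 1 UNIV f" "bounded K" "closed K" "\<And>x. x \<notin> K \<Longrightarrow> f x = 0"
  shows "integral UNIV (\<lambda>x. frechet_derivative f (at x) v) = 0"
proof -
  let ?f' = "\<lambda>x. frechet_derivative f (at x)"
  have df: "(f has_derivative ?f' x) (at x)" for x
    using assms(1) by (simp add: frechet_derivative_works)
  have cont: "continuous_on UNIV f" "continuous_on UNIV (\<lambda>x. ?f' x v)"
    using Ck_on_imp_continuous_on[OF assms(1)] assms(1) by simp_all
  obtain R where R: "\<And>x. x \<in> K \<Longrightarrow> norm x \<le> R" using assms(2) by (auto simp: bounded_iff)
  obtain B :: 'a where "cball 0 (R + norm v) \<subseteq> cbox (- B) B"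
    using bounded_subset_cbox_symmetric[OF bounded_cball] by blast
  \<comment> \<open>The box contains all translates of the support by at most \<open>v\<close>.\<close>
  then have B: "x - h *\<^sub>R v \<in> cbox (- B) B" if "x \<in> K" "\<bar>h\<bar> \<le> 1" for x h
  proof -
    have "norm (x - h *\<^sub>R v) \<le> norm x + \<bar>h\<bar> * norm v" using norm_triangle_ineq4[of x "h *\<^sub>R v"] by simp
    also have "\<dots> \<le> R + norm v" using R[OF that(1)] that(2) mult_right_mono[of "\<bar>h\<bar>" 1 "norm v"] by simp
    finally show ?thesis using \<open>cball 0 (R + norm v) \<subseteq> cbox (- B) B\<close> by (auto simp: dist_norm)
  qed
  have f'_0: "?f' x v = 0" if "x \<notin> K" for x
  proof -
    have "(f has_derivative (\<lambda>v. 0)) (at x)"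
      by (rule has_derivative_transform_within_open[OF has_derivative_const, of "- K"])
        (use assms(3,4) that in auto)
    from frechet_derivative_at[OF this] show ?thesis by metis
  qed
  have shift: "integral (cbox (- B) B) (\<lambda>x. f (x + h *\<^sub>R v)) = integral UNIV f" if "\<bar>h\<bar> \<le> 1" for h
  proof -
    have "integral (cbox (- B) B) (\<lambda>x. f (x + h *\<^sub>R v)) = integral (cbox (- B + h *\<^sub>R v) (B + h *\<^sub>R v)) f"
      using integral_shift_cbox_plus[of "- B" B f "h *\<^sub>R v"] by (simp add: o_def add.commute)
    also have "\<dots> = integral UNIV f"
    proof (rule integral_eq_integral_UNIV)
      fix x assume x: "x \<notin> cbox (- B + h *\<^sub>R v) (B + h *\<^sub>R v)"
      have "x \<notin> K"
      proof
        assume "x \<in> K"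
        from B[OF this that] x show False
          by (auto simp: mem_box inner_diff_left inner_add_left)
      qed
      then show "f x = 0" by (rule assms(4))
    qed
    finally show ?thesis .
  qed
  have "((\<lambda>h. integral (cbox (- B) B) (\<lambda>x. f (x + h *\<^sub>R v))) has_real_derivative
      integral (cbox (- B) B) (\<lambda>x. ?f' (x + 0 *\<^sub>R v) v)) (at 0 within {-1..1})"
  proof (rule leibniz_rule_field_derivative)
    fix h :: real and x
    interpret bounded_linear "?f' (x + h *\<^sub>R v)" using df by (rule has_derivative_bounded_linear)
    have "((\<lambda>h. f (x + h *\<^sub>R v)) has_derivative (\<lambda>s. ?f' (x + h *\<^sub>R v) (s *\<^sub>R v))) (at h within {-1..1})"
      by (rule has_derivative_compose[where f = "\<lambda>h. x + h *\<^sub>R v" and g = f, OF _ df]) (auto intro!: derivative_eq_intros)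
    moreover have "(\<lambda>s. ?f' (x + h *\<^sub>R v) (s *\<^sub>R v)) = (*) (?f' (x + h *\<^sub>R v) v)"
      by (rule ext) (simp add: scaleR)
    ultimately show "((\<lambda>h. f (x + h *\<^sub>R v)) has_real_derivative ?f' (x + h *\<^sub>R v) v) (at h within {-1..1})"
      by (simp add: has_field_derivative_def)
  next
    show "(\<lambda>x. f (x + h *\<^sub>R v)) integrable_on cbox (- B) B" for h
      by (rule integrable_continuous) (auto intro!: continuous_on_compose2[OF cont(1)] continuous_intros)
    show "continuous_on ({-1..1} \<times> cbox (- B) B) (\<lambda>(h, x). ?f' (x + h *\<^sub>R v) v)"
      unfolding case_prod_beta by (auto intro!: continuous_on_compose2[OF cont(2)] continuous_intros)
  qed auto
  then have 1: "((\<lambda>h. integral UNIV f) has_real_derivative integral (cbox (- B) B) (\<lambda>x. ?f' (x + 0 *\<^sub>R v) v)) (at 0 within {-1..1})"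
    by (rule has_field_derivative_transform_within[where d = 1]) (use shift in auto)
  have "integral (cbox (- B) B) (\<lambda>x. ?f' (x + 0 *\<^sub>R v) v) = 0"
    by (rule has_field_derivative_unique[OF 1 DERIV_const]) (simp add: trivial_limit_within)
  moreover have "integral (cbox (- B) B) (\<lambda>x. ?f' x v) = integral UNIV (\<lambda>x. ?f' x v)"
    by (rule integral_eq_integral_UNIV) (use B[of _ 0] f'_0 in auto)
  ultimately show ?thesis by simp
qed

lemma integral_directional_derivative:
  fixes f :: "'a::euclidean_space \<Rightarrow> real"
  assumes "open A" "Ck_on 1 A f" "compact K" "K \<subseteq> cbox a b" "cbox a b \<subseteq> A" "\<And>x. x \<in> A \<Longrightarrow> x \<notin> K \<Longrightarrow> f x = 0"
  shows "integral (cbox a b) (\<lambda>x. frechet_derivative f (at x) v) = 0"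
proof -
  define F where "F x = (if x \<in> A then f x else 0)" for x
  have F_A: "Ck_on 1 A F" using Ck_on_cong[OF assms(1), of F f 1] assms(2) by (simp add: F_def)
  have o: "open (- K)" using assms(3) by (simp add: compact_imp_closed open_Compl)
  have F_0: "F x = 0" if "x \<notin> K" for x using that assms(6) by (auto simp: F_def)
  have F_K: "Ck_on 1 (- K) F"
    using Ck_on_cong[OF o, of F "\<lambda>x. 0" 1] Ck_on_const[OF o] F_0 by auto
  have C: "Ck_on 1 UNIV F"
  proof (rule Ck_on_local)
    fix x
    show "\<exists>V. open V \<and> x \<in> V \<and> Ck_on 1 V F"
      using F_A F_K assms(1,4,5) o by (cases "x \<in> A") blast+
  qed
  have eq: "frechet_derivative F (at x) = frechet_derivative f (at x)" if "x \<in> A" for x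
  proof -
    have "(f has_derivative frechet_derivative f (at x)) (at x)"
      using assms(2) that by (auto simp: frechet_derivative_works)
    then have "(F has_derivative frechet_derivative f (at x)) (at x)"
      by (rule has_derivative_transform_within_open[OF _ assms(1) that]) (simp add: F_def)
    from frechet_derivative_at[OF this] show ?thesis by simp
  qed
  have F'_0: "frechet_derivative F (at x) v = 0" if "x \<notin> K" for x
  proof -
    have "(F has_derivative (\<lambda>v. 0)) (at x)"
      by (rule has_derivative_transform_within_open[OF has_derivative_const o]) (use F_0 that in auto)
    from frechet_derivative_at[OF this] show ?thesis by metis
  qed
  have "integral (cbox a b) (\<lambda>x. frechet_derivative f (at x) v) = integral (cbox a b) (\<lambda>x. frechet_derivative F (at x) v)"
    by (rule integral_cong) (use assms(5) eq in auto)
  also have "\<dots> = integral UNIV (\<lambda>x. frechet_derivative F (at x) v)"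
    by (rule integral_eq_integral_UNIV) (use F'_0 assms(4) in auto)
  also have "\<dots> = 0"
    by (rule integral_directional_derivative_UNIV[OF C _ _ F_0]) (use assms(3) in \<open>auto intro: compact_imp_bounded compact_imp_closed\<close>)
  finally show ?thesis .
qed

text \<open>The determinant in question is the time component \<open>V i0\<close> of the divergence-free field. Its time
  derivative is minus the spatial divergence, whose integral vanishes: the spatial components
  contain the row \<open>\<partial>\<^sub>s G\<close>, which is zero outside \<open>K\<close>.\<close>

lemma frame_integral_homotopy:
  fixes G :: "(real ^ 'n::finite) \<times> real \<Rightarrow> real ^ 'm::finite"
  assumes card: "CARD('m) = CARD('n) + 1"
    and W: "open W" "Ck_on 2 W G" "\<And>y. y \<in> W \<Longrightarrow> G y \<bullet> G y = 1"
    and K: "compact K" "K \<subseteq> cbox a b" "\<And>u s. (u, s) \<in> W \<Longrightarrow> u \<notin> K \<Longrightarrow> G (u, s) = G0 u"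
    and A: "open A" "cbox a b \<subseteq> A" "A \<times> {0..1} \<subseteq> W"
  shows "integral (cbox a b) (\<lambda>u. frame_det (G (u, 0)) (\<lambda>\<alpha>::'n. partial_deriv \<alpha> (\<lambda>u. G (u, 0)) u))
       = integral (cbox a b) (\<lambda>u. frame_det (G (u, 1)) (\<lambda>\<alpha>::'n. partial_deriv \<alpha> (\<lambda>u. G (u, 1)) u))"
proof -
  have "cbox a b \<times> {0..1} \<subseteq> W" using A(2,3) by blast
  note W = W this
  let ?s = "slot :: 'm \<Rightarrow> 'n option"
  let ?D = "\<lambda>y. frechet_derivative G (at y)"
  \<comment> \<open>The space-time directions: the slot of the normal stands for time.\<close>
  define e :: "'m \<Rightarrow> (real ^ 'n) \<times> real" where
    "e i = (case ?s i of None \<Rightarrow> (0, 1) | Some \<alpha> \<Rightarrow> (axis \<alpha> 1, 0))" for i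
  define V where "V i y = det (\<chi> j. if j = i then G y else ?D y (e j))" for i y
  define i0 where "i0 = inv ?s None"
  note bij = bij_slot[OF card]
  have s_i0: "?s i = None \<longleftrightarrow> i = i0" for i
    unfolding i0_def using bij by (metis bij_inv_eq_iff)
  have dG: "(G has_derivative ?D y) (at y)" if "y \<in> W" for y
    using W(2) that by (auto simp: numeral_2_eq_2 frechet_derivative_works)
  have C_D: "Ck_on 1 W (\<lambda>y. ?D y h)" for h
    using Ck_on_Suc_frechet[of 1 W G h] W(2) by (simp only: numeral_2_eq_2 One_nat_def)
  have C_G: "Ck_on 1 W G"
    using Ck_on_mono[OF W(2), of 1] by simp
  have C_V: "Ck_on 1 W (V i)" for i
    unfolding V_def
  proof (rule Ck_on_det_rows[OF W(1)])
    show "Ck_on 1 W (\<lambda>y. if j = i then G y else ?D y (e j))" for j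
      by (cases "j = i") (simp_all add: C_G C_D del: Ck_on.simps One_nat_def)
  qed
  have dV: "(V i has_derivative frechet_derivative (V i) (at y)) (at y)" if "y \<in> W" for y i
    using C_V that by (auto simp: frechet_derivative_works)
  have cont_dV: "continuous_on W (\<lambda>y. frechet_derivative (V i) (at y) h)" for i h
    using Ck_on_Suc_frechet[of 0 W "V i" h] C_V[of i] by (simp only: One_nat_def Ck_on.simps(1))
  have div0: "(\<Sum>i\<in>UNIV. frechet_derivative (V i) (at y) (e i)) = 0" if "y \<in> W" for y
    using divergence_free[OF W(1,2) W(3) that, of e] by (simp add: V_def[abs_def])
  have slice: "((\<lambda>u. h (u, s)) has_derivative (\<lambda>v. h' (v, 0))) (at u)"
    if "(h has_derivative h') (at (u, s))" for h :: "(real ^ 'n) \<times> real \<Rightarrow> 'z::real_normed_vector" and h' u s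
    by (rule has_derivative_compose[where f = "\<lambda>u. (u, s)" and g = h, OF _ that]) (auto intro!: derivative_eq_intros)
  have frame: "frame_det (G (u, s)) (\<lambda>\<alpha>::'n. partial_deriv \<alpha> (\<lambda>u. G (u, s)) u) = V i0 (u, s)"
    if "(u, s) \<in> W" for u s
  proof -
    have pd: "partial_deriv \<alpha> (\<lambda>u. G (u, s)) u = ?D (u, s) (axis \<alpha> 1, 0)" for \<alpha>
      unfolding partial_deriv_def using frechet_derivative_at[OF slice[OF dG[OF that]]] by metis
    have "(case ?s j of None \<Rightarrow> G (u, s) | Some \<alpha> \<Rightarrow> ?D (u, s) (axis \<alpha> 1, 0))
        = (if j = i0 then G (u, s) else ?D (u, s) (e j))" for j
      using s_i0[of j] by (cases "?s j") (auto simp: e_def)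
    then have "frame_rows (G (u, s)) (\<lambda>\<alpha>::'n. partial_deriv \<alpha> (\<lambda>u. G (u, s)) u)
        = (\<chi> j. if j = i0 then G (u, s) else ?D (u, s) (e j))"
      unfolding frame_rows_def pd by presburger
    then show ?thesis by (simp add: frame_det_def V_def)
  qed
  have time0: "?D (u, s) (0, 1) = 0" if "(u, s) \<in> W" "u \<notin> K" for u s
  proof -
    have o: "open (W \<inter> (- K) \<times> UNIV)"
      using W(1) K(1) by (intro open_Int open_Times) (auto intro: compact_imp_closed)
    define g where "g t = G (u, s + t)" for t
    have "((\<lambda>t::real. (u, s + t)) has_derivative (\<lambda>t. (0, t))) (at 0)"
      by (auto intro!: derivative_eq_intros)
    from has_derivative_compose[OF this, of G "?D (u, s)"] dG[OF that(1)]
    have "(g has_derivative (\<lambda>t. ?D (u, s) (0, t))) (at 0)"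
      unfolding g_def[abs_def] by simp
    moreover have "(g has_derivative (\<lambda>t. 0)) (at 0)"
    proof (rule has_derivative_transform_within_open)
      show "((\<lambda>t. G0 u) has_derivative (\<lambda>t. 0)) (at (0::real))" by simp
      have "open ((\<lambda>t. (u, s + t)) -` W)"
        by (rule open_vimage[OF W(1)]) (auto intro!: continuous_intros)
      then show "open {t. (u, s + t) \<in> W}" by (simp add: vimage_def)
    qed (use that K(3) in \<open>auto simp: g_def\<close>)
    ultimately have "(\<lambda>t. ?D (u, s) (0, t)) = (\<lambda>t. 0)" by (rule has_derivative_unique)
    then show ?thesis by (rule fun_cong)
  qed
  have V_0: "V i (u, s) = 0" if "(u, s) \<in> W" "u \<notin> K" "i \<noteq> i0" for i u s
  proof -
    have "(\<chi> j. if j = i then G (u, s) else ?D (u, s) (e j)) $ i0 = 0"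
      using that time0 s_i0[of i0] by (simp add: e_def)
    then show ?thesis unfolding V_def by (intro det_zero_row(1)[of i0]) (simp add: row_def vec_eq_iff)
  qed
  have flux0: "integral (cbox a b) (\<lambda>u. frechet_derivative (V i) (at (u, s)) (e i)) = 0"
    if i: "i \<noteq> i0" and s: "s \<in> {0..1}" for i s
  proof -
    obtain \<alpha> where e: "e i = (axis \<alpha> 1, 0)" using s_i0[of i] i by (auto simp: e_def split: option.splits)
    have AW: "(\<lambda>u. (u, s)) ` A \<subseteq> W" using A(3) s by auto
    have "Ck_on 1 A (\<lambda>u. (u, s))"
      by (intro Ck_on_Pair A(1) Ck_on_const Ck_on_bounded_linear bounded_linear_ident)
    from Ck_on_compose[OF A(1) W(1) AW this C_V]
    have C: "Ck_on 1 A (\<lambda>u. V i (u, s))" .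
    have "integral (cbox a b) (\<lambda>u. frechet_derivative (\<lambda>u. V i (u, s)) (at u) (axis \<alpha> 1)) = 0"
      by (rule integral_directional_derivative[OF A(1) C K(1,2) A(2)]) (use AW V_0 i in auto)
    moreover have "frechet_derivative (\<lambda>u. V i (u, s)) (at u) (axis \<alpha> 1) = frechet_derivative (V i) (at (u, s)) (e i)"
      if "u \<in> cbox a b" for u
    proof -
      have y: "(u, s) \<in> W" using that W(4) s by auto
      show ?thesis unfolding e frechet_derivative_at[OF slice[OF dV[OF y]], symmetric] ..
    qed
    ultimately show ?thesis
      by (subst integral_cong[where g = "\<lambda>u. frechet_derivative (\<lambda>u. V i (u, s)) (at u) (axis \<alpha> 1)"]) simp_all
  qed
  define f where "f s = integral (cbox a b) (\<lambda>u. V i0 (u, s))" for s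
  have cont: "continuous_on (cbox a b) (\<lambda>u. frechet_derivative (V i) (at (u, s)) h)" if "s \<in> {0..1}" for i s h
    by (rule continuous_on_compose2[OF cont_dV]) (use W(4) that in \<open>auto intro!: continuous_intros\<close>)
  have "(f has_real_derivative 0) (at s within {0..1})" if s: "s \<in> {0..1}" for s
  proof -
    have "(f has_real_derivative integral (cbox a b) (\<lambda>u. frechet_derivative (V i0) (at (u, s)) (0, 1))) (at s within {0..1})"
      unfolding f_def
    proof (rule leibniz_rule_field_derivative)
      show "((\<lambda>s. V i0 (u, s)) has_real_derivative frechet_derivative (V i0) (at (u, s)) (0, 1)) (at s within {0..1})"
        if "s \<in> {0..1}" "u \<in> cbox a b" for s u
      proof -
        have y: "(u, s) \<in> W" using that W(4) by auto
        interpret bounded_linear "frechet_derivative (V i0) (at (u, s))"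
          using dV[OF y] by (rule has_derivative_bounded_linear)
        have "((\<lambda>s. V i0 (u, s)) has_derivative (\<lambda>t. frechet_derivative (V i0) (at (u, s)) (0, t))) (at s within {0..1})"
          by (rule has_derivative_compose[where f = "\<lambda>s. (u, s)" and g = "V i0", OF _ dV[OF y]])
            (auto intro!: derivative_eq_intros)
        moreover have "(\<lambda>t. frechet_derivative (V i0) (at (u, s)) (0, t)) = (*) (frechet_derivative (V i0) (at (u, s)) (0, 1))"
        proof
          fix t show "frechet_derivative (V i0) (at (u, s)) (0, t) = frechet_derivative (V i0) (at (u, s)) (0, 1) * t"
            using scaleR[of t "(0, 1)"] by simp
        qed
        ultimately show ?thesis by (simp add: has_field_derivative_def)
      qed
      show "(\<lambda>u. V i0 (u, s)) integrable_on cbox a b" if "s \<in> {0..1}" for s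
        by (rule integrable_continuous, rule continuous_on_compose2[OF Ck_on_imp_continuous_on[OF C_V]])
          (use W(4) that in \<open>auto intro!: continuous_intros\<close>)
      show "continuous_on ({0..1} \<times> cbox a b) (\<lambda>(s, u). frechet_derivative (V i0) (at (u, s)) (0, 1))"
        unfolding case_prod_beta
        by (rule continuous_on_compose2[OF cont_dV]) (use W(4) in \<open>auto intro!: continuous_intros\<close>)
    qed (use s in auto)
    moreover have "integral (cbox a b) (\<lambda>u. frechet_derivative (V i0) (at (u, s)) (0, 1)) = 0"
    proof -
      have "frechet_derivative (V i0) (at (u, s)) (0, 1) = (\<Sum>i\<in>UNIV - {i0}. - frechet_derivative (V i) (at (u, s)) (e i))"
        if "u \<in> cbox a b" for u
      proof -
        have "e i0 = (0, 1)" using s_i0[of i0] by (simp add: e_def)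
        moreover have "(u, s) \<in> W" using W(4) s that by auto
        ultimately show ?thesis using div0[of "(u, s)"]
          sum.remove[of UNIV i0 "\<lambda>i. frechet_derivative (V i) (at (u, s)) (e i)"]
          by (simp add: sum_negf eq_neg_iff_add_eq_0)
      qed
      then have "integral (cbox a b) (\<lambda>u. frechet_derivative (V i0) (at (u, s)) (0, 1)) =
          integral (cbox a b) (\<lambda>u. \<Sum>i\<in>UNIV - {i0}. - frechet_derivative (V i) (at (u, s)) (e i))"
        by (rule integral_cong)
      also have "\<dots> = (\<Sum>i\<in>UNIV - {i0}. integral (cbox a b) (\<lambda>u. - frechet_derivative (V i) (at (u, s)) (e i)))"
        by (intro integral_sum finite_Diff finite integrable_neg integrable_continuous cont s)
      also have "\<dots> = 0" using flux0 s by (simp add: sum.neutral)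
      finally show ?thesis .
    qed
    ultimately show ?thesis by simp
  qed
  then have "\<exists>c. \<forall>s\<in>{0..1}. f s = c"
    by (intro has_field_derivative_zero_constant) auto
  then have "f 0 = f 1" by auto
  moreover have "f s = integral (cbox a b) (\<lambda>u. frame_det (G (u, s)) (\<lambda>\<alpha>::'n. partial_deriv \<alpha> (\<lambda>u. G (u, s)) u))"
    if "s \<in> {0..1}" for s
    unfolding f_def using W(4) that by (intro integral_cong frame[symmetric]) auto
  ultimately show ?thesis by simp
qed

section \<open>Change of variables for nonnegative functions\<close>

lemma nn_integral_eq_iff_absolutely_integrable:
  fixes f :: "'a::euclidean_space \<Rightarrow> real"
  assumes meas: "(\<lambda>x. indicator T x * f x) \<in> borel_measurable borel" and nonneg: "\<And>x. x \<in> T \<Longrightarrow> 0 \<le> f x" and "0 \<le> r"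
  shows "(\<integral>\<^sup>+x\<in>T. ennreal (f x) \<partial>lborel) = ennreal r \<longleftrightarrow> f absolutely_integrable_on T \<and> integral T f = r"
proof
  let ?h = "\<lambda>x. indicator T x * f x"
  assume *: "(\<integral>\<^sup>+x\<in>T. ennreal (f x) \<partial>lborel) = ennreal r"
  have "(\<integral>\<^sup>+x\<in>T. ennreal (f x) \<partial>lborel) = (\<integral>\<^sup>+x. ennreal (?h x) \<partial>lborel)"
    by (intro nn_integral_cong) (auto simp: indicator_def)
  with * have "(?h has_integral r) UNIV"
    by (intro nn_integral_has_integral) (use assms in \<open>auto simp: indicator_def\<close>)
  moreover have "?h = (\<lambda>x. if x \<in> T then f x else 0)" by auto
  ultimately have "(f has_integral r) T" by (simp add: has_integral_restrict_UNIV)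
  then show "f absolutely_integrable_on T \<and> integral T f = r"
    using nonneg by (auto intro!: nonnegative_absolutely_integrable_1 simp: has_integral_iff)
next
  assume "f absolutely_integrable_on T \<and> integral T f = r"
  then have "(f has_integral r) T"
    by (auto simp: has_integral_iff absolutely_integrable_on_def)
  from nn_integral_has_integral_lebesgue'[OF nonneg this]
  show "(\<integral>\<^sup>+x\<in>T. ennreal (f x) \<partial>lborel) = ennreal r" by simp
qed

text \<open>The change of variables formula for absolutely integrable functions is an equivalence: one
  side is integrable with value \<open>r\<close> if and only if the other is. Hence the two nonnegative
  integrals take the same finite values, and are infinite together.\<close>

lemma nn_integral_change_of_variables_wellorder:
  fixes g :: "real ^ 'k::{finite,wellorder} \<Rightarrow> real ^ 'k::_" and w1 w2 :: "real ^ 'k::_ \<Rightarrow> real"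
  assumes S: "S \<in> sets borel" and der: "\<And>x. x \<in> S \<Longrightarrow> (g has_derivative g' x) (at x within S)" and inj: "inj_on g S"
    and nonneg: "\<And>y. y \<in> g ` S \<Longrightarrow> 0 \<le> w2 y" and w: "\<And>x. x \<in> S \<Longrightarrow> w1 x = \<bar>det (matrix (g' x))\<bar> * w2 (g x)"
    and meas: "(\<lambda>x. indicator S x * w1 x) \<in> borel_measurable borel"
      "(\<lambda>y. indicator (g ` S) y * w2 y) \<in> borel_measurable borel"
  shows "(\<integral>\<^sup>+x\<in>S. ennreal (w1 x) \<partial>lborel) = (\<integral>\<^sup>+y\<in>g ` S. ennreal (w2 y) \<partial>lborel)"
proof -
  have "w1 absolutely_integrable_on S \<and> integral S w1 = r \<longleftrightarrow> w2 absolutely_integrable_on (g ` S) \<and> integral (g ` S) w2 = r" for r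
  proof -
    let ?v = "\<lambda>y. vec (w2 y) :: real ^ 1"
    have "w1 absolutely_integrable_on S \<longleftrightarrow> (\<lambda>x. \<bar>det (matrix (g' x))\<bar> * w2 (g x)) absolutely_integrable_on S"
      by (rule set_integrable_cong) (use w in auto)
    moreover have "integral S w1 = integral S (\<lambda>x. \<bar>det (matrix (g' x))\<bar> * w2 (g x))"
      by (rule integral_cong) (use w in auto)
    ultimately show ?thesis
      using has_absolute_integral_change_of_variables[OF _ der inj, of ?v "vec r"] S
      by (simp add: absolutely_integrable_on_1_iff integral_on_1_eq)
  qed
  moreover have "0 \<le> w1 x" if "x \<in> S" for x using that w nonneg by auto
  ultimately have iff: "(\<integral>\<^sup>+x\<in>S. ennreal (w1 x) \<partial>lborel) = ennreal r \<longleftrightarrow> (\<integral>\<^sup>+y\<in>g ` S. ennreal (w2 y) \<partial>lborel) = ennreal r"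
    if "0 \<le> r" for r
    using nn_integral_eq_iff_absolutely_integrable[OF meas(1) _ that]
      nn_integral_eq_iff_absolutely_integrable[OF meas(2) nonneg that] by simp
  show ?thesis
  proof (cases "(\<integral>\<^sup>+x\<in>S. ennreal (w1 x) \<partial>lborel)" rule: ennreal_cases)
    case (real r) with iff[of r] show ?thesis by simp
  next
    case top
    show ?thesis
      by (cases "(\<integral>\<^sup>+y\<in>g ` S. ennreal (w2 y) \<partial>lborel)" rule: ennreal_cases) (use top iff in auto)
  qed
qed

text \<open>The formula above asks for a well-ordered index type. A copy of a finite index type receives
  such an order from an enumeration, and relabelling coordinates preserves Lebesgue measure and
  determinants, so the formula transfers to arbitrary finite index types.\<close>

typedef 'n wo_copy = "UNIV :: 'n set" by simp

instance wo_copy :: (finite) finite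
proof
  have "surj (Abs_wo_copy :: 'a \<Rightarrow> _)" by (metis Rep_wo_copy_inverse surjI)
  then show "finite (UNIV :: 'a wo_copy set)" by (metis finite finite_imageI)
qed

instantiation wo_copy :: (finite) wellorder
begin

definition less_eq_wo_copy :: "'a wo_copy \<Rightarrow> 'a wo_copy \<Rightarrow> bool" where
  "x \<le> y \<longleftrightarrow> to_nat (Rep_wo_copy x) \<le> to_nat (Rep_wo_copy y)"

definition less_wo_copy :: "'a wo_copy \<Rightarrow> 'a wo_copy \<Rightarrow> bool" where
  "x < y \<longleftrightarrow> to_nat (Rep_wo_copy x) < to_nat (Rep_wo_copy y)"

instance
proof
  fix P :: "'a wo_copy \<Rightarrow> bool" and a
  assume *: "\<And>x. (\<And>y. y < x \<Longrightarrow> P y) \<Longrightarrow> P x"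
  show "P a"
    by (induction a rule: measure_induct_rule[of "\<lambda>x. to_nat (Rep_wo_copy x)"])
      (auto intro: * simp: less_wo_copy_def)
qed (auto simp: less_eq_wo_copy_def less_wo_copy_def Rep_wo_copy_inject)

end

definition to_wo :: "real ^ 'n::finite \<Rightarrow> real ^ 'n wo_copy" where
  "to_wo x = (\<chi> i. x $ Rep_wo_copy i)"

definition of_wo :: "real ^ 'n::finite wo_copy \<Rightarrow> real ^ 'n" where
  "of_wo y = (\<chi> i. y $ Abs_wo_copy i)"

lemma to_wo_of_wo [simp]: "to_wo (of_wo y) = y" and of_wo_to_wo [simp]: "of_wo (to_wo x) = x"
  by (simp_all add: to_wo_def of_wo_def vec_eq_iff Rep_wo_copy_inverse Abs_wo_copy_inverse)

lemma bij_Rep_wo_copy: "bij Rep_wo_copy"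
  by (metis Abs_wo_copy_inverse Rep_wo_copy_inverse UNIV_I bijI')

lemma bounded_linear_to_wo: "bounded_linear to_wo" and bounded_linear_of_wo: "bounded_linear of_wo"
  unfolding linear_conv_bounded_linear[symmetric]
  by (auto intro!: linearI simp: to_wo_def of_wo_def vec_eq_iff)

lemma measurable_of_wo [measurable]: "of_wo \<in> borel_measurable borel"
  by (intro borel_measurable_continuous_onI linear_continuous_on bounded_linear_of_wo)

lemma prod_Basis_vec: "(\<Prod>b\<in>Basis. x \<bullet> b) = (\<Prod>i\<in>UNIV. x $ i)" for x :: "real ^ 'n::finite"
proof -
  have "inj (\<lambda>i::'n. axis i (1::real))" by (rule injI) (simp add: axis_eq_axis)
  from prod.reindex[OF this, of "\<lambda>b. x \<bullet> b"]
  have "(\<Prod>b\<in>range (\<lambda>i. axis i 1). x \<bullet> b) = (\<Prod>i\<in>UNIV. x $ i)" by (simp add: o_def inner_axis)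
  moreover have "(Basis :: (real ^ 'n) set) = range (\<lambda>i. axis i 1)" by (auto simp: Basis_vec_def)
  ultimately show ?thesis by (simp only:)
qed

lemma distr_of_wo: "distr lborel borel of_wo = lborel"
proof (rule lborel_eqI[symmetric])
  fix l u :: "real ^ 'n" assume le: "\<And>b. b \<in> Basis \<Longrightarrow> l \<bullet> b \<le> u \<bullet> b"
  have "of_wo -` box l u = box (to_wo l) (to_wo u)"
    by (auto simp: mem_box_cart to_wo_def of_wo_def) (metis Abs_wo_copy_inverse Rep_wo_copy_inverse UNIV_I)+
  then have "emeasure (distr lborel borel of_wo) (box l u) = emeasure lborel (box (to_wo l) (to_wo u))"
    by (subst emeasure_distr) auto
  also have "\<dots> = (\<Prod>b\<in>Basis. (to_wo u - to_wo l) \<bullet> b)"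
  proof (rule emeasure_lborel_box)
    fix b :: "real ^ 'n wo_copy" assume "b \<in> Basis"
    then obtain i where "b = axis i 1" by (auto simp: Basis_vec_def)
    moreover have "axis (Rep_wo_copy i) 1 \<in> (Basis :: (real ^ 'n) set)" by (auto simp: Basis_vec_def)
    ultimately show "to_wo l \<bullet> b \<le> to_wo u \<bullet> b"
      using le[of "axis (Rep_wo_copy i) 1"] by (simp add: inner_axis to_wo_def)
  qed
  also have "(\<Prod>b\<in>Basis. (to_wo u - to_wo l) \<bullet> b) = (\<Prod>i\<in>UNIV. (u - l) $ Rep_wo_copy i)"
    by (simp add: prod_Basis_vec to_wo_def)
  also have "\<dots> = (\<Prod>i\<in>UNIV. (u - l) $ i)"
    by (rule prod.reindex_bij_betw) (use bij_Rep_wo_copy in simp)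
  also have "\<dots> = (\<Prod>b\<in>Basis. (u - l) \<bullet> b)"
    by (rule prod_Basis_vec[symmetric])
  finally show "emeasure (distr lborel borel of_wo) (box l u) = (\<Prod>b\<in>Basis. (u - l) \<bullet> b)" .
qed simp

lemma nn_integral_change_of_variables:
  fixes g :: "real ^ 'n::finite \<Rightarrow> real ^ 'n" and w1 w2 :: "real ^ 'n \<Rightarrow> real"
  assumes S: "S \<in> sets borel" and der: "\<And>x. x \<in> S \<Longrightarrow> (g has_derivative g' x) (at x within S)" and inj: "inj_on g S"
    and nonneg: "\<And>y. y \<in> g ` S \<Longrightarrow> 0 \<le> w2 y" and w: "\<And>x. x \<in> S \<Longrightarrow> w1 x = \<bar>det (matrix (g' x))\<bar> * w2 (g x)"
    and meas [measurable]: "(\<lambda>x. indicator S x * w1 x) \<in> borel_measurable borel"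
      "(\<lambda>y. indicator (g ` S) y * w2 y) \<in> borel_measurable borel"
  shows "(\<integral>\<^sup>+x\<in>S. ennreal (w1 x) \<partial>lborel) = (\<integral>\<^sup>+y\<in>g ` S. ennreal (w2 y) \<partial>lborel)"
proof -
  define G where "G = to_wo \<circ> g \<circ> of_wo"
  let ?S = "to_wo ` S"
  have vim: "to_wo ` T = of_wo -` T" for T :: "(real ^ 'n) set"
    by (auto simp: image_iff) (metis to_wo_of_wo)
  have GS: "G ` ?S = to_wo ` g ` S" by (simp add: G_def image_image)
  have ind: "indicator (to_wo ` T) y = (indicator T (of_wo y) :: real)" for T :: "(real ^ 'n) set" and y
    unfolding vim by (auto simp: indicator_def)
  have pull: "(\<integral>\<^sup>+x\<in>T. ennreal (w x) \<partial>lborel) = (\<integral>\<^sup>+y\<in>to_wo ` T. ennreal (w (of_wo y)) \<partial>lborel)"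
    if [measurable]: "(\<lambda>x. indicator T x * w x) \<in> borel_measurable borel" for T and w :: "real ^ 'n \<Rightarrow> real"
  proof -
    have "(\<integral>\<^sup>+x\<in>T. ennreal (w x) \<partial>lborel) = (\<integral>\<^sup>+x. ennreal (indicator T x * w x) \<partial>distr lborel borel of_wo)"
      unfolding distr_of_wo by (intro nn_integral_cong) (auto simp: indicator_def)
    also have "\<dots> = (\<integral>\<^sup>+y. ennreal (indicator T (of_wo y) * w (of_wo y)) \<partial>lborel)"
      by (subst nn_integral_distr) auto
    also have "\<dots> = (\<integral>\<^sup>+y\<in>to_wo ` T. ennreal (w (of_wo y)) \<partial>lborel)"
      unfolding vim by (intro nn_integral_cong) (auto simp: indicator_def)
    finally show ?thesis .
  qed
  have mat: "matrix (to_wo \<circ> L \<circ> of_wo) = (\<chi> i j. matrix L $ Rep_wo_copy i $ Rep_wo_copy j)" for L :: "real ^ 'n \<Rightarrow> real ^ 'n"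
  proof -
    have ax: "of_wo (axis j 1) = axis (Rep_wo_copy j) (1::real)" for j :: "'n wo_copy"
      by (auto simp: of_wo_def vec_eq_iff axis_def Rep_wo_copy_inverse) (metis Abs_wo_copy_inverse UNIV_I)
    show ?thesis by (simp only: matrix_def to_wo_def o_apply ax vec_lambda_beta)
  qed
  have "(\<integral>\<^sup>+x\<in>?S. ennreal (w1 (of_wo x)) \<partial>lborel) = (\<integral>\<^sup>+y\<in>G ` ?S. ennreal (w2 (of_wo y)) \<partial>lborel)"
  proof (rule nn_integral_change_of_variables_wellorder)
    show "?S \<in> sets borel"
      unfolding vim using measurable_sets[OF measurable_of_wo, of S] S by simp
    show "(G has_derivative (to_wo \<circ> g' (of_wo x) \<circ> of_wo)) (at x within ?S)" if "x \<in> ?S" for x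
    proof -
      have x: "of_wo x \<in> S" using that by auto
      have "of_wo ` ?S = S" by (auto simp: image_iff)
      then have "(g \<circ> of_wo has_derivative (g' (of_wo x) \<circ> of_wo)) (at x within ?S)"
        by (intro diff_chain_within bounded_linear_imp_has_derivative bounded_linear_of_wo) (use der[OF x] in simp)
      from bounded_linear.has_derivative[OF bounded_linear_to_wo this] show ?thesis
        by (simp add: G_def o_def)
    qed
    show "inj_on G ?S"
      using inj by (auto simp: inj_on_def G_def) (metis of_wo_to_wo)
    show "w1 (of_wo x) = \<bar>det (matrix (to_wo \<circ> g' (of_wo x) \<circ> of_wo))\<bar> * w2 (of_wo (G x))" if "x \<in> ?S" for x
      using w that by (auto simp: mat det_reindex[OF bij_Rep_wo_copy] G_def)
    show "0 \<le> w2 (of_wo y)" if "y \<in> G ` ?S" for y using nonneg that by (auto simp: GS)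
    show "(\<lambda>x. indicator ?S x * w1 (of_wo x)) \<in> borel_measurable borel"
      unfolding ind using measurable_compose[OF measurable_of_wo meas(1)] by simp
    show "(\<lambda>y. indicator (G ` ?S) y * w2 (of_wo y)) \<in> borel_measurable borel"
      unfolding GS ind using measurable_compose[OF measurable_of_wo meas(2)] by simp
  qed
  then show ?thesis using pull[OF meas(1)] pull[OF meas(2)] GS by simp
qed

section \<open>Measures with prescribed chart densities\<close>

locale closed_manifold =
  fixes X :: "'a topology" and \<A> :: "('a, 'n::finite) chart set"
  assumes manifold: "closed_smooth_manifold X \<A>"
begin

abbreviation borel_algebra :: "'a measure" where
  "borel_algebra \<equiv> sigma (topspace X) {U. openin X U}"

lemma space_borel_algebra [simp]: "space borel_algebra = topspace X"
  by (rule space_measure_of) (auto dest: openin_subset)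

lemma sets_borel_algebra: "sets borel_algebra = sigma_sets (topspace X) {U. openin X U}"
  by (rule sets_measure_of) (auto dest: openin_subset)

lemma openin_in_sets: "openin X U \<Longrightarrow> U \<in> sets borel_algebra"
  by (auto simp: sets_borel_algebra)

lemma measurable_of_continuous_map:
  assumes "continuous_map X euclidean (f :: 'a \<Rightarrow> 'b::topological_space)"
  shows "f \<in> borel_measurable borel_algebra"
proof (rule borel_measurableI)
  fix S :: "'b set" assume "open S"
  then have "openin X {x \<in> topspace X. f x \<in> S}"
    using assms by (auto simp: continuous_map_def)
  moreover have "f -` S \<inter> space borel_algebra = {x \<in> topspace X. f x \<in> S}" by auto
  ultimately show "f -` S \<inter> space borel_algebra \<in> sets borel_algebra"
    using openin_in_sets by simp
qed

lemma
  assumes "(U, \<phi>) \<in> \<A>"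
  shows chart_openin: "openin X U" and chart_open_image: "open (\<phi> ` U)"
    and chart_homeo: "homeomorphic_map (subtopology X U) (top_of_set (\<phi> ` U)) \<phi>"
    and chart_subset: "U \<subseteq> topspace X"
    and chart_topspace: "topspace (subtopology X U) = U"
proof -
  show "openin X U" "open (\<phi> ` U)" "homeomorphic_map (subtopology X U) (top_of_set (\<phi> ` U)) \<phi>"
    using manifold assms unfolding closed_smooth_manifold_def smooth_atlas_def is_chart_def by fast+
  then show "U \<subseteq> topspace X" by (simp add: openin_subset)
  then show "topspace (subtopology X U) = U" by auto
qed

lemma chart_inj: "(U, \<phi>) \<in> \<A> \<Longrightarrow> inj_on \<phi> U"
  using chart_homeo chart_topspace homeomorphic_imp_injective_map by metis

text \<open>The values of a coordinate map outside its chart domain are arbitrary, hence the intersection.\<close>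

lemma chart_image_open:
  assumes "(U, \<phi>) \<in> \<A>" "openin X W"
  shows "open (\<phi> ` (W \<inter> U))"
proof -
  have "openin (subtopology X U) (W \<inter> U)" using assms(2) by (auto simp: openin_subtopology)
  then have "openin (top_of_set (\<phi> ` U)) (\<phi> ` (W \<inter> U))"
    using homeomorphic_imp_open_map[OF chart_homeo[OF assms(1)]] by (auto simp: open_map_def)
  then show ?thesis using chart_open_image[OF assms(1)] openin_open_trans by blast
qed

lemma chart_preimage_openin:
  assumes "(U, \<phi>) \<in> \<A>" "open W"
  shows "openin X {p \<in> U. \<phi> p \<in> W}"
proof -
  have "continuous_map (subtopology X U) (top_of_set (\<phi> ` U)) \<phi>"
    using chart_homeo[OF assms(1)] homeomorphic_imp_continuous_map by blast
  then have "continuous_map (subtopology X U) euclidean \<phi>"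
    using continuous_map_in_subtopology by blast
  then have "openin (subtopology X U) {p \<in> topspace (subtopology X U). \<phi> p \<in> W}"
    using assms(2) unfolding continuous_map_def by auto
  then have "openin (subtopology X U) {p \<in> U. \<phi> p \<in> W}"
    unfolding chart_topspace[OF assms(1)] .
  then show ?thesis using openin_trans_full chart_openin[OF assms(1)] by blast
qed

lemma chart_at_exists:
  assumes "p \<in> topspace X"
  obtains U \<phi> where "(U, \<phi>) \<in> \<A>" "p \<in> U"
proof -
  have "(\<Union>(U, \<phi>)\<in>\<A>. U) = topspace X"
    using manifold unfolding closed_smooth_manifold_def smooth_atlas_def by simp
  with assms show thesis using that by blast
qed

lemma transition_smooth:
  "(U, \<phi>) \<in> \<A> \<Longrightarrow> (V, \<psi>) \<in> \<A> \<Longrightarrow> smooth_on (\<phi> ` (U \<inter> V)) (\<psi> \<circ> inv_into U \<phi>)"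
  using manifold unfolding closed_smooth_manifold_def smooth_atlas_def by fast

lemma inv_chart [simp]: "(U, \<phi>) \<in> \<A> \<Longrightarrow> p \<in> U \<Longrightarrow> inv_into U \<phi> (\<phi> p) = p"
  using chart_inj by (simp add: inv_into_f_f)

lemma chart_inv [simp]: "u \<in> \<phi> ` U \<Longrightarrow> \<phi> (inv_into U \<phi> u) = u"
  by (simp add: f_inv_into_f)

lemma chart_image_eq_vimage:
  assumes "(U, \<phi>) \<in> \<A>"
  shows "\<phi> ` (B \<inter> U) = inv_into U \<phi> -` B \<inter> \<phi> ` U"
  using assms inv_chart[OF assms] by (auto simp: image_iff) 

lemma measurable_inv_chart:
  assumes c: "(U, \<phi>) \<in> \<A>"
  shows "inv_into U \<phi> \<in> measurable (restrict_space lborel (\<phi> ` U)) borel_algebra"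
proof (rule measurable_measure_of)
  show "{U. openin X U} \<subseteq> Pow (topspace X)" by (auto dest: openin_subset)
  show "inv_into U \<phi> \<in> space (restrict_space lborel (\<phi> ` U)) \<rightarrow> topspace X"
    using chart_subset[OF c] by (auto simp: space_restrict_space c)
  show "inv_into U \<phi> -` W \<inter> space (restrict_space lborel (\<phi> ` U)) \<in> sets (restrict_space lborel (\<phi> ` U))"
    if "W \<in> {U. openin X U}" for W
    using chart_image_open[OF c, of W] that chart_open_image[OF c]
    by (auto simp: space_restrict_space sets_restrict_space_iff chart_image_eq_vimage[OF c])
qed

lemma chart_image_borel:
  assumes c: "(U, \<phi>) \<in> \<A>" and B: "B \<in> sets borel_algebra"
  shows "\<phi> ` (B \<inter> U) \<in> sets borel"
  using measurable_sets[OF measurable_inv_chart[OF c] B] chart_open_image[OF c]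
  by (auto simp: space_restrict_space sets_restrict_space_iff chart_image_eq_vimage[OF c])

definition chart_measure :: "('a, 'n) chart \<Rightarrow> (real ^ 'n \<Rightarrow> real) \<Rightarrow> 'a measure" where
  "chart_measure = (\<lambda>(U, \<phi>) w. distr (density (restrict_space lborel (\<phi> ` U)) (\<lambda>u. ennreal (w u)))
     borel_algebra (inv_into U \<phi>))"

lemma sets_chart_measure [simp]: "sets (chart_measure c w) = sets borel_algebra"
  by (simp add: chart_measure_def case_prod_beta)

lemma measurable_weight:
  fixes w :: "real ^ 'n \<Rightarrow> real"
  assumes w: "continuous_on (\<phi> ` U) w"
  shows "w \<in> borel_measurable (restrict_space lborel (\<phi> ` U))"
  using borel_measurable_continuous_on_restrict[OF w]
  by (simp cong: measurable_cong_sets add: sets_restrict_space)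

lemma emeasure_chart_measure:
  assumes c: "(U, \<phi>) \<in> \<A>" and w: "continuous_on (\<phi> ` U) w" and B: "B \<in> sets borel_algebra"
  shows "emeasure (chart_measure (U, \<phi>) w) B = (\<integral>\<^sup>+u\<in>\<phi> ` (B \<inter> U). ennreal (w u) \<partial>lborel)"
proof -
  let ?R = "restrict_space lborel (\<phi> ` U)"
  note meas [measurable] = measurable_weight[OF w]
  have im: "\<phi> ` (B \<inter> U) \<in> sets ?R"
    using chart_image_borel[OF c B] chart_open_image[OF c] by (auto simp: sets_restrict_space_iff)
  have "emeasure (chart_measure (U, \<phi>) w) B = emeasure (density ?R (\<lambda>u. ennreal (w u))) (inv_into U \<phi> -` B \<inter> \<phi> ` U)"
    unfolding chart_measure_def split using measurable_inv_chart[OF c] B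
    by (subst emeasure_distr) (auto simp: space_restrict_space cong: measurable_cong_sets)
  also have "\<dots> = emeasure (density ?R (\<lambda>u. ennreal (w u))) (\<phi> ` (B \<inter> U))"
    by (simp add: chart_image_eq_vimage[OF c])
  also have "\<dots> = (\<integral>\<^sup>+u\<in>\<phi> ` (B \<inter> U). ennreal (w u) \<partial>?R)"
    by (rule emeasure_density) (use im in auto)
  also have "\<dots> = (\<integral>\<^sup>+u\<in>\<phi> ` U. (ennreal (w u) * indicator (\<phi> ` (B \<inter> U)) u) \<partial>lborel)"
    by (rule nn_integral_restrict_space) (use chart_open_image[OF c] in auto)
  also have "\<dots> = (\<integral>\<^sup>+u\<in>\<phi> ` (B \<inter> U). ennreal (w u) \<partial>lborel)"
    by (intro nn_integral_cong) (auto simp: indicator_def)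
  finally show ?thesis .
qed

definition has_chart_density :: "'a measure \<Rightarrow> (('a, 'n) chart \<Rightarrow> real ^ 'n \<Rightarrow> real) \<Rightarrow> bool" where
  "has_chart_density \<mu> w \<longleftrightarrow> sets \<mu> = sets borel_algebra \<and>
     (\<forall>(U, \<phi>)\<in>\<A>. \<forall>B\<in>sets \<mu>. B \<subseteq> U \<longrightarrow>
        emeasure \<mu> B = (\<integral>\<^sup>+u\<in>\<phi> ` B. ennreal (w (U, \<phi>) u) \<partial>lborel))"

definition continuous_weight :: "(('a, 'n) chart \<Rightarrow> real ^ 'n \<Rightarrow> real) \<Rightarrow> bool" where
  "continuous_weight w \<longleftrightarrow> (\<forall>(U, \<phi>)\<in>\<A>. continuous_on (\<phi> ` U) (w (U, \<phi>)))"

lemma has_chart_densityD: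
  assumes "has_chart_density \<mu> w" "(U, \<phi>) \<in> \<A>" "B \<in> sets borel_algebra" "B \<subseteq> U"
  shows "emeasure \<mu> B = (\<integral>\<^sup>+u\<in>\<phi> ` B. ennreal (w (U, \<phi>) u) \<partial>lborel)"
proof -
  have "case (U, \<phi>) of (U, \<phi>) \<Rightarrow> \<forall>B\<in>sets \<mu>. B \<subseteq> U \<longrightarrow>
        emeasure \<mu> B = (\<integral>\<^sup>+u\<in>\<phi> ` B. ennreal (w (U, \<phi>) u) \<partial>lborel)"
    using assms(1,2) unfolding has_chart_density_def by blast
  then show ?thesis using assms(1,3,4) by (simp add: has_chart_density_def)
qed

lemma finite_cover:
  assumes "\<And>p. p \<in> topspace X \<Longrightarrow> openin X (Q p) \<and> p \<in> Q p"
  obtains P where "finite P" "P \<subseteq> topspace X" "topspace X = (\<Union>p\<in>P. Q p)"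
proof -
  have "compact_space X" using manifold by (simp add: closed_smooth_manifold_def)
  then have "\<exists>\<F>. finite \<F> \<and> \<F> \<subseteq> Q ` topspace X \<and> topspace X \<subseteq> \<Union>\<F>"
  proof -
    have "\<forall>U\<in>Q ` topspace X. openin X U" "topspace X \<subseteq> \<Union>(Q ` topspace X)" using assms by auto
    with spec[OF iffD1[OF compact_space_alt \<open>compact_space X\<close>], of "Q ` topspace X"]
    show ?thesis by blast
  qed
  then obtain \<F> where F: "finite \<F>" "\<F> \<subseteq> Q ` topspace X" "topspace X \<subseteq> \<Union>\<F>" by blast
  then obtain P where P: "P \<subseteq> topspace X" "finite P" "\<F> = Q ` P"
    using finite_subset_image[OF F(1,2)] by blast
  moreover have "Q p \<subseteq> topspace X" if "p \<in> P" for p using P that assms openin_subset by blast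
  ultimately show thesis using that[of P] F by blast
qed

text \<open>A finite Borel partition subordinate to the atlas. It reduces statements about measures on the
  manifold to single charts, and it is obtained by disjointing a finite cover.\<close>

lemma chart_partition:
  "\<exists>m c D. (\<forall>k<m. c k \<in> \<A> \<and> D k \<subseteq> fst (c k)) \<and> (\<forall>k. D k \<in> sets borel_algebra) \<and>
     disjoint_family D \<and> (\<Union>k<m::nat. D k) = topspace X"
proof -
  have "\<exists>d. d \<in> \<A> \<and> p \<in> fst d" if "p \<in> topspace X" for p
    using chart_at_exists[OF that] by (metis fst_conv)
  then obtain d where d: "\<And>p. p \<in> topspace X \<Longrightarrow> d p \<in> \<A> \<and> p \<in> fst (d p)" by metis
  have "openin X (fst (d p))" if "p \<in> topspace X" for p
    using d[OF that] chart_openin[of "fst (d p)" "snd (d p)"] by simp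
  with d obtain P where P: "finite P" "P \<subseteq> topspace X" "topspace X = (\<Union>p\<in>P. fst (d p))"
    by (elim finite_cover[of "\<lambda>p. fst (d p)", rotated -1]) simp_all
  obtain xs where xs: "set xs = P" using finite_list[OF P(1)] by blast
  define m where "m = length xs"
  define c where "c k = d (xs ! k)" for k
  define E where "E k = (if k < m then fst (c k) else {})" for k
  have c_A: "c k \<in> \<A>" if "k < m" for k
    using that d[of "xs ! k"] P(2) nth_mem[of k xs] xs by (auto simp: c_def m_def)
  have "E k \<in> sets borel_algebra" for k
    using chart_openin[of "fst (c k)" "snd (c k)"] c_A[of k] by (auto simp: E_def intro: openin_in_sets)
  then have D_sets: "disjointed E k \<in> sets borel_algebra" for k
    unfolding disjointed_def by (intro sets.Diff sets.finite_UN) auto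
  have D_E: "disjointed E k \<subseteq> E k" for k by (rule disjointed_subset)
  have "(\<Union>k<m. disjointed E k) = (\<Union>k. disjointed E k)"
  proof (intro equalityI subsetI)
    fix p assume "p \<in> (\<Union>k. disjointed E k)"
    then obtain k where k: "p \<in> disjointed E k" by blast
    then have "k < m" using D_E[of k] by (cases "k < m") (auto simp: E_def)
    then show "p \<in> (\<Union>k<m. disjointed E k)" using k by blast
  qed blast
  also have "\<dots> = (\<Union>k. E k)" by (rule UN_disjointed_eq)
  also have "\<dots> = (\<Union>k<m. fst (d (xs ! k)))" by (auto simp: E_def c_def)
  also have "\<dots> = topspace X"
    unfolding P(3) xs[symmetric] m_def by (auto simp: set_conv_nth)
  finally have U: "(\<Union>k<m. disjointed E k) = topspace X" .
  have D_c: "disjointed E k \<subseteq> fst (c k)" if "k < m" for k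
    using D_E[of k] that by (simp add: E_def)
  show ?thesis
    using c_A D_c D_sets disjoint_family_disjointed[of E] U by (intro exI[of _ m] exI[of _ c] exI[of _ "disjointed E"]) simp
qed

lemma has_chart_density_unique:
  assumes "has_chart_density \<mu> w" "has_chart_density \<nu> w"
  shows "\<mu> = \<nu>"
proof (rule measure_eqI)
  show s: "sets \<mu> = sets \<nu>" using assms by (simp add: has_chart_density_def)
  obtain m c D where P0: "\<forall>k<m. c k \<in> \<A> \<and> D k \<subseteq> fst (c k)" "\<forall>k. D k \<in> sets borel_algebra"
    "disjoint_family D" "(\<Union>k<m::nat. D k) = topspace X"
    using chart_partition by (elim exE conjE)
  then have P: "\<And>k. k < m \<Longrightarrow> c k \<in> \<A>" "\<And>k. k < m \<Longrightarrow> D k \<subseteq> fst (c k)"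
    "\<And>k. D k \<in> sets borel_algebra" "disjoint_family D" "(\<Union>k<m. D k) = topspace X" by auto
  fix B assume "B \<in> sets \<mu>"
  then have B: "B \<in> sets borel_algebra" using assms by (simp add: has_chart_density_def)
  have split: "emeasure \<kappa> B = (\<Sum>k<m. emeasure \<kappa> (B \<inter> D k))" if "has_chart_density \<kappa> w" for \<kappa>
  proof -
    have sk: "sets \<kappa> = sets borel_algebra" using that by (simp add: has_chart_density_def)
    have "(\<Sum>k<m. emeasure \<kappa> (B \<inter> D k)) = emeasure \<kappa> (\<Union>k<m. B \<inter> D k)"
      by (rule sum_emeasure) (use B P(3,4) in \<open>auto simp: sk disjoint_family_on_def\<close>)
    also have "(\<Union>k<m. B \<inter> D k) = B" using P(5) sets.sets_into_space[OF B] by auto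
    finally show ?thesis ..
  qed
  have "emeasure \<mu> (B \<inter> D k) = emeasure \<nu> (B \<inter> D k)" if "k < m" for k
  proof -
    obtain U \<phi> where c: "c k = (U, \<phi>)" by fastforce
    show ?thesis
      using has_chart_densityD[OF assms(1), of U \<phi> "B \<inter> D k"] has_chart_densityD[OF assms(2), of U \<phi> "B \<inter> D k"]
        P(1,2)[OF that] c B P(3)[of k] by (simp add: le_infI2)
  qed
  then show "emeasure \<mu> B = emeasure \<nu> B" using split assms by simp
qed

text \<open>The measure is glued from the chart measures along a partition. That it has the right density in
  every chart, not only in those of the partition, is what the compatibility condition is for.\<close>

lemma has_chart_density_exists:
  assumes w: "continuous_weight w"
    and compat: "\<And>U \<phi> V \<psi> B. (U, \<phi>) \<in> \<A> \<Longrightarrow> (V, \<psi>) \<in> \<A> \<Longrightarrow> B \<in> sets borel_algebra \<Longrightarrow> B \<subseteq> U \<inter> V \<Longrightarrow>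
      (\<integral>\<^sup>+u\<in>\<phi> ` B. ennreal (w (U, \<phi>) u) \<partial>lborel) = (\<integral>\<^sup>+u\<in>\<psi> ` B. ennreal (w (V, \<psi>) u) \<partial>lborel)"
  obtains \<mu> where "has_chart_density \<mu> w"
proof -
  obtain m c D where P0: "\<forall>k<m. c k \<in> \<A> \<and> D k \<subseteq> fst (c k)" "\<forall>k. D k \<in> sets borel_algebra"
    "disjoint_family D" "(\<Union>k<m::nat. D k) = topspace X"
    using chart_partition by (elim exE conjE)
  then have P: "\<And>k. k < m \<Longrightarrow> c k \<in> \<A>" "\<And>k. k < m \<Longrightarrow> D k \<subseteq> fst (c k)"
    "\<And>k. D k \<in> sets borel_algebra" "disjoint_family D" "(\<Union>k<m. D k) = topspace X" by auto
  let ?\<nu> = "\<lambda>c. chart_measure c (w c)"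
  define f where "f B = (\<Sum>k<m. emeasure (?\<nu> (c k)) (B \<inter> D k))" for B
  define \<mu> where "\<mu> = measure_of (topspace X) {U. openin X U} f"
  have chart_em: "emeasure (?\<nu> (U, \<phi>)) B = (\<integral>\<^sup>+u\<in>\<phi> ` B. ennreal (w (U, \<phi>) u) \<partial>lborel)"
    if "(U, \<phi>) \<in> \<A>" "B \<in> sets borel_algebra" "B \<subseteq> U" for U \<phi> B
  proof -
    have "continuous_on (\<phi> ` U) (w (U, \<phi>))" using w that(1) unfolding continuous_weight_def by fast
    moreover have "B \<inter> U = B" using that(3) by auto
    ultimately show ?thesis using emeasure_chart_measure[OF that(1) _ that(2), of "w (U, \<phi>)"] by simp
  qed
  have sets_\<mu>: "sets \<mu> = sets borel_algebra"
    unfolding \<mu>_def by (subst sets_measure_of) (auto simp: sets_borel_algebra dest: openin_subset)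
  have em: "emeasure \<mu> B = f B" if "B \<in> sets borel_algebra" for B
  proof (rule emeasure_measure_of[OF \<mu>_def])
    show "{U. openin X U} \<subseteq> Pow (topspace X)" by (auto dest: openin_subset)
    show "B \<in> sets \<mu>" using that sets_\<mu> by simp
    show "positive (sets \<mu>) f" by (simp add: positive_def f_def)
    show "countably_additive (sets \<mu>) f"
    proof (rule countably_additiveI)
      fix A :: "nat \<Rightarrow> 'a set" assume A: "range A \<subseteq> sets \<mu>" "disjoint_family A"
      have "(\<Sum>i. f (A i)) = (\<Sum>k<m. \<Sum>i. emeasure (?\<nu> (c k)) (A i \<inter> D k))"
        unfolding f_def by (rule suminf_sum) (simp add: summableI)
      also have "\<dots> = (\<Sum>k<m. emeasure (?\<nu> (c k)) (\<Union>i. A i \<inter> D k))"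
        by (intro sum.cong refl suminf_emeasure)
          (use A P(3) in \<open>auto simp: sets_\<mu> disjoint_family_on_def\<close>)
      also have "\<dots> = f (\<Union>i. A i)" by (simp add: f_def)
      finally show "(\<Sum>i. f (A i)) = f (\<Union>i. A i)" .
    qed
  qed
  have "has_chart_density \<mu> w" unfolding has_chart_density_def
  proof (intro conjI sets_\<mu> ballI, clarify)
    fix V \<psi> B assume V: "(V, \<psi>) \<in> \<A>" and B: "B \<in> sets \<mu>" "B \<subseteq> V"
    have B': "B \<in> sets borel_algebra" using B sets_\<mu> by simp
    have "emeasure \<mu> B = f B" by (rule em[OF B'])
    also have "\<dots> = (\<Sum>k<m. emeasure (?\<nu> (V, \<psi>)) (B \<inter> D k))"
      unfolding f_def
    proof (rule sum.cong[OF refl])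
      fix k assume "k \<in> {..<m}"
      then have k: "k < m" by simp
      obtain U \<phi> where c: "c k = (U, \<phi>)" by fastforce
      have U: "(U, \<phi>) \<in> \<A>" "D k \<subseteq> U" using P(1,2)[OF k] c by auto
      have BD: "B \<inter> D k \<in> sets borel_algebra" using B' P(3) by auto
      have "(\<integral>\<^sup>+u\<in>\<phi> ` (B \<inter> D k). ennreal (w (U, \<phi>) u) \<partial>lborel) = (\<integral>\<^sup>+u\<in>\<psi> ` (B \<inter> D k). ennreal (w (V, \<psi>) u) \<partial>lborel)"
        by (rule compat[OF U(1) V BD]) (use U B in auto)
      then show "emeasure (?\<nu> (c k)) (B \<inter> D k) = emeasure (?\<nu> (V, \<psi>)) (B \<inter> D k)"
        unfolding c using chart_em[OF U(1) BD le_infI2[OF U(2)]] chart_em[OF V BD le_infI1[OF B(2)]] by simp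
    qed
    also have "\<dots> = emeasure (?\<nu> (V, \<psi>)) (\<Union>k<m. B \<inter> D k)"
      by (rule sum_emeasure) (use B' P(3,4) in \<open>auto simp: disjoint_family_on_def\<close>)
    also have "(\<Union>k<m. B \<inter> D k) = B" using P(5) sets.sets_into_space[OF B'] by auto
    also have "emeasure (?\<nu> (V, \<psi>)) B = (\<integral>\<^sup>+u\<in>\<psi> ` B. ennreal (w (V, \<psi>) u) \<partial>lborel)"
      by (rule chart_em[OF V B' B(2)])
    finally show "emeasure \<mu> B = (\<integral>\<^sup>+u\<in>\<psi> ` B. ennreal (w (V, \<psi>) u) \<partial>lborel)" .
  qed
  then show thesis by (rule that)
qed

text \<open>A chart domain may have infinite coordinate volume, so finiteness comes from covering the
  manifold by preimages of coordinate balls whose closures lie inside the charts.\<close>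

lemma finite_measure_chart_density:
  assumes \<mu>: "has_chart_density \<mu> w" and w: "continuous_weight w"
  shows "finite_measure \<mu>"
proof (rule finite_measureI)
  have s: "sets \<mu> = sets borel_algebra" using \<mu> by (simp add: has_chart_density_def)
  then have sp: "space \<mu> = topspace X" using sets_eq_imp_space_eq[OF s] by simp
  have "\<exists>W. openin X W \<and> p \<in> W \<and> emeasure \<mu> W < \<infinity>" if p: "p \<in> topspace X" for p
  proof -
    obtain U \<phi> where c: "(U, \<phi>) \<in> \<A>" "p \<in> U" using chart_at_exists[OF p] .
    obtain r where r: "r > 0" "cball (\<phi> p) r \<subseteq> \<phi> ` U"
      using chart_open_image[OF c(1)] c(2) by (meson imageI open_contains_cball)
    let ?W = "{q \<in> U. \<phi> q \<in> ball (\<phi> p) r}"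
    have o: "openin X ?W" by (rule chart_preimage_openin[OF c(1)]) simp
    have W: "\<phi> ` ?W \<subseteq> cball (\<phi> p) r" by auto
    have "continuous_on (cball (\<phi> p) r) (w (U, \<phi>))"
      using w c(1) r(2) unfolding continuous_weight_def by (blast intro: continuous_on_subset)
    then have "compact (w (U, \<phi>) ` cball (\<phi> p) r)" by (intro compact_continuous_image) auto
    then obtain M where M: "\<And>u. u \<in> cball (\<phi> p) r \<Longrightarrow> w (U, \<phi>) u \<le> M"
      by (metis bounded_real compact_imp_bounded imageI abs_le_D1)
    have "emeasure \<mu> ?W = (\<integral>\<^sup>+u\<in>\<phi> ` ?W. ennreal (w (U, \<phi>) u) \<partial>lborel)"
      by (rule has_chart_densityD[OF \<mu> c(1) openin_in_sets[OF o]]) auto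
    also have "\<dots> \<le> (\<integral>\<^sup>+u. ennreal M * indicator (cball (\<phi> p) r) u \<partial>lborel)"
      using W M by (intro nn_integral_mono) (auto simp: indicator_def intro!: ennreal_leI)
    also have "\<dots> = ennreal M * emeasure lborel (cball (\<phi> p) r)"
      by (rule nn_integral_cmult_indicator) auto
    also have "\<dots> < \<infinity>"
      using emeasure_lborel_cball_finite[of "\<phi> p" r] by (simp add: ennreal_mult_less_top)
    finally show ?thesis using o c(2) r(1) by (intro exI[of _ ?W]) auto
  qed
  then obtain W where W: "\<And>p. p \<in> topspace X \<Longrightarrow> openin X (W p) \<and> p \<in> W p \<and> emeasure \<mu> (W p) < \<infinity>" by metis
  then obtain P where P: "finite P" "P \<subseteq> topspace X" "topspace X = (\<Union>p\<in>P. W p)"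
    by (elim finite_cover[of W, rotated -1]) simp_all
  have "W p \<in> sets \<mu>" if "p \<in> P" for p using that W P(2) openin_in_sets s by auto
  then have "emeasure \<mu> (\<Union>p\<in>P. W p) \<le> (\<Sum>p\<in>P. emeasure \<mu> (W p))"
    by (intro emeasure_subadditive_finite P(1)) auto
  also have "\<dots> < \<infinity>" using W P(1,2) by (auto simp: ennreal_sum_less_top)
  finally show "emeasure \<mu> (space \<mu>) \<noteq> \<infinity>" using P(3) sp by simp
qed

lemma density_indicator_chart:
  assumes \<mu>: "has_chart_density \<mu> w" and w: "continuous_weight w" and c: "(U, \<phi>) \<in> \<A>"
  shows "density \<mu> (\<lambda>p. ennreal (indicator U p)) = chart_measure (U, \<phi>) (w (U, \<phi>))"
proof -
  let ?w = "w (U, \<phi>)"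
  have s: "sets \<mu> = sets borel_algebra" using \<mu> by (simp add: has_chart_density_def)
  have cw: "continuous_on (\<phi> ` U) ?w" using w(1) c unfolding continuous_weight_def by fast
  have U [measurable]: "U \<in> sets \<mu>" using chart_openin[OF c] openin_in_sets s by simp
  show ?thesis
  proof (rule measure_eqI)
    fix B assume "B \<in> sets (density \<mu> (\<lambda>p. ennreal (indicator U p)))"
    then have B: "B \<in> sets \<mu>" by simp
    have "emeasure (density \<mu> (\<lambda>p. ennreal (indicator U p))) B = (\<integral>\<^sup>+p. ennreal (indicator U p) * indicator B p \<partial>\<mu>)"
      by (rule emeasure_density) (use B in auto)
    also have "\<dots> = (\<integral>\<^sup>+p. indicator (B \<inter> U) p \<partial>\<mu>)"
      by (intro nn_integral_cong) (auto simp: indicator_def)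
    also have "\<dots> = emeasure \<mu> (B \<inter> U)" using B by simp
    also have "\<dots> = emeasure (chart_measure (U, \<phi>) ?w) B"
      using has_chart_densityD[OF \<mu> c, of "B \<inter> U"] emeasure_chart_measure[OF c cw, of B] B U s by simp
    finally show "emeasure (density \<mu> (\<lambda>p. ennreal (indicator U p))) B = emeasure (chart_measure (U, \<phi>) ?w) B" .
  qed (simp add: s)
qed

lemma nn_integral_in_chart:
  assumes \<mu>: "has_chart_density \<mu> w" and w: "continuous_weight w" and c: "(U, \<phi>) \<in> \<A>"
    and h [measurable]: "h \<in> borel_measurable borel_algebra"
  shows "(\<integral>\<^sup>+p\<in>U. h p \<partial>\<mu>) = (\<integral>\<^sup>+u\<in>\<phi> ` U. ennreal (w (U, \<phi>) u) * h (inv_into U \<phi> u) \<partial>lborel)"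
proof -
  let ?w = "w (U, \<phi>)" and ?R = "restrict_space lborel (\<phi> ` U)"
  have s: "sets \<mu> = sets borel_algebra" using \<mu> by (simp add: has_chart_density_def)
  have h' [measurable]: "h \<in> borel_measurable \<mu>" using h s by (simp cong: measurable_cong_sets)
  have cw: "continuous_on (\<phi> ` U) ?w" using w c unfolding continuous_weight_def by fast
  note [measurable] = measurable_weight[OF cw] measurable_inv_chart[OF c]
  have U [measurable]: "U \<in> sets \<mu>" using chart_openin[OF c] openin_in_sets s by simp
  have "(\<integral>\<^sup>+p\<in>U. h p \<partial>\<mu>) = (\<integral>\<^sup>+p. ennreal (indicator U p) * h p \<partial>\<mu>)"
    by (intro nn_integral_cong) (auto simp: indicator_def)
  also have "\<dots> = integral\<^sup>N (density \<mu> (\<lambda>p. ennreal (indicator U p))) h"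
    by (rule nn_integral_density[symmetric]) auto
  also have "\<dots> = integral\<^sup>N (distr (density ?R (\<lambda>u. ennreal (?w u))) borel_algebra (inv_into U \<phi>)) h"
    unfolding density_indicator_chart[OF \<mu> w c] by (simp add: chart_measure_def)
  also have "\<dots> = (\<integral>\<^sup>+u. h (inv_into U \<phi> u) \<partial>density ?R (\<lambda>u. ennreal (?w u)))"
    by (rule nn_integral_distr) (use h measurable_inv_chart[OF c] in simp_all)
  also have "\<dots> = (\<integral>\<^sup>+u. ennreal (?w u) * h (inv_into U \<phi> u) \<partial>?R)"
    by (rule nn_integral_density) (use measurable_compose[OF measurable_inv_chart[OF c] h] in simp_all)
  also have "\<dots> = (\<integral>\<^sup>+u\<in>\<phi> ` U. ennreal (?w u) * h (inv_into U \<phi> u) \<partial>lborel)"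
    by (rule nn_integral_restrict_space) (use chart_open_image[OF c] in auto)
  finally show ?thesis .
qed

lemma integral_supported_in_chart:
  assumes \<mu>: "has_chart_density \<mu> w" and w: "continuous_weight w" "\<And>u. u \<in> \<phi> ` U \<Longrightarrow> 0 \<le> w (U, \<phi>) u"
    and c: "(U, \<phi>) \<in> \<A>" and K: "cbox a b \<subseteq> \<phi> ` U"
    and h: "h \<in> borel_measurable borel_algebra" "\<And>p. p \<in> topspace X \<Longrightarrow> p \<notin> inv_into U \<phi> ` cbox a b \<Longrightarrow> h p = 0"
    and h_cont: "continuous_on (cbox a b) (\<lambda>u. h (inv_into U \<phi> u) * w (U, \<phi>) u)"
  shows "integral\<^sup>L \<mu> h = integral (cbox a b) (\<lambda>u. h (inv_into U \<phi> u) * w (U, \<phi>) u)"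
proof -
  let ?w = "w (U, \<phi>)" and ?R = "restrict_space lborel (\<phi> ` U)"
  have s: "sets \<mu> = sets borel_algebra" using \<mu> by (simp add: has_chart_density_def)
  then have sp: "space \<mu> = topspace X" using sets_eq_imp_space_eq[OF s] by simp
  have h' [measurable]: "h \<in> borel_measurable \<mu>" using h(1) s by (simp cong: measurable_cong_sets)
  have cw: "continuous_on (\<phi> ` U) ?w" using w(1) c unfolding continuous_weight_def by fast
  note [measurable] = measurable_weight[OF cw] measurable_inv_chart[OF c]
  have U [measurable]: "U \<in> sets \<mu>" using chart_openin[OF c] openin_in_sets s by simp
  have oU: "\<phi> ` U \<in> sets lborel" using chart_open_image[OF c] by auto
  have inv: "inv_into U \<phi> u \<in> U" if "u \<in> \<phi> ` U" for u using that by (rule inv_into_into)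
  note eq = density_indicator_chart[OF \<mu> w(1) c]
  have "integral\<^sup>L \<mu> h = (\<integral>p. indicator U p *\<^sub>R h p \<partial>\<mu>)"
  proof (rule Bochner_Integration.integral_cong[OF refl])
    fix p assume "p \<in> space \<mu>"
    then show "h p = indicator U p *\<^sub>R h p"
      using h(2)[of p] K inv sp by (cases "p \<in> U") auto
  qed
  also have "\<dots> = integral\<^sup>L (density \<mu> (\<lambda>p. ennreal (indicator U p))) h"
    by (rule integral_density[symmetric]) auto
  also have "\<dots> = integral\<^sup>L (distr (density ?R (\<lambda>u. ennreal (?w u))) borel_algebra (inv_into U \<phi>)) h"
    unfolding eq by (simp add: chart_measure_def)
  also have "\<dots> = (\<integral>u. h (inv_into U \<phi> u) \<partial>density ?R (\<lambda>u. ennreal (?w u)))"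
    by (rule integral_distr) (use h(1) measurable_inv_chart[OF c] in simp_all)
  also have "\<dots> = (\<integral>u. ?w u *\<^sub>R h (inv_into U \<phi> u) \<partial>?R)"
    by (rule integral_density)
      (use w(2) h(1) in \<open>auto intro!: AE_I2 simp: space_restrict_space measurable_compose[OF measurable_inv_chart[OF c]]\<close>)
  also have "\<dots> = (\<integral>u. indicator (\<phi> ` U) u *\<^sub>R (?w u *\<^sub>R h (inv_into U \<phi> u)) \<partial>lborel)"
    by (rule integral_restrict_space) (use oU in auto)
  also have "\<dots> = (LINT u:cbox a b|lborel. h (inv_into U \<phi> u) * ?w u)"
    unfolding set_lebesgue_integral_def
  proof (rule Bochner_Integration.integral_cong[OF refl])
    fix u
    have "h (inv_into U \<phi> u) = 0" if "u \<in> \<phi> ` U" "u \<notin> cbox a b"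
    proof (rule h(2))
      show "inv_into U \<phi> u \<in> topspace X" using inv[OF that(1)] chart_subset[OF c] by auto
      show "inv_into U \<phi> u \<notin> inv_into U \<phi> ` cbox a b"
      proof
        assume "inv_into U \<phi> u \<in> inv_into U \<phi> ` cbox a b"
        then obtain v where v: "v \<in> cbox a b" "inv_into U \<phi> u = inv_into U \<phi> v" by blast
        then have "u = v" using inv_into_injective[OF v(2) that(1)] K by blast
        then show False using that v by simp
      qed
    qed
    then show "indicator (\<phi> ` U) u *\<^sub>R (?w u *\<^sub>R h (inv_into U \<phi> u)) = indicator (cbox a b) u *\<^sub>R (h (inv_into U \<phi> u) * ?w u)"
      using K by (auto simp: indicator_def)
  qed
  also have "\<dots> = integral (cbox a b) (\<lambda>u. h (inv_into U \<phi> u) * ?w u)"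
    by (rule set_borel_integral_eq_integral) (use borel_integrable_compact[OF compact_cbox h_cont] in \<open>simp add: set_integrable_def\<close>)
  finally show ?thesis .
qed

end

section \<open>Curvature and surface element as quotients of determinants\<close>

text \<open>For \<open>H = N\<close>, this is the coordinate density of the area of the hypersurface if \<open>K = F\<close>, and of
  the volume swept out by the Gauss map if \<open>K = N\<close>, each up to sign.\<close>

definition jet_det :: "('a, 'n::finite) chart \<Rightarrow> ('a \<Rightarrow> real ^ 'm::finite) \<Rightarrow> ('a \<Rightarrow> real ^ 'm) \<Rightarrow> 'a \<Rightarrow> real" where
  "jet_det = (\<lambda>(U, \<phi>) H K p. frame_det (H p) (\<lambda>\<alpha>::'n. partial_deriv \<alpha> (K \<circ> inv_into U \<phi>) (\<phi> p)))"

context closed_manifold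
begin

definition Ck_map :: "nat \<Rightarrow> ('a \<Rightarrow> 'b::real_normed_vector) \<Rightarrow> bool" where
  "Ck_map k K \<longleftrightarrow> (\<forall>(U, \<phi>)\<in>\<A>. Ck_on k (\<phi> ` U) (K \<circ> inv_into U \<phi>))"

lemma Ck_mapD: "Ck_map k K \<Longrightarrow> (U, \<phi>) \<in> \<A> \<Longrightarrow> Ck_on k (\<phi> ` U) (K \<circ> inv_into U \<phi>)"
  unfolding Ck_map_def by blast

lemma Ck_map_mono: "Ck_map l K \<Longrightarrow> k \<le> l \<Longrightarrow> Ck_map k K"
  unfolding Ck_map_def using Ck_on_mono by blast

lemma transition_has_derivative:
  assumes c: "(U, \<phi>) \<in> \<A>" and d: "(V, \<psi>) \<in> \<A>" and p: "p \<in> U" "p \<in> V"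
  shows "((\<psi> \<circ> inv_into U \<phi>) has_derivative frechet_derivative (\<psi> \<circ> inv_into U \<phi>) (at (\<phi> p))) (at (\<phi> p))"
proof -
  have "Ck_on 1 (\<phi> ` (U \<inter> V)) (\<psi> \<circ> inv_into U \<phi>)"
    using transition_smooth[OF c d] by (simp add: smooth_on_def)
  then show ?thesis using p by (auto simp: frechet_derivative_works)
qed

text \<open>The Jacobian factor depends neither on \<open>H\<close> nor on \<open>K\<close>, so it cancels in quotients, sign
  included. Quotients of two such determinants are therefore well defined without an orientation of
  the atlas.\<close>

lemma jet_det_transition:
  fixes H K :: "'a \<Rightarrow> real ^ 'm::finite"
  assumes card: "CARD('m) = CARD('n) + 1"
    and c: "(U, \<phi>) \<in> \<A>" and d: "(V, \<psi>) \<in> \<A>" and p: "p \<in> U" "p \<in> V" and K: "Ck_map 1 K"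
  shows "jet_det (U, \<phi>) H K p =
    det (matrix (frechet_derivative (\<psi> \<circ> inv_into U \<phi>) (at (\<phi> p)))) * jet_det (V, \<psi>) H K p"
proof -
  let ?g = "\<psi> \<circ> inv_into U \<phi>"
  let ?g' = "frechet_derivative ?g (at (\<phi> p))"
  let ?L = "frechet_derivative (K \<circ> inv_into V \<psi>) (at (\<psi> p))"
  have oUV: "open (\<phi> ` (V \<inter> U))" by (rule chart_image_open[OF c chart_openin[OF d]])
  have dg: "(?g has_derivative ?g') (at (\<phi> p))" by (rule transition_has_derivative[OF c d p])
  have gp: "?g (\<phi> p) = \<psi> p" using c p by simp
  have dL: "((K \<circ> inv_into V \<psi>) has_derivative ?L) (at (\<psi> p))"
    using Ck_mapD[OF K d] p by (simp add: frechet_derivative_works)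
  then interpret L: bounded_linear ?L by (rule has_derivative_bounded_linear)
  have "((K \<circ> inv_into V \<psi>) \<circ> ?g has_derivative ?L \<circ> ?g') (at (\<phi> p))"
    by (rule diff_chain_at[OF dg]) (simp only: gp dL)
  then have "((K \<circ> inv_into U \<phi>) has_derivative ?L \<circ> ?g') (at (\<phi> p))"
    by (rule has_derivative_transform_within_open[OF _ oUV]) (use p c d in auto)
  then have D: "frechet_derivative (K \<circ> inv_into U \<phi>) (at (\<phi> p)) = ?L \<circ> ?g'"
    by (rule frechet_derivative_at[symmetric])
  have "partial_deriv \<alpha> (K \<circ> inv_into U \<phi>) (\<phi> p) =
      (\<Sum>\<beta>\<in>UNIV. transpose (matrix ?g') $ \<alpha> $ \<beta> *\<^sub>R partial_deriv \<beta> (K \<circ> inv_into V \<psi>) (\<psi> p))" for \<alpha>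
  proof -
    have "?g' (axis \<alpha> 1) = (\<Sum>\<beta>\<in>UNIV. ?g' (axis \<alpha> 1) $ \<beta> *\<^sub>R axis \<beta> 1)"
      by (simp add: vec_eq_iff axis_def if_distrib cong: if_cong)
    then have "?L (?g' (axis \<alpha> 1)) = (\<Sum>\<beta>\<in>UNIV. ?g' (axis \<alpha> 1) $ \<beta> *\<^sub>R ?L (axis \<beta> 1))"
      by (metis (mono_tags, lifting) L.scaleR L.sum sum.cong)
    then show ?thesis by (simp add: partial_deriv_def D transpose_def matrix_def)
  qed
  then show ?thesis
    unfolding jet_det_def split by (simp add: frame_det_linear_change[OF card] det_transpose)
qed

lemma jet_det_continuous:
  fixes H K :: "'a \<Rightarrow> real ^ 'm::finite"
  assumes c: "(U, \<phi>) \<in> \<A>" and H: "Ck_map 0 H" and K: "Ck_map 1 K"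
  shows "continuous_on (\<phi> ` U) (\<lambda>u. jet_det (U, \<phi>) H K (inv_into U \<phi> u))"
proof -
  have H': "Ck_on 0 (\<phi> ` U) (\<lambda>u. H (inv_into U \<phi> u))" using Ck_mapD[OF H c] by (simp add: o_def)
  have K': "Ck_on 0 (\<phi> ` U) (\<lambda>u. partial_deriv \<alpha> (K \<circ> inv_into U \<phi>) u)" for \<alpha>
    unfolding partial_deriv_def by (rule Ck_on_frechet[OF Ck_mapD[OF K c]]) simp
  have "Ck_on 0 (\<phi> ` U) (\<lambda>u. det (\<chi> i. (case slot i of None \<Rightarrow> H (inv_into U \<phi> u)
      | Some \<alpha> \<Rightarrow> partial_deriv \<alpha> (K \<circ> inv_into U \<phi>) u)))"
  proof (rule Ck_on_det_rows[OF chart_open_image[OF c]])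
    fix i
    show "Ck_on 0 (\<phi> ` U) (\<lambda>u. case slot i of None \<Rightarrow> H (inv_into U \<phi> u)
      | Some \<alpha> \<Rightarrow> partial_deriv \<alpha> (K \<circ> inv_into U \<phi>) u)"
      using H' K' by (cases "slot i :: 'n option") simp_all
  qed
  then have "continuous_on (\<phi> ` U) (\<lambda>u. det (\<chi> i. (case slot i of None \<Rightarrow> H (inv_into U \<phi> u)
      | Some \<alpha> \<Rightarrow> partial_deriv \<alpha> (K \<circ> inv_into U \<phi>) u)))" by simp
  then show ?thesis
  proof (rule continuous_on_eq)
    fix u assume u: "u \<in> \<phi> ` U"
    have "jet_det (U, \<phi>) H K (inv_into U \<phi> u) =
        frame_det (H (inv_into U \<phi> u)) (\<lambda>\<alpha>. partial_deriv \<alpha> (K \<circ> inv_into U \<phi>) u)"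
      using u by (simp add: jet_det_def)
    then show "det (\<chi> i. (case slot i of None \<Rightarrow> H (inv_into U \<phi> u)
      | Some \<alpha> \<Rightarrow> partial_deriv \<alpha> (K \<circ> inv_into U \<phi>) u)) = jet_det (U, \<phi>) H K (inv_into U \<phi> u)"
      by (simp add: frame_det_def frame_rows_def)
  qed
qed

text \<open>For continuously differentiable maps with nonvanishing denominator, the quotient is the same in
  every chart around the point (\<open>jet_ratio_chart\<close>).\<close>

definition jet_ratio :: "('a \<Rightarrow> real ^ 'm::finite) \<Rightarrow> ('a \<Rightarrow> real ^ 'm) \<Rightarrow> ('a \<Rightarrow> real ^ 'm) \<Rightarrow> ('a \<Rightarrow> real ^ 'm) \<Rightarrow> 'a \<Rightarrow> real" where
  "jet_ratio H K N F p = (let c = SOME c. c \<in> \<A> \<and> p \<in> fst c in jet_det c H K p / jet_det c N F p)"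

lemma jet_ratio_chart:
  fixes H K N F :: "'a \<Rightarrow> real ^ 'm::finite"
  assumes card: "CARD('m) = CARD('n) + 1"
    and c: "(U, \<phi>) \<in> \<A>" and p: "p \<in> U" and K: "Ck_map 1 K" and F: "Ck_map 1 F"
    and nz: "jet_det (U, \<phi>) N F p \<noteq> 0"
  shows "jet_ratio H K N F p = jet_det (U, \<phi>) H K p / jet_det (U, \<phi>) N F p"
proof -
  define d where "d = (SOME c. c \<in> \<A> \<and> p \<in> fst c)"
  have "d \<in> \<A> \<and> p \<in> fst d" unfolding d_def by (rule someI[of _ "(U, \<phi>)"]) (use c p in simp)
  then obtain V \<psi> where d: "d = (V, \<psi>)" "(V, \<psi>) \<in> \<A>" "p \<in> V" by (metis prod.collapse)
  show ?thesis
    using jet_det_transition[OF card c d(2) p d(3) K, of H] jet_det_transition[OF card c d(2) p d(3) F, of N] nz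
    by (simp add: jet_ratio_def d_def[symmetric] d(1) Let_def)
qed

lemma continuous_map_from_charts:
  fixes f :: "'a \<Rightarrow> 'b::topological_space"
  assumes "\<And>U \<phi>. (U, \<phi>) \<in> \<A> \<Longrightarrow> continuous_on (\<phi> ` U) (\<lambda>u. f (inv_into U \<phi> u))"
  shows "continuous_map X euclidean f"
  unfolding continuous_map_def
proof (intro conjI allI impI)
  fix S :: "'b set" assume "openin euclidean S"
  then have S: "open S" by simp
  have "openin X {p \<in> U. f p \<in> S}" if c: "(U, \<phi>) \<in> \<A>" for U \<phi>
  proof -
    have "open ((\<lambda>u. f (inv_into U \<phi> u)) -` S \<inter> \<phi> ` U)"
      using assms[OF c] chart_open_image[OF c] S by (simp add: continuous_on_open_vimage)
    from chart_preimage_openin[OF c this] show ?thesis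
      by (rule back_subst[of "openin X"]) (use c in \<open>auto dest: inj_onD[OF chart_inj[OF c]]\<close>)
  qed
  then have "openin X (\<Union>(U, \<phi>)\<in>\<A>. {p \<in> U. f p \<in> S})" by (intro openin_Union) auto
  moreover have "(\<Union>(U, \<phi>)\<in>\<A>. {p \<in> U. f p \<in> S}) = {p \<in> topspace X. f p \<in> S}"
  proof (intro equalityI subsetI)
    fix p assume p: "p \<in> {p \<in> topspace X. f p \<in> S}"
    then obtain U \<phi> where "(U, \<phi>) \<in> \<A>" "p \<in> U" using chart_at_exists[of p] by blast
    then show "p \<in> (\<Union>(U, \<phi>)\<in>\<A>. {p \<in> U. f p \<in> S})" using p by blast
  next
    fix p assume "p \<in> (\<Union>(U, \<phi>)\<in>\<A>. {p \<in> U. f p \<in> S})"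
    then obtain U \<phi> where "(U, \<phi>) \<in> \<A>" "p \<in> U" "f p \<in> S" by blast
    then show "p \<in> {p \<in> topspace X. f p \<in> S}" using chart_subset[of U \<phi>] by blast
  qed
  ultimately show "openin X {p \<in> topspace X. f p \<in> S}" by simp
qed auto

lemma jet_ratio_continuous:
  fixes H K N F :: "'a \<Rightarrow> real ^ 'm::finite"
  assumes card: "CARD('m) = CARD('n) + 1"
    and C: "Ck_map 0 H" "Ck_map 1 K" "Ck_map 0 N" "Ck_map 1 F"
    and nz: "\<And>U \<phi> p. (U, \<phi>) \<in> \<A> \<Longrightarrow> p \<in> U \<Longrightarrow> jet_det (U, \<phi>) N F p \<noteq> 0"
  shows "continuous_map X euclidean (jet_ratio H K N F)"
proof (rule continuous_map_from_charts)
  fix U \<phi> assume c: "(U, \<phi>) \<in> \<A>"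
  have inv: "inv_into U \<phi> u \<in> U" if "u \<in> \<phi> ` U" for u using that by (rule inv_into_into)
  have "continuous_on (\<phi> ` U) (\<lambda>u. jet_det (U, \<phi>) H K (inv_into U \<phi> u) / jet_det (U, \<phi>) N F (inv_into U \<phi> u))"
    by (intro continuous_on_divide jet_det_continuous c C ballI nz inv)
  then show "continuous_on (\<phi> ` U) (\<lambda>u. jet_ratio H K N F (inv_into U \<phi> u))"
    by (rule continuous_on_eq) (use jet_ratio_chart[OF card c inv C(2,4)] nz[OF c inv] in simp)
qed

definition oriented_immersion :: "('a \<Rightarrow> real ^ 'm::finite) \<Rightarrow> ('a \<Rightarrow> real ^ 'm) \<Rightarrow> bool" where
  "oriented_immersion F N \<longleftrightarrow> Ck_map 2 F \<and> Ck_map 2 N \<and> unit_normal_field X \<A> F N \<and>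
     (\<forall>(U, \<phi>)\<in>\<A>. \<forall>u\<in>\<phi> ` U. inj (frechet_derivative (F \<circ> inv_into U \<phi>) (at u)))"

definition metric_weight :: "('a \<Rightarrow> real ^ 'm::finite) \<Rightarrow> ('a, 'n) chart \<Rightarrow> real ^ 'n \<Rightarrow> real" where
  "metric_weight F = (\<lambda>(U, \<phi>) u. sqrt (det (metric_tensor (F \<circ> inv_into U \<phi>) u)))"

context
  fixes F N :: "'a \<Rightarrow> real ^ 'm::finite"
  assumes card: "CARD('m) = CARD('n) + 1" and FN: "oriented_immersion F N"
begin

lemma oriented_immersion_Ck: "Ck_map 2 F" "Ck_map 2 N" "Ck_map 1 F" "Ck_map 1 N" "Ck_map 0 N"
  using FN Ck_map_mono[of 2 F 1] Ck_map_mono[of 2 N 1] Ck_map_mono[of 2 N 0] by (auto simp: oriented_immersion_def)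

lemma normal_unit: "p \<in> topspace X \<Longrightarrow> N p \<bullet> N p = 1"
  using FN unfolding oriented_immersion_def unit_normal_field_def by (simp add: norm_eq_1)

lemma normal_tangent: "(U, \<phi>) \<in> \<A> \<Longrightarrow> p \<in> U \<Longrightarrow> N p \<bullet> partial_deriv \<alpha> (F \<circ> inv_into U \<phi>) (\<phi> p) = 0"
  using FN unfolding oriented_immersion_def unit_normal_field_def by fast

lemma jet_det_immersion_nonzero:
  assumes c: "(U, \<phi>) \<in> \<A>" and p: "p \<in> U"
  shows "jet_det (U, \<phi>) N F p \<noteq> 0"
proof -
  let ?D = "frechet_derivative (F \<circ> inv_into U \<phi>) (at (\<phi> p))"
  have inj: "inj ?D" using FN c p unfolding oriented_immersion_def by fast
  have "((F \<circ> inv_into U \<phi>) has_derivative ?D) (at (\<phi> p))"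
    using Ck_mapD[OF oriented_immersion_Ck(3) c] p by (simp add: frechet_derivative_works)
  then interpret bounded_linear ?D by (rule has_derivative_bounded_linear)
  show ?thesis unfolding jet_det_def split
  proof (rule frame_det_nonzero[OF card])
    show "N p \<bullet> N p = 1" using normal_unit p chart_subset[OF c] by auto
    show "N p \<bullet> partial_deriv \<alpha> (F \<circ> inv_into U \<phi>) (\<phi> p) = 0" for \<alpha>
      by (rule normal_tangent[OF c p])
    fix a :: "'n \<Rightarrow> real"
    assume "(\<Sum>\<alpha>\<in>UNIV. a \<alpha> *\<^sub>R partial_deriv \<alpha> (F \<circ> inv_into U \<phi>) (\<phi> p)) = 0"
    then have "?D (\<Sum>\<alpha>\<in>UNIV. a \<alpha> *\<^sub>R axis \<alpha> 1) = ?D 0"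
      by (simp only: sum scaleR zero partial_deriv_def)
    then have "(\<Sum>\<alpha>\<in>UNIV. a \<alpha> *\<^sub>R axis \<alpha> (1::real)) = 0" using inj by (rule injD[rotated])
    then have "(\<Sum>\<alpha>\<in>UNIV. a \<alpha> *\<^sub>R axis \<alpha> (1::real)) $ \<beta> = 0" for \<beta> by simp
    then show "a = (\<lambda>\<alpha>. 0)" by (simp add: fun_eq_iff axis_def if_distrib cong: if_cong)
  qed
qed

lemma det_metric_tensor:
  assumes c: "(U, \<phi>) \<in> \<A>" and p: "p \<in> U"
  shows "det (metric_tensor (F \<circ> inv_into U \<phi>) (\<phi> p)) = (jet_det (U, \<phi>) N F p)\<^sup>2"
proof -
  have u: "N p \<bullet> N p = 1" using normal_unit p chart_subset[OF c] by auto
  have "jet_det (U, \<phi>) N F p * jet_det (U, \<phi>) N F p = det (metric_tensor (F \<circ> inv_into U \<phi>) (\<phi> p))"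
    unfolding jet_det_def split metric_tensor_def
    by (rule frame_det_product[OF card u]) (use normal_tangent[OF c p] in \<open>simp_all add: inner_commute\<close>)
  then show ?thesis by (simp add: power2_eq_square)
qed

text \<open>Both equations arise by differentiating a constant: \<open>N \<bullet> N = 1\<close> and \<open>N \<bullet> \<partial>\<^sub>\<beta>F = 0\<close>.\<close>

lemma weingarten:
  assumes c: "(U, \<phi>) \<in> \<A>" and p: "p \<in> U"
  shows "N p \<bullet> partial_deriv \<alpha> (N \<circ> inv_into U \<phi>) (\<phi> p) = 0"
    and "partial_deriv \<alpha> (N \<circ> inv_into U \<phi>) (\<phi> p) \<bullet> partial_deriv \<beta> (F \<circ> inv_into U \<phi>) (\<phi> p) =
      - (curvature_tensor (F \<circ> inv_into U \<phi>) (N \<circ> inv_into U \<phi>) (\<phi> p) $ \<alpha> $ \<beta>)"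
proof -
  let ?r = "F \<circ> inv_into U \<phi>" and ?\<nu> = "N \<circ> inv_into U \<phi>" and ?u = "\<phi> p"
  have u: "?u \<in> \<phi> ` U" using p by simp
  have o: "open (\<phi> ` U)" by (rule chart_open_image[OF c])
  have nu_p: "?\<nu> ?u = N p" using c p by simp
  have dN: "(?\<nu> has_derivative frechet_derivative ?\<nu> (at ?u)) (at ?u)"
    using Ck_mapD[OF oriented_immersion_Ck(4) c] p by (simp add: frechet_derivative_works)
  have "Ck_on 1 (\<phi> ` U) (\<lambda>y. partial_deriv \<beta> ?r y)"
    unfolding partial_deriv_def by (rule Ck_on_frechet[OF Ck_mapD[OF oriented_immersion_Ck(1) c]]) simp
  then have dF: "(partial_deriv \<beta> ?r has_derivative frechet_derivative (partial_deriv \<beta> ?r) (at ?u)) (at ?u)"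
    using p by (simp add: frechet_derivative_works)
  have "((\<lambda>y. ?\<nu> y \<bullet> ?\<nu> y) has_derivative (\<lambda>h. ?\<nu> ?u \<bullet> frechet_derivative ?\<nu> (at ?u) h + frechet_derivative ?\<nu> (at ?u) h \<bullet> ?\<nu> ?u)) (at ?u)"
    by (rule has_derivative_inner[OF dN dN])
  moreover have "((\<lambda>y. ?\<nu> y \<bullet> ?\<nu> y) has_derivative (\<lambda>h. 0)) (at ?u)"
  proof (rule has_derivative_transform_within_open[OF has_derivative_const o u])
    fix y assume "y \<in> \<phi> ` U"
    then obtain q where "q \<in> U" "y = \<phi> q" by blast
    then show "1 = ?\<nu> y \<bullet> ?\<nu> y" using normal_unit[of q] chart_subset[OF c] c by auto
  qed
  ultimately have "(\<lambda>h. ?\<nu> ?u \<bullet> frechet_derivative ?\<nu> (at ?u) h + frechet_derivative ?\<nu> (at ?u) h \<bullet> ?\<nu> ?u) = (\<lambda>h. 0)"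
    by (rule has_derivative_unique)
  from fun_cong[OF this, of "axis \<alpha> 1"] show "N p \<bullet> partial_deriv \<alpha> ?\<nu> ?u = 0"
    unfolding nu_p by (simp add: partial_deriv_def inner_commute)
  have "((\<lambda>y. ?\<nu> y \<bullet> partial_deriv \<beta> ?r y) has_derivative (\<lambda>h. ?\<nu> ?u \<bullet> frechet_derivative (partial_deriv \<beta> ?r) (at ?u) h
      + frechet_derivative ?\<nu> (at ?u) h \<bullet> partial_deriv \<beta> ?r ?u)) (at ?u)"
    by (rule has_derivative_inner[OF dN dF])
  moreover have "((\<lambda>y. ?\<nu> y \<bullet> partial_deriv \<beta> ?r y) has_derivative (\<lambda>h. 0)) (at ?u)"
  proof (rule has_derivative_transform_within_open[OF has_derivative_const o u])
    show "0 = ?\<nu> y \<bullet> partial_deriv \<beta> ?r y" if "y \<in> \<phi> ` U" for y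
      using that normal_tangent[OF c, of _ \<beta>] c by auto
  qed
  ultimately have "(\<lambda>h. ?\<nu> ?u \<bullet> frechet_derivative (partial_deriv \<beta> ?r) (at ?u) h
      + frechet_derivative ?\<nu> (at ?u) h \<bullet> partial_deriv \<beta> ?r ?u) = (\<lambda>h. 0)"
    by (rule has_derivative_unique)
  from fun_cong[OF this, of "axis \<alpha> 1"]
  show "partial_deriv \<alpha> ?\<nu> ?u \<bullet> partial_deriv \<beta> ?r ?u = - (curvature_tensor ?r ?\<nu> ?u $ \<alpha> $ \<beta>)"
    by (simp add: partial_deriv_def[of \<alpha>] curvature_tensor_def)
qed

text \<open>Multiplying the frames \<open>(N, \<partial>N)\<close> and \<open>(N, \<partial>F)\<close> gives the determinant of minus the second
  fundamental form, multiplying \<open>(N, \<partial>F)\<close> with itself gives the metric; their quotient is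
  the determinant of the shape operator up to the sign.\<close>

lemma det_shape_operator:
  assumes c: "(U, \<phi>) \<in> \<A>" and p: "p \<in> U"
  shows "det (shape_operator (F \<circ> inv_into U \<phi>) (N \<circ> inv_into U \<phi>) (\<phi> p)) =
    (-1) ^ CARD('n) * (jet_det (U, \<phi>) N N p / jet_det (U, \<phi>) N F p)"
proof -
  let ?S = "metric_tensor (F \<circ> inv_into U \<phi>) (\<phi> p)"
  let ?B = "curvature_tensor (F \<circ> inv_into U \<phi>) (N \<circ> inv_into U \<phi>) (\<phi> p)"
  have u: "N p \<bullet> N p = 1" using normal_unit p chart_subset[OF c] by auto
  have "jet_det (U, \<phi>) N N p * jet_det (U, \<phi>) N F p =
      det (\<chi> \<alpha> \<beta>. partial_deriv \<alpha> (N \<circ> inv_into U \<phi>) (\<phi> p) \<bullet> partial_deriv \<beta> (F \<circ> inv_into U \<phi>) (\<phi> p))"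
    unfolding jet_det_def split
    by (rule frame_det_product[OF card u]) (use normal_tangent[OF c p] weingarten(1)[OF c p] in \<open>simp_all add: inner_commute\<close>)
  also have "\<dots> = det (\<chi> \<alpha>. (-1) *s ?B $ \<alpha>)"
    by (rule arg_cong[of _ _ det]) (simp add: vec_eq_iff weingarten(2)[OF c p])
  also have "\<dots> = (-1) ^ CARD('n) * det ?B"
    by (subst det_rows_mul) simp
  finally have B: "jet_det (U, \<phi>) N N p * jet_det (U, \<phi>) N F p = (-1) ^ CARD('n) * det ?B" .
  have S: "det ?S = (jet_det (U, \<phi>) N F p)\<^sup>2" by (rule det_metric_tensor[OF c p])
  have nz: "jet_det (U, \<phi>) N F p \<noteq> 0" by (rule jet_det_immersion_nonzero[OF c p])
  then have "invertible ?S" using S by (simp add: invertible_det_nz)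
  then have "det (matrix_inv ?S) * det ?S = 1"
    unfolding invertible_def matrix_inv_def by (metis (mono_tags, lifting) det_I det_mul someI_ex)
  then have shape: "det (shape_operator (F \<circ> inv_into U \<phi>) (N \<circ> inv_into U \<phi>) (\<phi> p)) = det ?B / det ?S"
    using S nz by (simp add: shape_operator_def det_mul field_simps)
  have det_B: "det ?B = (-1) ^ CARD('n) * (jet_det (U, \<phi>) N N p * jet_det (U, \<phi>) N F p)"
    unfolding B by (simp flip: power_mult_distrib mult.assoc)
  show ?thesis unfolding shape det_B S using nz by (simp add: power2_eq_square)
qed

lemma gauss_kronecker_eq:
  assumes p: "p \<in> topspace X"
  shows "gauss_kronecker \<A> F N p = (-1) ^ CARD('n) * jet_ratio N N N F p"
proof -
  have *: "det (shape_operator (F \<circ> inv_into U \<phi>) (N \<circ> inv_into U \<phi>) (\<phi> p)) = (-1) ^ CARD('n) * jet_ratio N N N F p"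
    if "(U, \<phi>) \<in> \<A>" "p \<in> U" for U \<phi>
    using det_shape_operator[OF that] jet_ratio_chart[OF card that oriented_immersion_Ck(4,3) jet_det_immersion_nonzero[OF that]]
    by simp
  obtain U \<phi> where c: "(U, \<phi>) \<in> \<A>" "p \<in> U" using chart_at_exists[OF p] .
  show ?thesis unfolding gauss_kronecker_def
  proof (rule the_equality)
    show "\<forall>(U, \<phi>)\<in>\<A>. p \<in> U \<longrightarrow> (-1) ^ CARD('n) * jet_ratio N N N F p =
        det (shape_operator (F \<circ> inv_into U \<phi>) (N \<circ> inv_into U \<phi>) (\<phi> p))"
      using * by auto
  next
    fix k assume "\<forall>(U, \<phi>)\<in>\<A>. p \<in> U \<longrightarrow>
        k = det (shape_operator (F \<circ> inv_into U \<phi>) (N \<circ> inv_into U \<phi>) (\<phi> p))"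
    then show "k = (-1) ^ CARD('n) * jet_ratio N N N F p" using *[OF c] c by auto
  qed
qed

lemma metric_weight_eq:
  assumes c: "(U, \<phi>) \<in> \<A>" and u: "u \<in> \<phi> ` U"
  shows "metric_weight F (U, \<phi>) u = \<bar>jet_det (U, \<phi>) N F (inv_into U \<phi> u)\<bar>"
  using det_metric_tensor[OF c inv_into_into[OF u]] u by (simp add: metric_weight_def)

lemma continuous_metric_weight: "continuous_weight (metric_weight F)"
  unfolding continuous_weight_def
proof clarify
  fix U \<phi> assume c: "(U, \<phi>) \<in> \<A>"
  have "continuous_on (\<phi> ` U) (\<lambda>u. \<bar>jet_det (U, \<phi>) N F (inv_into U \<phi> u)\<bar>)"
    by (intro continuous_intros jet_det_continuous c oriented_immersion_Ck)
  then show "continuous_on (\<phi> ` U) (metric_weight F (U, \<phi>))"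
    by (rule continuous_on_eq) (simp add: metric_weight_eq[OF c])
qed

lemma metric_weight_compatible:
  assumes c: "(U, \<phi>) \<in> \<A>" and d: "(V, \<psi>) \<in> \<A>" and B: "B \<in> sets borel_algebra" "B \<subseteq> U \<inter> V"
  shows "(\<integral>\<^sup>+u\<in>\<phi> ` B. ennreal (metric_weight F (U, \<phi>) u) \<partial>lborel) =
    (\<integral>\<^sup>+u\<in>\<psi> ` B. ennreal (metric_weight F (V, \<psi>) u) \<partial>lborel)"
proof -
  let ?g = "\<psi> \<circ> inv_into U \<phi>"
  have gB: "?g ` \<phi> ` B = \<psi> ` B" using B(2) c by (force simp: image_image)
  have BU: "B \<inter> U = B" "B \<inter> V = B" using B(2) by auto
  have borel: "\<phi> ` B \<in> sets borel" "\<psi> ` B \<in> sets borel"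
    using chart_image_borel[OF c B(1)] chart_image_borel[OF d B(1)] BU by auto
  have meas: "(\<lambda>u. indicator (\<xi> ` B) u * metric_weight F (W, \<xi>) u) \<in> borel_measurable borel"
    if "(W, \<xi>) \<in> \<A>" "\<xi> ` B \<in> sets borel" "B \<subseteq> W" for W \<xi>
  proof -
    have "continuous_on (\<xi> ` B) (metric_weight F (W, \<xi>))"
      using continuous_metric_weight that unfolding continuous_weight_def by (blast intro: continuous_on_subset image_mono)
    from borel_measurable_continuous_on_indicator[OF that(2) this] show ?thesis by simp
  qed
  have "(\<integral>\<^sup>+u\<in>\<phi> ` B. ennreal (metric_weight F (U, \<phi>) u) \<partial>lborel) =
    (\<integral>\<^sup>+u\<in>?g ` \<phi> ` B. ennreal (metric_weight F (V, \<psi>) u) \<partial>lborel)"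
  proof (rule nn_integral_change_of_variables)
    show "(?g has_derivative frechet_derivative ?g (at u)) (at u within \<phi> ` B)" if "u \<in> \<phi> ` B" for u
      using that B(2) transition_has_derivative[OF c d] has_derivative_at_withinI by blast
    show "inj_on ?g (\<phi> ` B)"
    proof (rule inj_onI)
      fix u v assume uv: "u \<in> \<phi> ` B" "v \<in> \<phi> ` B" "?g u = ?g v"
      then obtain p q where pq: "u = \<phi> p" "v = \<phi> q" "p \<in> B" "q \<in> B" by blast
      then have UV: "p \<in> U" "q \<in> U" "p \<in> V" "q \<in> V" using B(2) by auto
      then have "\<psi> p = \<psi> q" using uv(3) pq c by simp
      then show "u = v" using inj_onD[OF chart_inj[OF d]] UV pq by blast
    qed
    show "0 \<le> metric_weight F (V, \<psi>) y" if "y \<in> ?g ` \<phi> ` B" for y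
      using metric_weight_eq[OF d, of y] that B(2) unfolding gB by auto
    show "metric_weight F (U, \<phi>) u = \<bar>det (matrix (frechet_derivative ?g (at u)))\<bar> * metric_weight F (V, \<psi>) (?g u)"
      if "u \<in> \<phi> ` B" for u
    proof -
      obtain p where p: "p \<in> B" "u = \<phi> p" using \<open>u \<in> \<phi> ` B\<close> by blast
      then have UV: "p \<in> U" "p \<in> V" using B(2) by auto
      show ?thesis
        using metric_weight_eq[OF c, of u] metric_weight_eq[OF d, of "\<psi> p"] UV c d p
          jet_det_transition[OF card c d UV oriented_immersion_Ck(3), of N]
        by (simp add: abs_mult)
    qed
  qed (use borel gB meas c d B(2) in auto)
  then show ?thesis unfolding gB .
qed

lemma surface_element_has_density: "has_chart_density (surface_element X \<A> F) (metric_weight F)"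
proof -
  obtain \<mu> where \<mu>: "has_chart_density \<mu> (metric_weight F)"
    using has_chart_density_exists[OF continuous_metric_weight metric_weight_compatible] by blast
  have "surface_element X \<A> F = (THE \<mu>. has_chart_density \<mu> (metric_weight F))"
    unfolding surface_element_def has_chart_density_def metric_weight_def split ..
  also have "\<dots> = \<mu>" by (rule the_equality) (use \<mu> has_chart_density_unique in blast)+
  finally show ?thesis using \<mu> by simp
qed

lemma total_curvature_eq:
  "total_curvature X \<A> F N = (-1) ^ CARD('n) * (\<integral>p. jet_ratio N N N F p \<partial>surface_element X \<A> F)"
proof -
  have "sets (surface_element X \<A> F) = sets borel_algebra"
    using surface_element_has_density by (simp add: has_chart_density_def)
  then have sp: "space (surface_element X \<A> F) = topspace X" using sets_eq_imp_space_eq[of "surface_element X \<A> F" borel_algebra] by simp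
  have "total_curvature X \<A> F N = (\<integral>p. (-1) ^ CARD('n) * jet_ratio N N N F p \<partial>surface_element X \<A> F)"
    unfolding total_curvature_def
    by (rule Bochner_Integration.integral_cong[OF refl]) (simp add: sp gauss_kronecker_eq)
  then show ?thesis by simp
qed

end

end

section \<open>Total curvatures relative to one surface element\<close>

context closed_manifold
begin

lemma jet_ratio_cong:
  fixes H K N F :: "'a \<Rightarrow> real ^ 'm::finite"
  assumes W: "openin X W" "p \<in> W" and eq: "\<And>q. q \<in> W \<Longrightarrow> H q = K q"
  shows "jet_ratio H H N F p = jet_ratio K K N F p"
proof -
  define c where "c = (SOME c. c \<in> \<A> \<and> p \<in> fst c)"
  obtain V \<psi> where V: "c = (V, \<psi>)" by fastforce
  have "p \<in> topspace X" using W openin_subset by blast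
  then obtain U \<phi> where "(U, \<phi>) \<in> \<A>" "p \<in> U" by (rule chart_at_exists)
  then have "(U, \<phi>) \<in> \<A> \<and> p \<in> fst (U, \<phi>)" by simp
  then have "c \<in> \<A> \<and> p \<in> fst c" unfolding c_def by (rule someI)
  then have c: "(V, \<psi>) \<in> \<A>" "p \<in> V" using V by auto
  have "frechet_derivative (H \<circ> inv_into V \<psi>) (at (\<psi> p)) = frechet_derivative (K \<circ> inv_into V \<psi>) (at (\<psi> p))"
    by (rule frechet_derivative_cong_open[OF chart_image_open[OF c(1) W(1)]]) (use W(2) eq c in auto)
  then have "jet_det c H H p = jet_det c K K p"
    using eq[OF W(2)] by (simp add: V jet_det_def partial_deriv_def)
  then show ?thesis by (simp add: jet_ratio_def c_def[symmetric])
qed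

text \<open>The quotient \<open>jet_ratio N F N0 F0\<close> is the density of one surface element with respect to the
  other once it is known to be positive; multiplied with the curvature of \<open>F\<close>, it leaves a quotient
  with the reference determinant in the denominator.\<close>

lemma total_curvature_relative:
  fixes F N F0 N0 :: "'a \<Rightarrow> real ^ 'm::finite"
  assumes card: "CARD('m) = CARD('n) + 1"
    and FN: "oriented_immersion F N" and FN0: "oriented_immersion F0 N0"
    and pos: "\<And>p. p \<in> topspace X \<Longrightarrow> 0 < jet_ratio N F N0 F0 p"
  shows "total_curvature X \<A> F N = (-1) ^ CARD('n) * (\<integral>p. jet_ratio N N N0 F0 p \<partial>surface_element X \<A> F0)"
proof -
  let ?\<mu>0 = "surface_element X \<A> F0" and ?r = "jet_ratio N F N0 F0"
  note C = oriented_immersion_Ck[OF card FN] and C0 = oriented_immersion_Ck[OF card FN0]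
  note nz = jet_det_immersion_nonzero[OF card FN] and nz0 = jet_det_immersion_nonzero[OF card FN0]
  have \<mu>0: "has_chart_density ?\<mu>0 (metric_weight F0)" by (rule surface_element_has_density[OF card FN0])
  then have s: "sets ?\<mu>0 = sets borel_algebra" by (simp add: has_chart_density_def)
  then have sp: "space ?\<mu>0 = topspace X" using sets_eq_imp_space_eq[of ?\<mu>0 borel_algebra] by simp
  have r_meas: "?r \<in> borel_measurable borel_algebra"
    by (intro measurable_of_continuous_map jet_ratio_continuous[OF card C(5,3) C0(5,3) nz0])
  have f_meas: "jet_ratio N N N F \<in> borel_measurable borel_algebra"
    by (intro measurable_of_continuous_map jet_ratio_continuous[OF card C(5,4,5,3) nz])
  have meas: "?r \<in> borel_measurable ?\<mu>0" "jet_ratio N N N F \<in> borel_measurable ?\<mu>0"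
    using r_meas f_meas s by (simp_all cong: measurable_cong_sets)
  have "has_chart_density (density ?\<mu>0 (\<lambda>p. ennreal (?r p))) (metric_weight F)"
    unfolding has_chart_density_def
  proof (intro conjI ballI, simp add: s, clarify)
    fix U \<phi> B assume c: "(U, \<phi>) \<in> \<A>" and "B \<in> sets (density ?\<mu>0 (\<lambda>p. ennreal (?r p)))" and BU: "B \<subseteq> U"
    then have B: "B \<in> sets ?\<mu>0" "B \<in> sets borel_algebra" using s by auto
    have inv: "inv_into U \<phi> u \<in> U" if "u \<in> \<phi> ` U" for u using that by (rule inv_into_into)
    have in_B: "inv_into U \<phi> u \<in> B \<longleftrightarrow> u \<in> \<phi> ` B" if "u \<in> \<phi> ` U" for u
      using chart_image_eq_vimage[OF c, of B] BU that by (auto simp: Int_absorb2)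
    have "emeasure (density ?\<mu>0 (\<lambda>p. ennreal (?r p))) B = (\<integral>\<^sup>+p. ennreal (?r p) * indicator B p \<partial>?\<mu>0)"
      by (rule emeasure_density) (use B meas in auto)
    also have "\<dots> = (\<integral>\<^sup>+p\<in>U. ennreal (?r p) * indicator B p \<partial>?\<mu>0)"
      by (intro nn_integral_cong) (use BU in \<open>auto simp: indicator_def\<close>)
    also have "\<dots> = (\<integral>\<^sup>+u\<in>\<phi> ` U. ennreal (metric_weight F0 (U, \<phi>) u) *
        (ennreal (?r (inv_into U \<phi> u)) * indicator B (inv_into U \<phi> u)) \<partial>lborel)"
      by (rule nn_integral_in_chart[OF \<mu>0 continuous_metric_weight[OF card FN0] c])
        (use r_meas B in \<open>auto intro!: borel_measurable_times borel_measurable_indicator measurable_compose[OF _ measurable_ennreal]\<close>)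
    also have "\<dots> = (\<integral>\<^sup>+u\<in>\<phi> ` B. ennreal (metric_weight F (U, \<phi>) u) \<partial>lborel)"
    proof (rule nn_integral_cong)
      fix u
      show "ennreal (metric_weight F0 (U, \<phi>) u) * (ennreal (?r (inv_into U \<phi> u)) * indicator B (inv_into U \<phi> u)) * indicator (\<phi> ` U) u
        = ennreal (metric_weight F (U, \<phi>) u) * indicator (\<phi> ` B) u"
      proof (cases "u \<in> \<phi> ` U")
        case True
        let ?p = "inv_into U \<phi> u"
        have "?r ?p = jet_det (U, \<phi>) N F ?p / jet_det (U, \<phi>) N0 F0 ?p"
          by (rule jet_ratio_chart[OF card c inv[OF True] C(3) C0(3) nz0[OF c inv[OF True]]])
        moreover have "0 < ?r ?p" using pos inv[OF True] chart_subset[OF c] by auto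
        ultimately have "?r ?p = \<bar>jet_det (U, \<phi>) N F ?p\<bar> / \<bar>jet_det (U, \<phi>) N0 F0 ?p\<bar>"
          by (metis abs_divide abs_of_pos)
        then have "metric_weight F0 (U, \<phi>) u * ?r ?p = metric_weight F (U, \<phi>) u"
          using metric_weight_eq[OF card FN0 c True] metric_weight_eq[OF card FN c True] nz0[OF c inv[OF True]] by simp
        moreover have "0 \<le> metric_weight F0 (U, \<phi>) u" using metric_weight_eq[OF card FN0 c True] by simp
        ultimately have "ennreal (metric_weight F0 (U, \<phi>) u) * ennreal (?r ?p) = ennreal (metric_weight F (U, \<phi>) u)"
          by (metis \<open>0 < ?r ?p\<close> ennreal_mult less_imp_le)
        then show ?thesis using in_B[OF True] True by (simp add: indicator_def)
      next
        case False
        then show ?thesis using BU by (auto simp: indicator_def)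
      qed
    qed
    finally show "emeasure (density ?\<mu>0 (\<lambda>p. ennreal (?r p))) B = (\<integral>\<^sup>+u\<in>\<phi> ` B. ennreal (metric_weight F (U, \<phi>) u) \<partial>lborel)" .
  qed
  then have \<mu>: "surface_element X \<A> F = density ?\<mu>0 (\<lambda>p. ennreal (?r p))"
    by (rule has_chart_density_unique[OF surface_element_has_density[OF card FN]])
  have "(\<integral>p. jet_ratio N N N F p \<partial>surface_element X \<A> F) = (\<integral>p. ?r p *\<^sub>R jet_ratio N N N F p \<partial>?\<mu>0)"
    unfolding \<mu> by (rule integral_density) (use meas pos in \<open>auto intro!: AE_I2 simp: sp less_imp_le\<close>)
  also have "\<dots> = (\<integral>p. jet_ratio N N N0 F0 p \<partial>?\<mu>0)"
  proof (rule Bochner_Integration.integral_cong[OF refl])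
    fix p assume "p \<in> space ?\<mu>0"
    then obtain U \<phi> where c: "(U, \<phi>) \<in> \<A>" "p \<in> U" using chart_at_exists sp by metis
    show "?r p *\<^sub>R jet_ratio N N N F p = jet_ratio N N N0 F0 p"
      using jet_ratio_chart[OF card c C(3) C0(3) nz0[OF c], of N] jet_ratio_chart[OF card c C(4) C(3) nz[OF c], of N]
        jet_ratio_chart[OF card c C(4) C0(3) nz0[OF c], of N] nz[OF c] nz0[OF c] by simp
  qed
  finally show ?thesis using total_curvature_eq[OF card FN] by simp
qed

lemma continuous_map_inv_chart:
  assumes c: "(U, \<phi>) \<in> \<A>"
  shows "continuous_map (top_of_set (\<phi> ` U)) X (inv_into U \<phi>)"
  unfolding continuous_map_def
proof (intro conjI allI impI)
  show "inv_into U \<phi> \<in> topspace (top_of_set (\<phi> ` U)) \<rightarrow> topspace X"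
    using chart_subset[OF c] c by auto
  fix W assume W: "openin X W"
  have "{u \<in> topspace (top_of_set (\<phi> ` U)). inv_into U \<phi> u \<in> W} = \<phi> ` (W \<inter> U)"
    using chart_image_eq_vimage[OF c, of W] by auto
  then show "openin (top_of_set (\<phi> ` U)) {u \<in> topspace (top_of_set (\<phi> ` U)). inv_into U \<phi> u \<in> W}"
    using chart_image_open[OF c W] by (simp add: openin_open_eq[OF chart_open_image[OF c]] image_mono)
qed

lemma closedin_chart_compact:
  assumes c: "(U, \<phi>) \<in> \<A>" and K: "compact K" "K \<subseteq> \<phi> ` U"
  shows "closedin X (inv_into U \<phi> ` K)"
proof (rule compactin_imp_closedin)
  show "Hausdorff_space X" using manifold by (simp add: closed_smooth_manifold_def)
  show "compactin X (inv_into U \<phi> ` K)"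
    by (rule image_compactin[OF _ continuous_map_inv_chart[OF c]]) (use K in \<open>simp add: compactin_subtopology\<close>)
qed

text \<open>Away from the chart, the extension is zero near every point because the compact support is
  closed in the manifold. This is where the Hausdorff property is needed.\<close>

lemma Ck_map_extend_by_zero:
  fixes \<beta> :: "real ^ 'n \<Rightarrow> real"
  assumes c: "(U, \<phi>) \<in> \<A>" and K: "compact K" "K \<subseteq> \<phi> ` U"
    and \<beta>: "Ck_on k UNIV \<beta>" "\<And>u. u \<notin> K \<Longrightarrow> \<beta> u = 0"
  shows "Ck_map k (\<lambda>p. if p \<in> U then \<beta> (\<phi> p) else 0)"
  unfolding Ck_map_def
proof clarify
  fix V \<psi> assume d: "(V, \<psi>) \<in> \<A>"
  let ?\<eta> = "\<lambda>p. if p \<in> U then \<beta> (\<phi> p) else 0"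
  let ?C = "inv_into U \<phi> ` K"
  have C: "openin X (topspace X - ?C)"
    using closedin_chart_compact[OF c K] by (simp add: closedin_def)
  have \<eta>0: "?\<eta> q = 0" if "q \<notin> ?C" for q
  proof (cases "q \<in> U")
    case True
    then have "\<phi> q \<notin> K" using that c by (metis image_eqI inv_chart)
    then show ?thesis using \<beta>(2) by simp
  qed simp
  show "Ck_on k (\<psi> ` V) (?\<eta> \<circ> inv_into V \<psi>)"
  proof (rule Ck_on_local)
    fix u assume "u \<in> \<psi> ` V"
    then obtain q where q: "q \<in> V" "u = \<psi> q" by blast
    show "\<exists>O'. open O' \<and> u \<in> O' \<and> Ck_on k O' (?\<eta> \<circ> inv_into V \<psi>)"
    proof (cases "q \<in> U")
      case True
      let ?O = "\<psi> ` (U \<inter> V)"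
      have o: "open ?O" by (rule chart_image_open[OF d chart_openin[OF c]])
      have "Ck_on k ?O (\<phi> \<circ> inv_into V \<psi>)"
        using transition_smooth[OF d c] by (simp add: smooth_on_def Int_commute)
      from Ck_on_compose[OF o open_UNIV subset_UNIV this \<beta>(1)]
      have \<beta>': "Ck_on k ?O (\<lambda>u. \<beta> ((\<phi> \<circ> inv_into V \<psi>) u))" .
      have "Ck_on k ?O (?\<eta> \<circ> inv_into V \<psi>)"
      proof (rule iffD2[OF Ck_on_cong[OF o] \<beta>'])
        show "(?\<eta> \<circ> inv_into V \<psi>) u = \<beta> ((\<phi> \<circ> inv_into V \<psi>) u)" if "u \<in> ?O" for u
          using that d by auto
      qed
      then show ?thesis using o q True by blast
    next
      case False
      let ?O = "\<psi> ` ((topspace X - ?C) \<inter> V)"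
      have o: "open ?O" by (rule chart_image_open[OF d C])
      have "q \<notin> ?C" using False K(2) inv_into_into[of _ \<phi> U] by blast
      then have "u \<in> ?O" using q chart_subset[OF d] by auto
      moreover have "Ck_on k ?O (?\<eta> \<circ> inv_into V \<psi>)"
      proof (rule iffD2[OF Ck_on_cong[OF o] Ck_on_const[OF o]])
        fix u assume "u \<in> ?O"
        then obtain q where "q \<notin> ?C" "q \<in> V" "u = \<psi> q" by blast
        then show "(?\<eta> \<circ> inv_into V \<psi>) u = 0" using \<eta>0[of q] d by (simp split: if_splits)
      qed
      ultimately show ?thesis using o by blast
    qed
  qed
qed

end

section \<open>Bump functions\<close>

text \<open>The inner cube is positive exactly inside the ball; the outer one cuts off at height one eighth,
  which \<open>s\<^sup>3\<close> reaches on the ball of half the radius, where \<open>s \<ge> 1/2\<close>.\<close>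

lemma euclidean_bump:
  fixes c :: "'a::euclidean_space"
  assumes "0 < r"
  obtains \<beta> :: "'a \<Rightarrow> real" where "Ck_on 2 UNIV \<beta>" "\<And>u. 0 \<le> \<beta> u \<and> \<beta> u \<le> 1"
    "\<And>u. u \<notin> cball c r \<Longrightarrow> \<beta> u = 0" "\<And>u. u \<in> ball c (r / 2) \<Longrightarrow> \<beta> u = 1"
proof -
  define s where "s u = 1 - ((u - c) \<bullet> (u - c)) / r\<^sup>2" for u
  define \<beta> where "\<beta> u = 1 - pos_cube (1 - 8 * pos_cube (s u))" for u
  have "Ck_on 2 UNIV (\<lambda>u. u - c)"
    by (intro Ck_on_diff open_UNIV Ck_on_const Ck_on_bounded_linear bounded_linear_ident)
  then have "Ck_on 2 UNIV (\<lambda>u. (u - c) \<bullet> (u - c))"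
    by (intro Ck_on_bilinear[OF open_UNIV bounded_bilinear_inner])
  then have "Ck_on 2 UNIV (\<lambda>u. ((u - c) \<bullet> (u - c)) / r\<^sup>2)"
    by (intro Ck_on_linear_image[OF open_UNIV _ bounded_linear_divide])
  then have "Ck_on 2 UNIV s"
    unfolding s_def[abs_def] by (intro Ck_on_diff open_UNIV Ck_on_const)
  then have "Ck_on 2 UNIV (\<lambda>u. pos_cube (s u))"
    by (intro Ck_on_compose[OF open_UNIV open_UNIV _ _ Ck_on_pos_cube]) auto
  then have "Ck_on 2 UNIV (\<lambda>u. 1 - 8 * pos_cube (s u))"
    by (intro Ck_on_diff Ck_on_mult open_UNIV Ck_on_const)
  then have "Ck_on 2 UNIV (\<lambda>u. pos_cube (1 - 8 * pos_cube (s u)))"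
    by (intro Ck_on_compose[OF open_UNIV open_UNIV _ _ Ck_on_pos_cube]) auto
  then have C: "Ck_on 2 UNIV \<beta>"
    unfolding \<beta>_def[abs_def] by (intro Ck_on_diff open_UNIV Ck_on_const)
  have pc: "0 \<le> pos_cube x" for x by (simp add: pos_cube_def)
  have pc1: "pos_cube x \<le> 1" if "x \<le> 1" for x
    unfolding pos_cube_def using that by (intro power_le_one) auto
  have pc0: "pos_cube x = 0" if "x \<le> 0" for x using that by (simp add: pos_cube_def)
  have s: "s u = 1 - (dist c u)\<^sup>2 / r\<^sup>2" for u
    by (simp add: s_def power2_norm_eq_inner[symmetric] dist_norm norm_minus_commute)
  show thesis
  proof (rule that[OF C])
    show "0 \<le> \<beta> u \<and> \<beta> u \<le> 1" for u
      using pc pc1[of "1 - 8 * pos_cube (s u)"] pc[of "s u"] by (simp add: \<beta>_def)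
    show "\<beta> u = 0" if "u \<notin> cball c r" for u
    proof -
      have "r\<^sup>2 \<le> (dist c u)\<^sup>2" using that assms by (intro power_mono) auto
      then have "s u \<le> 0" using assms by (simp add: s)
      then show ?thesis by (simp add: \<beta>_def pc0 pos_cube_def)
    qed
    show "\<beta> u = 1" if "u \<in> ball c (r / 2)" for u
    proof -
      have "(dist c u)\<^sup>2 \<le> (r / 2)\<^sup>2" using that by (intro power_mono) auto
      then have "4 * (dist c u)\<^sup>2 \<le> r\<^sup>2" by (simp add: power_divide)
      then have "2 * (dist c u)\<^sup>2 \<le> r\<^sup>2" using zero_le_power2[of "dist c u"] by linarith
      then have "1 / 2 \<le> s u" using assms by (simp add: s field_simps)
      then have "(1 / 2) ^ 3 \<le> pos_cube (s u)" unfolding pos_cube_def by (intro power_mono) auto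
      then have "1 - 8 * pos_cube (s u) \<le> 0" by (simp add: power_divide)
      then show ?thesis by (simp add: \<beta>_def pc0)
    qed
  qed
qed

context closed_manifold
begin

lemma manifold_bump:
  assumes p: "p \<in> topspace X"
  shows "\<exists>U \<phi> a b K \<eta> W. (U, \<phi>) \<in> \<A> \<and> cbox a b \<subseteq> \<phi> ` U \<and> compact K \<and> K \<subseteq> cbox a b \<and> Ck_map 2 \<eta> \<and>
    (\<forall>q. 0 \<le> \<eta> q \<and> \<eta> q \<le> (1::real)) \<and> (\<forall>q. q \<notin> inv_into U \<phi> ` K \<longrightarrow> \<eta> q = 0) \<and>
    openin X W \<and> p \<in> W \<and> (\<forall>q\<in>W. \<eta> q = 1)"
proof -
  obtain U \<phi> where c: "(U, \<phi>) \<in> \<A>" "p \<in> U" using chart_at_exists[OF p] .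
  obtain a b where "cbox a b \<subseteq> \<phi> ` U" "\<phi> p \<in> box a b" "\<forall>i\<in>Basis. a \<bullet> i < b \<bullet> i"
    by (rule open_contains_cbox[OF chart_open_image[OF c(1)] imageI[OF c(2)]])
  then have ab: "\<phi> p \<in> box a b" "cbox a b \<subseteq> \<phi> ` U" by simp_all
  obtain r where r: "r > 0" "cball (\<phi> p) r \<subseteq> box a b"
    using ab(1) open_box by (meson open_contains_cball)
  obtain \<beta> :: "real ^ 'n \<Rightarrow> real" where \<beta>: "Ck_on 2 UNIV \<beta>" "\<And>u. 0 \<le> \<beta> u \<and> \<beta> u \<le> 1"
    "\<And>u. u \<notin> cball (\<phi> p) r \<Longrightarrow> \<beta> u = 0" "\<And>u. u \<in> ball (\<phi> p) (r / 2) \<Longrightarrow> \<beta> u = 1"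
    using euclidean_bump[OF r(1), of "\<phi> p"] by metis
  let ?K = "cball (\<phi> p) r" and ?\<eta> = "\<lambda>p. if p \<in> U then \<beta> (\<phi> p) else 0" and ?W = "{q \<in> U. \<phi> q \<in> ball (\<phi> p) (r / 2)}"
  have K: "?K \<subseteq> cbox a b" using r(2) box_subset_cbox by blast
  have C: "Ck_map 2 ?\<eta>"
    by (rule Ck_map_extend_by_zero[OF c(1) _ _ \<beta>(1,3)]) (use K ab in auto)
  have "?\<eta> q = 0" if "q \<notin> inv_into U \<phi> ` ?K" for q
  proof (cases "q \<in> U")
    case True
    then have "\<phi> q \<notin> ?K" using that c(1) by (metis image_eqI inv_chart)
    then show ?thesis using \<beta>(3) by simp
  qed simp
  moreover have "openin X ?W" by (rule chart_preimage_openin[OF c(1)]) simp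
  moreover have "p \<in> ?W" using c(2) r(1) by simp
  ultimately show ?thesis
    using c(1) ab(2) K C \<beta>(2,4)
    by (intro exI[of _ U] exI[of _ \<phi>] exI[of _ a] exI[of _ b] exI[of _ ?K] exI[of _ ?\<eta>] exI[of _ ?W]) auto
qed

end

section \<open>Invariance of the volume swept out by the Gauss map\<close>

lemma same_sign_of_continuous_nonzero:
  fixes f :: "'c::topological_space \<Rightarrow> real"
  assumes "connected S" "continuous_on S f" "\<And>x. x \<in> S \<Longrightarrow> f x \<noteq> 0" "x \<in> S" "y \<in> S"
  shows "0 < f y / f x"
proof (rule ccontr)
  assume "\<not> ?thesis"
  then have "min (f x) (f y) \<le> 0 \<and> 0 \<le> max (f x) (f y)"
    using assms(3)[OF assms(4)] assms(3)[OF assms(5)] by (auto simp: zero_less_divide_iff min_def max_def not_less)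
  moreover have "connected (f ` S)" by (rule connected_continuous_image[OF assms(2,1)])
  moreover have "min (f x) (f y) \<in> f ` S" "max (f x) (f y) \<in> f ` S" using assms(4,5) by (auto simp: min_def max_def)
  ultimately have "0 \<in> f ` S" unfolding connected_iff_interval by blast
  then show False using assms(3) by auto
qed

locale evolving_hypersurface = closed_manifold X \<A>
  for X :: "'a topology" and \<A> :: "('a, 'n::finite) chart set" +
  fixes I :: "real set" and F N :: "'a \<Rightarrow> real \<Rightarrow> real ^ 'm::finite"
  assumes card: "CARD('m) = CARD('n) + 1" and I: "open I" "is_interval I"
    and evolution: "smooth_evolution X \<A> I F N"
begin

lemma family_Ck:
  "(U, \<phi>) \<in> \<A> \<Longrightarrow> Ck_on k (\<phi> ` U \<times> I) (\<lambda>(u, t). F (inv_into U \<phi> u) t)"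
  "(U, \<phi>) \<in> \<A> \<Longrightarrow> Ck_on k (\<phi> ` U \<times> I) (\<lambda>(u, t). N (inv_into U \<phi> u) t)"
  using evolution unfolding smooth_evolution_def smooth_family_def smooth_on_def by blast+

text \<open>The time may depend on the point; this is the form in which the family is used throughout.\<close>

lemma Ck_map_at_time:
  assumes G: "\<And>U \<phi>. (U, \<phi>) \<in> \<A> \<Longrightarrow> Ck_on k (\<phi> ` U \<times> I) (\<lambda>(u, t). G (inv_into U \<phi> u) t)"
    and \<tau>: "Ck_map k \<tau>" "\<And>p. p \<in> topspace X \<Longrightarrow> \<tau> p \<in> I"
  shows "Ck_map k (\<lambda>p. G p (\<tau> p))"
  unfolding Ck_map_def
proof clarify
  fix U \<phi> assume c: "(U, \<phi>) \<in> \<A>"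
  note o = chart_open_image[OF c]
  have "Ck_on k (\<phi> ` U) (\<lambda>u. (u, (\<tau> \<circ> inv_into U \<phi>) u))"
    by (intro Ck_on_Pair o Ck_on_bounded_linear bounded_linear_ident Ck_mapD[OF \<tau>(1) c])
  moreover have "(\<lambda>u. (u, (\<tau> \<circ> inv_into U \<phi>) u)) ` \<phi> ` U \<subseteq> \<phi> ` U \<times> I"
    using \<tau>(2) chart_subset[OF c] c by auto
  ultimately have "Ck_on k (\<phi> ` U) (\<lambda>u. (\<lambda>(u, t). G (inv_into U \<phi> u) t) (u, (\<tau> \<circ> inv_into U \<phi>) u))"
    using Ck_on_compose[OF o open_Times[OF o I(1)] _ _ G[OF c]] by blast
  then show "Ck_on k (\<phi> ` U) ((\<lambda>p. G p (\<tau> p)) \<circ> inv_into U \<phi>)" by (simp add: o_def)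
qed

lemma Ck_map_const: "Ck_map k (\<lambda>p. c)"
  unfolding Ck_map_def o_def using chart_open_image Ck_on_const by blast

lemma immersion_at:
  assumes t: "t \<in> I"
  shows "oriented_immersion (\<lambda>p. F p t) (\<lambda>p. N p t)"
proof -
  have "Ck_map 2 (\<lambda>p. F p t)" "Ck_map 2 (\<lambda>p. N p t)"
    using Ck_map_at_time[OF family_Ck(1) Ck_map_const[of 2 t]] Ck_map_at_time[OF family_Ck(2) Ck_map_const[of 2 t]] t by auto
  then show ?thesis
    using evolution t unfolding oriented_immersion_def smooth_evolution_def smooth_embedding_def by blast
qed

lemma jet_det_continuous_in_time:
  assumes c: "(U, \<phi>) \<in> \<A>" and p: "p \<in> U"
  shows "continuous_on I (\<lambda>t. jet_det (U, \<phi>) (\<lambda>p. N p t) (\<lambda>p. F p t) p)"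
proof -
  let ?F = "\<lambda>(u, t). F (inv_into U \<phi> u) t" and ?N = "\<lambda>(u, t). N (inv_into U \<phi> u) t"
  have line: "continuous_on I (\<lambda>t. (\<phi> p, t))" "(\<lambda>t. (\<phi> p, t)) ` I \<subseteq> \<phi> ` U \<times> I"
    using p by (auto intro!: continuous_intros)
  have pd: "partial_deriv \<alpha> ((\<lambda>p. F p t) \<circ> inv_into U \<phi>) (\<phi> p) = frechet_derivative ?F (at (\<phi> p, t)) (axis \<alpha> 1, 0)"
    if t: "t \<in> I" for t \<alpha>
  proof -
    have "?F differentiable (at (\<phi> p, t))"
      by (rule Ck_on_imp_differentiable[OF family_Ck(1)[OF c, of 1]]) (use p t in auto)
    then have "(?F has_derivative frechet_derivative ?F (at (\<phi> p, t))) (at (\<phi> p, t))"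
      by (simp add: frechet_derivative_works)
    from has_derivative_compose[where f = "\<lambda>u. (u, t)" and g = ?F, OF _ this, of "\<lambda>v. (v, 0)" UNIV]
    have "((\<lambda>u. (u, t)) has_derivative (\<lambda>v. (v, 0))) (at (\<phi> p)) \<Longrightarrow>
        ((\<lambda>u. ?F (u, t)) has_derivative (\<lambda>v. frechet_derivative ?F (at (\<phi> p, t)) (v, 0))) (at (\<phi> p))" .
    moreover have "((\<lambda>u. (u, t)) has_derivative (\<lambda>v. (v, 0))) (at (\<phi> p))"
      by (auto intro!: derivative_eq_intros)
    ultimately have "((\<lambda>p. F p t) \<circ> inv_into U \<phi> has_derivative (\<lambda>v. frechet_derivative ?F (at (\<phi> p, t)) (v, 0))) (at (\<phi> p))"
      by (simp add: o_def)
    from frechet_derivative_at[OF this] show ?thesis unfolding partial_deriv_def by metis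
  qed
  have cont_F: "continuous_on I (\<lambda>t. partial_deriv \<alpha> ((\<lambda>p. F p t) \<circ> inv_into U \<phi>) (\<phi> p))" for \<alpha>
  proof -
    have "continuous_on (\<phi> ` U \<times> I) (\<lambda>y. frechet_derivative ?F (at y) (axis \<alpha> 1, 0))"
      by (rule Ck_on_imp_continuous_on[OF Ck_on_frechet[OF family_Ck(1)[OF c, of 1], of 0]]) simp
    from continuous_on_compose2[OF this line]
    show ?thesis by (rule continuous_on_eq) (simp add: pd)
  qed
  have cont_N: "continuous_on I (\<lambda>t. N p t)"
    using continuous_on_compose2[OF Ck_on_imp_continuous_on[OF family_Ck(2)[OF c, of 0]] line] c p by simp
  have cont_rows: "continuous_on I (\<lambda>t. frame_rows (N p t) (\<lambda>\<alpha>. partial_deriv \<alpha> ((\<lambda>p. F p t) \<circ> inv_into U \<phi>) (\<phi> p)) $ i $ j)" for i j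
    by (cases "slot i :: 'n option") (auto simp: frame_rows_def intro!: continuous_intros cont_N cont_F)
  then show ?thesis
    unfolding jet_det_def split frame_det_def det_def
    by (intro continuous_on_sum continuous_on_mult continuous_on_const continuous_on_prod cont_rows)
qed

lemma density_ratio_positive:
  assumes t: "t0 \<in> I" "t1 \<in> I" and p: "p \<in> topspace X"
  shows "0 < jet_ratio (\<lambda>p. N p t1) (\<lambda>p. F p t1) (\<lambda>p. N p t0) (\<lambda>p. F p t0) p"
proof -
  obtain U \<phi> where c: "(U, \<phi>) \<in> \<A>" "p \<in> U" using chart_at_exists[OF p] .
  have "0 < jet_det (U, \<phi>) (\<lambda>p. N p t1) (\<lambda>p. F p t1) p / jet_det (U, \<phi>) (\<lambda>p. N p t0) (\<lambda>p. F p t0) p"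
    by (rule same_sign_of_continuous_nonzero[OF _ jet_det_continuous_in_time[OF c]])
      (use I(2) t c in \<open>auto intro: is_interval_connected simp: jet_det_immersion_nonzero[OF card immersion_at]\<close>)
  then show ?thesis
    using jet_ratio_chart[OF card c oriented_immersion_Ck(3)[OF card immersion_at[OF t(2)]]
        oriented_immersion_Ck(3)[OF card immersion_at[OF t(1)]] jet_det_immersion_nonzero[OF card immersion_at[OF t(1)] c]]
    by simp
qed

abbreviation normal_at :: "('a \<Rightarrow> real) \<Rightarrow> 'a \<Rightarrow> real ^ 'm" where
  "normal_at \<tau> \<equiv> \<lambda>p. N p (\<tau> p)"

text \<open>The signed volume swept out on the sphere by \<open>p \<mapsto> N (p, \<tau> p)\<close>, written as an integral against the
  surface element at the reference time \<open>t0\<close>. For nonconstant \<open>\<tau>\<close> the vectors \<open>N (p, \<tau> p)\<close>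
  are in general not normal to the image of \<open>p \<mapsto> F (p, \<tau> p)\<close>.\<close>

definition gauss_map_volume :: "real \<Rightarrow> ('a \<Rightarrow> real) \<Rightarrow> real" where
  "gauss_map_volume t0 \<tau> = (\<integral>p. jet_ratio (normal_at \<tau>) (normal_at \<tau>) (\<lambda>p. N p t0) (\<lambda>p. F p t0) p
     \<partial>surface_element X \<A> (\<lambda>p. F p t0))"

definition time_field :: "('a \<Rightarrow> real) \<Rightarrow> bool" where
  "time_field \<tau> \<longleftrightarrow> Ck_map 2 \<tau> \<and> (\<forall>p\<in>topspace X. \<tau> p \<in> I)"

lemma segment_in_I: "x \<in> I \<Longrightarrow> y \<in> I \<Longrightarrow> 0 \<le> l \<Longrightarrow> l \<le> 1 \<Longrightarrow> x + l * (y - x) \<in> I"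
  using is_interval_convex[OF I(2)] convexD[of I x y "1 - l" l] by (simp add: algebra_simps)

lemma Ck_map_normal_at: "time_field \<tau> \<Longrightarrow> Ck_map 2 (normal_at \<tau>)"
  using Ck_map_at_time[OF family_Ck(2)] by (auto simp: time_field_def)

lemma Ck_map_mix:
  assumes "Ck_map k \<tau>" "Ck_map k \<eta>"
  shows "Ck_map k (\<lambda>p. \<tau> p + \<eta> p * (t1 - \<tau> p :: real))"
  unfolding Ck_map_def o_def
proof clarify
  fix U \<phi> assume c: "(U, \<phi>) \<in> \<A>"
  have "Ck_on k (\<phi> ` U) (\<lambda>u. \<tau> (inv_into U \<phi> u))" "Ck_on k (\<phi> ` U) (\<lambda>u. \<eta> (inv_into U \<phi> u))"
    using assms[THEN Ck_mapD, OF c] by (simp_all add: o_def)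
  then show "Ck_on k (\<phi> ` U) (\<lambda>u. \<tau> (inv_into U \<phi> u) + \<eta> (inv_into U \<phi> u) * (t1 - \<tau> (inv_into U \<phi> u)))"
    by (intro Ck_on_add Ck_on_mult Ck_on_diff Ck_on_const chart_open_image[OF c])
qed

text \<open>The move from \<open>\<tau>\<close> to \<open>\<tau>'\<close> is interpolated linearly by a parameter \<open>s\<close>. The interpolated times may
  leave \<open>I\<close> for \<open>s\<close> outside the unit interval, hence the domain \<open>W\<close>.\<close>

lemma integral_det_constant_in_chart:
  fixes \<eta> :: "'a \<Rightarrow> real"
  assumes c: "(U, \<phi>) \<in> \<A>" and \<tau>: "time_field \<tau>" and t1: "t1 \<in> I"
    and \<eta>: "Ck_map 2 \<eta>" "\<And>q. 0 \<le> \<eta> q \<and> \<eta> q \<le> 1" "\<And>q. q \<notin> inv_into U \<phi> ` K \<Longrightarrow> \<eta> q = 0"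
    and K: "compact K" "K \<subseteq> cbox a b" "cbox a b \<subseteq> \<phi> ` U"
  defines "\<tau>' \<equiv> \<lambda>p. \<tau> p + \<eta> p * (t1 - \<tau> p)"
  shows "integral (cbox a b) (\<lambda>u. jet_det (U, \<phi>) (normal_at \<tau>) (normal_at \<tau>) (inv_into U \<phi> u)) =
    integral (cbox a b) (\<lambda>u. jet_det (U, \<phi>) (normal_at \<tau>') (normal_at \<tau>') (inv_into U \<phi> u))"
proof -
  let ?A = "\<phi> ` U" and ?v = "inv_into U \<phi>"
  note oA = chart_open_image[OF c]
  have inv: "?v u \<in> U" "?v u \<in> topspace X" if "u \<in> ?A" for u
    using inv_into_into[OF that] chart_subset[OF c] by auto
  define \<theta> where "\<theta> y = \<tau> (?v (fst y)) + snd y * (\<eta> (?v (fst y)) * (t1 - \<tau> (?v (fst y))))" for y :: "(real ^ 'n) \<times> real"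
  define W where "W = {y \<in> ?A \<times> UNIV. \<theta> y \<in> I}"
  define G where "G = (\<lambda>y. N (?v (fst y)) (\<theta> y))"
  have oAU: "open (?A \<times> (UNIV :: real set))" by (intro open_Times oA open_UNIV)
  have fst: "Ck_on 2 (?A \<times> (UNIV :: real set)) fst" and snd: "Ck_on 2 (?A \<times> (UNIV :: real set)) snd"
    by (intro Ck_on_bounded_linear oAU bounded_linear_fst bounded_linear_snd)+
  have lift: "Ck_on 2 (?A \<times> (UNIV :: real set)) (\<lambda>y. f (?v (fst y)))" if "Ck_map 2 f" for f :: "'a \<Rightarrow> real"
  proof -
    have "fst ` (?A \<times> (UNIV :: real set)) \<subseteq> ?A" by auto
    from Ck_on_compose[OF oAU oA this fst Ck_mapD[OF that c]] show ?thesis unfolding o_def .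
  qed
  have C\<theta>: "Ck_on 2 (?A \<times> UNIV) \<theta>"
    unfolding \<theta>_def[abs_def] using \<tau> \<eta>(1)
    by (intro Ck_on_add Ck_on_mult Ck_on_diff Ck_on_const oAU snd lift) (auto simp: time_field_def)
  have oW: "open W"
  proof -
    have "open (\<theta> -` I \<inter> (?A \<times> UNIV))"
      using Ck_on_imp_continuous_on[OF C\<theta>] I(1) oAU by (simp add: continuous_on_open_vimage)
    moreover have "\<theta> -` I \<inter> (?A \<times> UNIV) = W" by (auto simp: W_def)
    ultimately show ?thesis by simp
  qed
  have W_sub: "W \<subseteq> ?A \<times> UNIV" by (auto simp: W_def)
  have "Ck_on 2 W (\<lambda>y. (fst y, \<theta> y))"
    by (rule Ck_on_subset[OF _ W_sub]) (intro Ck_on_Pair oAU fst C\<theta>)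
  moreover have "(\<lambda>y. (fst y, \<theta> y)) ` W \<subseteq> ?A \<times> I" by (auto simp: W_def)
  ultimately have "Ck_on 2 W (\<lambda>y. (\<lambda>(u, t). N (?v u) t) (fst y, \<theta> y))"
    by (intro Ck_on_compose[OF oW open_Times[OF oA I(1)] _ _ family_Ck(2)[OF c, of 2]])
  then have CG: "Ck_on 2 W G" unfolding G_def split .
  have AW: "?A \<times> {0..1} \<subseteq> W"
  proof
    fix y assume "y \<in> ?A \<times> {0..1::real}"
    then obtain u s where y: "y = (u, s)" "u \<in> ?A" "0 \<le> s" "s \<le> 1" by auto
    have "\<tau> (?v u) + (s * \<eta> (?v u)) * (t1 - \<tau> (?v u)) \<in> I"
      by (rule segment_in_I) (use \<tau> t1 inv[OF y(2)] y(3,4) \<eta>(2)[of "?v u"] in \<open>auto simp: time_field_def mult_le_one\<close>)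
    then show "y \<in> W" using y by (simp add: W_def \<theta>_def mult.assoc)
  qed
  have slice: "frame_det (G (u, s)) (\<lambda>\<alpha>::'n. partial_deriv \<alpha> (\<lambda>u. G (u, s)) u) = jet_det (U, \<phi>) (normal_at \<sigma>) (normal_at \<sigma>) (?v u)"
    if "u \<in> ?A" "\<And>q. \<sigma> q = \<tau> q + s * (\<eta> q * (t1 - \<tau> q))" for u s \<sigma>
    using that by (simp add: jet_det_def G_def \<theta>_def o_def)
  have "integral (cbox a b) (\<lambda>u. frame_det (G (u, 0)) (\<lambda>\<alpha>::'n. partial_deriv \<alpha> (\<lambda>u. G (u, 0)) u))
       = integral (cbox a b) (\<lambda>u. frame_det (G (u, 1)) (\<lambda>\<alpha>::'n. partial_deriv \<alpha> (\<lambda>u. G (u, 1)) u))"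
  proof (rule frame_integral_homotopy[OF card oW CG _ K(1,2) _ oA K(3) AW])
    show "G y \<bullet> G y = 1" if "y \<in> W" for y
    proof -
      have y: "fst y \<in> ?A" "\<theta> y \<in> I" using that by (auto simp: W_def)
      show ?thesis unfolding G_def
        by (rule normal_unit[OF card immersion_at[OF y(2)]]) (rule inv(2)[OF y(1)])
    qed
    show "G (u, s) = N (?v u) (\<tau> (?v u))" if "(u, s) \<in> W" "u \<notin> K" for u s
    proof -
      have "u \<in> ?A" using that(1) by (auto simp: W_def)
      have "?v u \<notin> ?v ` K"
      proof
        assume "?v u \<in> ?v ` K"
        then obtain v where v: "v \<in> K" "?v u = ?v v" by blast
        then have "u = v" using inv_into_injective[OF v(2) \<open>u \<in> ?A\<close>] K(2,3) by blast
        then show False using v that(2) by simp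
      qed
      then show ?thesis using \<eta>(3) by (simp add: G_def \<theta>_def)
    qed
  qed
  moreover have "integral (cbox a b) (\<lambda>u. frame_det (G (u, s)) (\<lambda>\<alpha>::'n. partial_deriv \<alpha> (\<lambda>u. G (u, s)) u))
      = integral (cbox a b) (\<lambda>u. jet_det (U, \<phi>) (normal_at \<sigma>) (normal_at \<sigma>) (?v u))"
    if "\<And>q. \<sigma> q = \<tau> q + s * (\<eta> q * (t1 - \<tau> q))" for s \<sigma>
    using K(3) slice that by (intro integral_cong) blast
  ultimately show ?thesis by (simp add: \<tau>'_def)
qed

text \<open>The two integrands agree off the support of \<open>\<eta>\<close>, so their difference can be integrated in one
  chart. There the area density is the reference determinant up to a sign \<open>\<epsilon>\<close> that is constant on
  the connected box, and what remains is the difference of two integrals of determinants.\<close>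

lemma gauss_map_volume_local_change:
  fixes \<eta> :: "'a \<Rightarrow> real"
  assumes c: "(U, \<phi>) \<in> \<A>" and \<tau>: "time_field \<tau>" and t: "t0 \<in> I" "t1 \<in> I"
    and \<eta>: "Ck_map 2 \<eta>" "\<And>q. 0 \<le> \<eta> q \<and> \<eta> q \<le> 1" "\<And>q. q \<notin> inv_into U \<phi> ` K \<Longrightarrow> \<eta> q = 0"
    and K: "compact K" "K \<subseteq> cbox a b" "cbox a b \<subseteq> \<phi> ` U"
  defines "\<tau>' \<equiv> \<lambda>p. \<tau> p + \<eta> p * (t1 - \<tau> p)"
  shows "time_field \<tau>'" and "gauss_map_volume t0 \<tau>' = gauss_map_volume t0 \<tau>"
proof -
  show \<tau>': "time_field \<tau>'"
    unfolding time_field_def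
  proof
    show "Ck_map 2 \<tau>'" unfolding \<tau>'_def by (rule Ck_map_mix) (use \<tau> \<eta>(1) in \<open>auto simp: time_field_def\<close>)
    show "\<forall>p\<in>topspace X. \<tau>' p \<in> I"
      unfolding \<tau>'_def using \<tau> t(2) \<eta>(2) by (auto intro!: segment_in_I simp: time_field_def)
  qed
  let ?N0 = "\<lambda>p. N p t0" and ?F0 = "\<lambda>p. F p t0" and ?v = "inv_into U \<phi>"
  let ?\<mu> = "surface_element X \<A> ?F0"
  define \<rho> where "\<rho> \<sigma> = jet_ratio (normal_at \<sigma>) (normal_at \<sigma>) ?N0 ?F0" for \<sigma>
  note imm = immersion_at[OF t(1)]
  note C0 = oriented_immersion_Ck[OF card imm] and nz = jet_det_immersion_nonzero[OF card imm]
  have \<mu>: "has_chart_density ?\<mu> (metric_weight ?F0)" by (rule surface_element_has_density[OF card imm])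
  then have s: "sets ?\<mu> = sets borel_algebra" by (simp add: has_chart_density_def)
  then have sp: "space ?\<mu> = topspace X" using sets_eq_imp_space_eq[of ?\<mu> borel_algebra] by simp
  interpret finite_measure ?\<mu>
    by (rule finite_measure_chart_density[OF \<mu> continuous_metric_weight[OF card imm]])
  have CN: "Ck_map 0 (normal_at \<sigma>)" "Ck_map 1 (normal_at \<sigma>)" if "time_field \<sigma>" for \<sigma>
    using Ck_map_mono[OF Ck_map_normal_at[OF that]] by auto
  have cont: "continuous_map X euclidean (\<rho> \<sigma>)" if "time_field \<sigma>" for \<sigma>
    unfolding \<rho>_def by (rule jet_ratio_continuous[OF card CN[OF that] C0(5,3) nz])
  have meas: "\<rho> \<sigma> \<in> borel_measurable borel_algebra" if "time_field \<sigma>" for \<sigma>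
    by (rule measurable_of_continuous_map[OF cont[OF that]])
  have int: "integrable ?\<mu> (\<rho> \<sigma>)" if "time_field \<sigma>" for \<sigma>
  proof -
    have "compactin X (topspace X)" using manifold by (simp add: closed_smooth_manifold_def compact_space_def)
    from image_compactin[OF this cont[OF that]] have "compact (\<rho> \<sigma> ` topspace X)" by simp
    then obtain B where "\<And>p. p \<in> topspace X \<Longrightarrow> \<bar>\<rho> \<sigma> p\<bar> \<le> B"
      by (metis bounded_real compact_imp_bounded imageI)
    then show ?thesis
      using meas[OF that] s by (intro integrable_const_bound[where B = B]) (auto intro!: AE_I2 simp: sp cong: measurable_cong_sets)
  qed
  define h where "h p = \<rho> \<tau>' p - \<rho> \<tau> p" for p
  have inv: "?v u \<in> U" if "u \<in> cbox a b" for u using inv_into_into K(3) that by (metis subsetD)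
  have jet: "\<rho> \<sigma> p = jet_det (U, \<phi>) (normal_at \<sigma>) (normal_at \<sigma>) p / jet_det (U, \<phi>) ?N0 ?F0 p"
    if "time_field \<sigma>" "p \<in> U" for \<sigma> p
    unfolding \<rho>_def by (rule jet_ratio_chart[OF card c that(2) CN(2)[OF that(1)] C0(3) nz[OF c that(2)]])
  define d where "d \<sigma> u = jet_det (U, \<phi>) (normal_at \<sigma>) (normal_at \<sigma>) (?v u)" for \<sigma> u
  define d0 where "d0 u = jet_det (U, \<phi>) ?N0 ?F0 (?v u)" for u
  have cont_d: "continuous_on (cbox a b) (d \<sigma>)" if "time_field \<sigma>" for \<sigma>
    unfolding d_def by (rule continuous_on_subset[OF jet_det_continuous[OF c CN[OF that]] K(3)])
  obtain \<epsilon> where \<epsilon>: "\<And>u. u \<in> cbox a b \<Longrightarrow> \<bar>d0 u\<bar> = \<epsilon> * d0 u"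
  proof (cases "cbox a b = {}")
    case True then show thesis using that[of 0] by simp
  next
    case False
    then obtain v where v: "v \<in> cbox a b" by blast
    have "0 < d0 u / d0 v" if "u \<in> cbox a b" for u
      unfolding d0_def by (rule same_sign_of_continuous_nonzero[OF _ continuous_on_subset[OF jet_det_continuous[OF c C0(5,3)] K(3)] _ v that])
        (use nz[OF c inv] in \<open>auto intro: convex_connected\<close>)
    then have "\<bar>d0 u\<bar> = sgn (d0 v) * d0 u" if "u \<in> cbox a b" for u
      using that by (fastforce simp: zero_less_divide_iff abs_if)
    then show thesis by (rule that)
  qed
  have hw: "h (?v u) * metric_weight ?F0 (U, \<phi>) u = \<epsilon> * (d \<tau>' u - d \<tau> u)" if u: "u \<in> cbox a b" for u
  proof -
    have "u \<in> \<phi> ` U" using u K(3) by blast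
    then have "metric_weight ?F0 (U, \<phi>) u = \<epsilon> * d0 u"
      using metric_weight_eq[OF card imm c] \<epsilon>[OF u] by (simp add: d0_def)
    then show ?thesis
      using jet[OF \<tau> inv[OF u]] jet[OF \<tau>' inv[OF u]] nz[OF c inv[OF u]]
      by (simp add: h_def d_def d0_def field_simps)
  qed
  have "integral\<^sup>L ?\<mu> h = integral (cbox a b) (\<lambda>u. h (?v u) * metric_weight ?F0 (U, \<phi>) u)"
  proof (rule integral_supported_in_chart[OF \<mu> continuous_metric_weight[OF card imm] _ c K(3)])
    show "0 \<le> metric_weight ?F0 (U, \<phi>) u" if "u \<in> \<phi> ` U" for u
      using metric_weight_eq[OF card imm c that] by simp
    show "h \<in> borel_measurable borel_algebra"
      unfolding h_def by (intro borel_measurable_diff meas \<tau> \<tau>')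
    show "h p = 0" if p: "p \<in> topspace X" "p \<notin> ?v ` cbox a b" for p
    proof -
      have "openin X (topspace X - ?v ` K)"
        using closedin_chart_compact[OF c K(1)] K(2,3) by (auto simp: closedin_def)
      moreover have "p \<in> topspace X - ?v ` K" using p K(2) by blast
      ultimately have "\<rho> \<tau>' p = \<rho> \<tau> p"
        unfolding \<rho>_def by (rule jet_ratio_cong) (use \<eta>(3) in \<open>auto simp: \<tau>'_def\<close>)
      then show ?thesis by (simp add: h_def)
    qed
    show "continuous_on (cbox a b) (\<lambda>u. h (?v u) * metric_weight ?F0 (U, \<phi>) u)"
    proof (rule continuous_on_eq)
      show "continuous_on (cbox a b) (\<lambda>u. \<epsilon> * (d \<tau>' u - d \<tau> u))"
        by (intro continuous_intros cont_d \<tau> \<tau>')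
    qed (rule hw[symmetric])
  qed
  also have "\<dots> = integral (cbox a b) (\<lambda>u. \<epsilon> * (d \<tau>' u - d \<tau> u))"
    by (rule integral_cong) (rule hw)
  also have "\<dots> = \<epsilon> * (integral (cbox a b) (d \<tau>') - integral (cbox a b) (d \<tau>))"
    by (simp add: integral_diff integrable_continuous cont_d \<tau> \<tau>')
  also have "\<dots> = 0"
    using integral_det_constant_in_chart[OF c \<tau> t(2) \<eta> K] by (simp add: d_def[abs_def] \<tau>'_def)
  finally have "integral\<^sup>L ?\<mu> (\<lambda>p. \<rho> \<tau>' p - \<rho> \<tau> p) = 0" unfolding h_def .
  then show "gauss_map_volume t0 \<tau>' = gauss_map_volume t0 \<tau>"
    using Bochner_Integration.integral_diff[OF int[OF \<tau>'] int[OF \<tau>]]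
    by (simp add: gauss_map_volume_def \<rho>_def)
qed

text \<open>Points that have reached the time \<open>t1\<close> are not moved again, so after one move for each member of
  a finite cover by regions \<open>\<eta> = 1\<close> every point has arrived.\<close>

lemma gauss_map_volume_constant:
  assumes t: "t0 \<in> I" "t1 \<in> I"
  shows "gauss_map_volume t0 (\<lambda>p. t1) = gauss_map_volume t0 (\<lambda>p. t0)"
proof -
  define good where "good p W \<longleftrightarrow> openin X W \<and> p \<in> W \<and> (\<forall>\<tau>. time_field \<tau> \<longrightarrow>
    (\<exists>\<sigma>. time_field \<sigma> \<and> gauss_map_volume t0 \<sigma> = gauss_map_volume t0 \<tau> \<and>
      (\<forall>q. \<tau> q = t1 \<or> q \<in> W \<longrightarrow> \<sigma> q = t1)))" for p W
  have "\<exists>W. good p W" if p: "p \<in> topspace X" for p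
  proof -
    obtain U \<phi> a b K \<eta> W where c: "(U, \<phi>) \<in> \<A>" and ab: "cbox a b \<subseteq> \<phi> ` U" and K: "compact K" "K \<subseteq> cbox a b"
      and \<eta>: "Ck_map 2 \<eta>" "\<forall>q. 0 \<le> \<eta> q \<and> \<eta> q \<le> (1::real)" "\<forall>q. q \<notin> inv_into U \<phi> ` K \<longrightarrow> \<eta> q = 0"
      and W: "openin X W" "p \<in> W" "\<forall>q\<in>W. \<eta> q = 1"
      using manifold_bump[OF p] by (elim exE conjE)
    have "\<exists>\<sigma>. time_field \<sigma> \<and> gauss_map_volume t0 \<sigma> = gauss_map_volume t0 \<tau> \<and>
        (\<forall>q. \<tau> q = t1 \<or> q \<in> W \<longrightarrow> \<sigma> q = t1)" if \<tau>: "time_field \<tau>" for \<tau>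
      using gauss_map_volume_local_change[OF c \<tau> t \<eta>(1) _ _ K ab] \<eta>(2,3) W(3)
      by (intro exI[of _ "\<lambda>p. \<tau> p + \<eta> p * (t1 - \<tau> p)"]) auto
    then show ?thesis using W(1,2) unfolding good_def by blast
  qed
  then obtain W where W: "\<And>p. p \<in> topspace X \<Longrightarrow> good p (W p)" by metis
  then have "openin X (W p) \<and> p \<in> W p" if "p \<in> topspace X" for p using that unfolding good_def by blast
  then obtain P where P: "finite P" "P \<subseteq> topspace X" "topspace X = (\<Union>p\<in>P. W p)"
    by (rule finite_cover)
  have "\<exists>\<tau>. time_field \<tau> \<and> gauss_map_volume t0 \<tau> = gauss_map_volume t0 (\<lambda>p. t0) \<and> (\<forall>q\<in>\<Union>p\<in>P. W p. \<tau> q = t1)"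
    using P(1,2)
  proof (induction P rule: finite_induct)
    case empty
    have "time_field (\<lambda>p. t0)" using t(1) Ck_map_const by (simp add: time_field_def)
    then show ?case by auto
  next
    case (insert p P)
    then obtain \<tau> where \<tau>: "time_field \<tau>" "gauss_map_volume t0 \<tau> = gauss_map_volume t0 (\<lambda>p. t0)" "\<forall>q\<in>\<Union>p\<in>P. W p. \<tau> q = t1"
      by auto
    have "good p (W p)" using W insert.prems by simp
    then obtain \<sigma> where \<sigma>: "time_field \<sigma>" "gauss_map_volume t0 \<sigma> = gauss_map_volume t0 \<tau>"
        "\<forall>q. \<tau> q = t1 \<or> q \<in> W p \<longrightarrow> \<sigma> q = t1"
      using \<tau>(1) unfolding good_def by blast
    then show ?case using \<tau> by (intro exI[of _ \<sigma>]) auto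
  qed
  then obtain \<tau> where \<tau>: "gauss_map_volume t0 \<tau> = gauss_map_volume t0 (\<lambda>p. t0)" "\<forall>q\<in>topspace X. \<tau> q = t1"
    using P(3) by auto
  let ?\<mu> = "surface_element X \<A> (\<lambda>p. F p t0)"
  have "sets ?\<mu> = sets borel_algebra"
    using surface_element_has_density[OF card immersion_at[OF t(1)]] by (simp add: has_chart_density_def)
  then have sp: "space ?\<mu> = topspace X" using sets_eq_imp_space_eq[of ?\<mu> borel_algebra] by simp
  have "gauss_map_volume t0 (\<lambda>p. t1) = gauss_map_volume t0 \<tau>"
    unfolding gauss_map_volume_def
    by (rule Bochner_Integration.integral_cong[OF refl], rule jet_ratio_cong[of "topspace X"]) (use \<tau>(2) in \<open>auto simp: sp\<close>)
  then show ?thesis using \<tau>(1) by simp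
qed

lemma total_curvature_constant:
  assumes t: "t0 \<in> I" "t1 \<in> I"
  shows "total_curvature X \<A> (\<lambda>p. F p t0) (\<lambda>p. N p t0) = total_curvature X \<A> (\<lambda>p. F p t1) (\<lambda>p. N p t1)"
proof -
  have "total_curvature X \<A> (\<lambda>p. F p t) (\<lambda>p. N p t) = (-1) ^ CARD('n) * gauss_map_volume t0 (\<lambda>p. t)" if "t \<in> I" for t
    unfolding gauss_map_volume_def
    by (rule total_curvature_relative[OF card immersion_at[OF that] immersion_at[OF t(1)] density_ratio_positive[OF t(1) that]])
  then show ?thesis using gauss_map_volume_constant[OF t] t by simp
qed

end

theorem mainTheorem1:
  fixes X :: "'a topology"
    and \<A> :: "('a, 'n::finite) chart set"
    and I :: "real set"
    and F N :: "'a \<Rightarrow> real \<Rightarrow> real ^ 'm::finite"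
  assumes "CARD('m) = CARD('n) + 1"
    and "open I" and "is_interval I"
    and "closed_smooth_manifold X \<A>"
    and "smooth_evolution X \<A> I F N"
  shows "(\<forall>t\<in>I. ((\<lambda>s. total_curvature X \<A> (\<lambda>p. F p s) (\<lambda>p. N p s))
            has_real_derivative 0) (at t)) \<and>
         (\<forall>t\<^sub>0\<in>I. \<forall>t\<^sub>1\<in>I.
            total_curvature X \<A> (\<lambda>p. F p t\<^sub>0) (\<lambda>p. N p t\<^sub>0) =
            total_curvature X \<A> (\<lambda>p. F p t\<^sub>1) (\<lambda>p. N p t\<^sub>1))"
proof -
  interpret evolving_hypersurface X \<A> I F N
    by unfold_locales (use assms in auto)
  let ?T = "\<lambda>s. total_curvature X \<A> (\<lambda>p. F p s) (\<lambda>p. N p s)"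
  have "(?T has_real_derivative 0) (at t)" if t: "t \<in> I" for t
    by (rule has_field_derivative_transform_within_open[OF DERIV_const assms(2) t, of "?T t"])
      (rule total_curvature_constant[OF t])
  then show ?thesis using total_curvature_constant by blast
qed

end
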